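(* Let $R$ be an indecomposable commutative ring. Let $(\Sigma_1,i_1,q_1)$ and $(\Sigma_2,i_2,q_2)$ be discrete $R$-twists over ample Hausdorff groupoids $G_1$ and $G_2$, respectively. Suppose that $(\Sigma_1,i_1,q_1)$ satisfies the local bisection hypothesis. The following are equivalent. (1) The twists $(\Sigma_1,i_1,q_1)$ and $(\Sigma_2,i_2,q_2)$ are isomorphic. (2) There exists a diagonal-preserving isomorphism of $R$-algebras $\Psi\colon A_R(G_1;\Sigma_1)\to A_R(G_2;\Sigma_2)$.
   Context: **Rings and groupoids.** A commutative ring $R$ with identity is indecomposable if $0\neq1$ and its only idempotents are $0$ and $1$. $R^\times$ is its group of units, with the discrete topology. Groupoids are locally compact topological groupoids with Hausdorff unit space $G^{(0)}$ and range/source maps $r,s$. A bisection is a subset $D$ contained in an open set $O$ such that $r|_O,s|_O$ are homeomorphisms onto open subsets of $G^{(0)}$. $G$ is étale if $r$ is a local homeomorphism, and ample if it is étale with a basis of compact open bisections. **Twists.** A discrete $R$-twist $(\Sigma,i,q)$ over an étale groupoid $G$ is a sequence $G^{(0)}\times R^\times\xrightarrow{i}\Sigma\xrightarrow{q}G$, where $G^{(0)}\times R^\times$ is the trivial group bundle, $\Sigma$ is a topological groupoid with $\Sigma^{(0)}=i(G^{(0)}\times\{1\})$ (identified with $G^{(0)}$), and $i,q$ are continuous groupoid homomorphisms restricting to homeomorphisms of unit spaces, such that: (DT1) $i(\{x\}\times R^\times)=q^{-1}(x)$ for $x\in G^{(0)}$, $i$ injective, $q$ surjective; (DT2) each $\alpha\in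 G$ has an open bisection $B_\alpha\ni\alpha$ and a continuous $P_\alpha\colon B_\alpha\to\Sigma$ with $q\circ P_\alpha=\mathrm{id}$ and $(\beta,t)\mapsto i(r(\beta),t)P_\alpha(\beta)$ a homeomorphism $B_\alpha\times R^\times\to q^{-1}(B_\alpha)$; (DT3) $i(r(\sigma),t)\sigma=\sigma i(s(\sigma),t)$. Write $t\cdot\sigma=i(r(\sigma),t)\sigma$. Two twists $(\Sigma_1,i_1,q_1)$ over $G_1$ and $(\Sigma_2,i_2,q_2)$ over $G_2$ are isomorphic if there are isomorphisms of topological groupoids $\psi\colon\Sigma_1\to\Sigma_2$ and $\psi_G\colon G_1\to G_2$ with $\psi\circ i_1=i_2\circ(\psi_G|_{G_1^{(0)}}\times\mathrm{id})$ and $q_2\circ\psi=\psi_G\circ q_1$. **Twisted Steinberg algebra.** $\operatorname{supp}(f)=\{f\neq0\}$, $\operatorname{supp}_G(f)=q(\operatorname{supp}(f))$. For $G$ ample Hausdorff, $A_R(G;\Sigma)$ is the set of locally constant $f\colon\Sigma\to R$ with $f(t\cdot\sigma)=t^{-1}f(\sigma)$ for $t\in R^\times$ and $q(\operatorname{supp}(f))$ compact; it is an $R$-algebra under pointwise operations and $(f*g)(\sigma)=\sum_{\alpha\in r^{-1}(r(\sigma))\cap\operatorname{supp}_G(f)}f(S(\alpha))g(S(\alpha)^{-1}\sigma)$, with $S\colon\operatorname{supp}_G(f)\to\operatorname{supp}(f)$ any section for $q$. $A_R(G^{(0)};q^{-1}(G^{(0)}))$ is the commutative subalgebra of those $f$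 supported in $q^{-1}(G^{(0)})$ (the diagonal subalgebra). An isomorphism $\Psi\colon A_R(G_1;\Sigma_1)\to A_R(G_2;\Sigma_2)$ is diagonal-preserving if $\Psi\big(A_R(G_1^{(0)};q_1^{-1}(G_1^{(0)}))\big)=A_R(G_2^{(0)};q_2^{-1}(G_2^{(0)}))$. **Local bisection hypothesis.** With $A=A_R(G;\Sigma)$, $B=A_R(G^{(0)};q^{-1}(G^{(0)}))$, a normaliser of $B$ in $A$ is an element $n\in A$ for which there is $k\in A$ with $knk=k$, $nkn=n$ and $kBn\cup nBk\subseteq B$. The twist satisfies the local bisection hypothesis if $\operatorname{supp}_G(n)$ is a bisection of $G$ for every normaliser $n$ of $B$ in $A$. *)

theory Defs
  imports "HOL-Analysis.Analysis"
begin

section \<open>Indecomposable rings and units\<close>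

definition indecomposable_ring :: "'r::comm_ring_1 itself \<Rightarrow> bool" where
  "indecomposable_ring _ \<longleftrightarrow>
     (0::'r) \<noteq> 1 \<and> (\<forall>e::'r. e * e = e \<longrightarrow> e = 0 \<or> e = 1)"

definition Units_R :: "'r::comm_ring_1 set" where
  "Units_R = {t. \<exists>u. t * u = 1}"

definition unit_inv :: "'r::comm_ring_1 \<Rightarrow> 'r" where
  "unit_inv t = (THE u. t * u = 1)"


section \<open>Topological groupoids\<close>

text \<open>
  The set of arrows is the underlying set of the topology, and units are identified with
  identity arrows. The operations are total functions; their values
  outside the arrows, or on non-composable pairs, carry no meaning.
\<close>

record 'a tgroupoid =
  arr_top :: "'a topology"
  rng :: "'a \<Rightarrow> 'a"
  src :: "'a \<Rightarrow> 'a"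
  mul :: "'a \<Rightarrow> 'a \<Rightarrow> 'a"
  ginv :: "'a \<Rightarrow> 'a"

abbreviation arr :: "'a tgroupoid \<Rightarrow> 'a set" where
  "arr G \<equiv> topspace (arr_top G)"

definition gunits :: "'a tgroupoid \<Rightarrow> 'a set" where
  "gunits G = rng G ` arr G"

definition unit_space :: "'a tgroupoid \<Rightarrow> 'a topology" where
  "unit_space G = subtopology (arr_top G) (gunits G)"

definition composable :: "'a tgroupoid \<Rightarrow> ('a \<times> 'a) set" where
  "composable G = {(a, b). a \<in> arr G \<and> b \<in> arr G \<and> src G a = rng G b}"

definition is_groupoid :: "'a tgroupoid \<Rightarrow> bool" where
  "is_groupoid G \<longleftrightarrow>
     (\<forall>a\<in>arr G. rng G a \<in> arr G \<and> src G a \<in> arr G \<and> ginv G a \<in> arr G) \<and>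
     (\<forall>a\<in>arr G. rng G (rng G a) = rng G a \<and> src G (rng G a) = rng G a \<and>
                rng G (src G a) = src G a \<and> src G (src G a) = src G a) \<and>
     (\<forall>(a, b)\<in>composable G. mul G a b \<in> arr G \<and>
                rng G (mul G a b) = rng G a \<and> src G (mul G a b) = src G b) \<and>
     (\<forall>a b c. (a, b) \<in> composable G \<longrightarrow> (b, c) \<in> composable G \<longrightarrow>
                mul G (mul G a b) c = mul G a (mul G b c)) \<and>
     (\<forall>a\<in>arr G. mul G (rng G a) a = a \<and> mul G a (src G a) = a) \<and>
     (\<forall>a\<in>arr G. rng G (ginv G a) = src G a \<and> src G (ginv G a) = rng G a \<and>
                mul G a (ginv G a) = rng G a \<and> mul G (ginv G a) a = src G a)"

text \<open>
  All groupoids are locally compact with Hausdorff unit space. (For the middle term of a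
  discrete twist these two properties also follow from local triviality.)
\<close>

definition topological_groupoid :: "'a tgroupoid \<Rightarrow> bool" where
  "topological_groupoid G \<longleftrightarrow>
     is_groupoid G \<and>
     continuous_map (arr_top G) (unit_space G) (rng G) \<and>
     continuous_map (arr_top G) (unit_space G) (src G) \<and>
     continuous_map (subtopology (prod_topology (arr_top G) (arr_top G)) (composable G))
       (arr_top G) (\<lambda>(a, b). mul G a b) \<and>
     continuous_map (arr_top G) (arr_top G) (ginv G) \<and>
     locally_compact_space (arr_top G) \<and>
     Hausdorff_space (unit_space G)"

definition homeo_onto_open :: "'a tgroupoid \<Rightarrow> 'a set \<Rightarrow> ('a \<Rightarrow> 'a) \<Rightarrow> bool" where
  "homeo_onto_open G U f \<longleftrightarrow>
     openin (unit_space G) (f ` U) \<and>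
     homeomorphic_map (subtopology (arr_top G) U) (subtopology (unit_space G) (f ` U)) f"

definition bisection :: "'a tgroupoid \<Rightarrow> 'a set \<Rightarrow> bool" where
  "bisection G D \<longleftrightarrow>
     (\<exists>U. openin (arr_top G) U \<and> D \<subseteq> U \<and>
          homeo_onto_open G U (rng G) \<and> homeo_onto_open G U (src G))"

definition etale :: "'a tgroupoid \<Rightarrow> bool" where
  "etale G \<longleftrightarrow> topological_groupoid G \<and>
     (\<forall>a\<in>arr G. \<exists>U. openin (arr_top G) U \<and> a \<in> U \<and> homeo_onto_open G U (rng G))"

definition ample :: "'a tgroupoid \<Rightarrow> bool" where
  "ample G \<longleftrightarrow> etale G \<and>
     (\<forall>U a. openin (arr_top G) U \<longrightarrow> a \<in> U \<longrightarrow>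
        (\<exists>K. compactin (arr_top G) K \<and> openin (arr_top G) K \<and> bisection G K \<and>
             a \<in> K \<and> K \<subseteq> U))"

definition groupoid_hom :: "'a tgroupoid \<Rightarrow> 'b tgroupoid \<Rightarrow> ('a \<Rightarrow> 'b) \<Rightarrow> bool" where
  "groupoid_hom G H f \<longleftrightarrow>
     f ` arr G \<subseteq> arr H \<and>
     (\<forall>(a, b)\<in>composable G. (f a, f b) \<in> composable H \<and> f (mul G a b) = mul H (f a) (f b))"

text \<open>
  Homomorphisms as above automatically respect range, source and inverses, and the inverse of a
  bijective homomorphism is again a homomorphism.
\<close>

definition tgroupoid_iso :: "'a tgroupoid \<Rightarrow> 'b tgroupoid \<Rightarrow> ('a \<Rightarrow> 'b) \<Rightarrow> bool" where
  "tgroupoid_iso G H f \<longleftrightarrow> groupoid_hom G H f \<and> homeomorphic_map (arr_top G) (arr_top H) f"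


section \<open>Discrete twists\<close>

definition trivial_bundle :: "'a tgroupoid \<Rightarrow> ('a \<times> 'r::comm_ring_1) tgroupoid" where
  "trivial_bundle G =
     \<lparr> arr_top = prod_topology (unit_space G) (discrete_topology Units_R),
       rng = (\<lambda>(x, t). (x, 1)),
       src = (\<lambda>(x, t). (x, 1)),
       mul = (\<lambda>(x, t) (y, u). (x, t * u)),
       ginv = (\<lambda>(x, t). (x, unit_inv t)) \<rparr>"

text \<open>
  The unit space of the twist \<open>S\<close> is identified with that of \<open>G\<close> by \<open>x \<mapsto> i (x, 1)\<close>, whose
  inverse is the restriction of \<open>q\<close>. Accordingly the usual \<open>i(r(\<sigma>), t)\<close>
  is rendered as \<open>i (q (rng S \<sigma>), t)\<close>.
\<close>

definition twist_act ::
  "'b tgroupoid \<Rightarrow> ('a \<times> 'r \<Rightarrow> 'b) \<Rightarrow> ('b \<Rightarrow> 'a) \<Rightarrow> 'r \<Rightarrow> 'b \<Rightarrow> 'b" where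
  "twist_act S i q t \<sigma> = mul S (i (q (rng S \<sigma>), t)) \<sigma>"

definition discrete_twist ::
  "'a tgroupoid \<Rightarrow> 'b tgroupoid \<Rightarrow> ('a \<times> 'r::comm_ring_1 \<Rightarrow> 'b) \<Rightarrow> ('b \<Rightarrow> 'a) \<Rightarrow> bool" where
  "discrete_twist G S i q \<longleftrightarrow>
     etale G \<and> topological_groupoid S \<and>
     gunits S = i ` (gunits G \<times> {1}) \<and>
     groupoid_hom (trivial_bundle G) S i \<and>
     continuous_map (arr_top (trivial_bundle G :: ('a \<times> 'r) tgroupoid)) (arr_top S) i \<and>
     homeomorphic_map (unit_space (trivial_bundle G :: ('a \<times> 'r) tgroupoid)) (unit_space S) i \<and>
     groupoid_hom S G q \<and>
     continuous_map (arr_top S) (arr_top G) q \<and>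
     homeomorphic_map (unit_space S) (unit_space G) q \<and>
     (\<forall>x\<in>gunits G. i ` ({x} \<times> Units_R) = {\<sigma>\<in>arr S. q \<sigma> = x}) \<and>
     inj_on i (gunits G \<times> Units_R) \<and>
     q ` arr S = arr G \<and>
     (\<forall>\<alpha>\<in>arr G. \<exists>B P. openin (arr_top G) B \<and> bisection G B \<and> \<alpha> \<in> B \<and>
        continuous_map (subtopology (arr_top G) B) (arr_top S) P \<and>
        (\<forall>\<beta>\<in>B. q (P \<beta>) = \<beta>) \<and>
        homeomorphic_map
          (prod_topology (subtopology (arr_top G) B) (discrete_topology (Units_R :: 'r set)))
          (subtopology (arr_top S) {\<sigma>\<in>arr S. q \<sigma> \<in> B})
          (\<lambda>(\<beta>, t). mul S (i (rng G \<beta>, t)) (P \<beta>))) \<and>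
     (\<forall>\<sigma>\<in>arr S. \<forall>t\<in>Units_R.
        mul S (i (q (rng S \<sigma>), t)) \<sigma> = mul S \<sigma> (i (q (src S \<sigma>), t)))"

definition twists_isomorphic ::
  "'a tgroupoid \<Rightarrow> 'b tgroupoid \<Rightarrow> ('a \<times> 'r::comm_ring_1 \<Rightarrow> 'b) \<Rightarrow> ('b \<Rightarrow> 'a) \<Rightarrow>
   'c tgroupoid \<Rightarrow> 'd tgroupoid \<Rightarrow> ('c \<times> 'r \<Rightarrow> 'd) \<Rightarrow> ('d \<Rightarrow> 'c) \<Rightarrow> bool" where
  "twists_isomorphic G1 S1 i1 q1 G2 S2 i2 q2 \<longleftrightarrow>
     (\<exists>\<psi> \<psi>G. tgroupoid_iso S1 S2 \<psi> \<and> tgroupoid_iso G1 G2 \<psi>G \<and>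
        (\<forall>x\<in>gunits G1. \<forall>t\<in>Units_R. \<psi> (i1 (x, t)) = i2 (\<psi>G x, t)) \<and>
        (\<forall>\<sigma>\<in>arr S1. q2 (\<psi> \<sigma>) = \<psi>G (q1 \<sigma>)))"


section \<open>Twisted Steinberg algebras\<close>

definition fsupp :: "'b tgroupoid \<Rightarrow> ('b \<Rightarrow> 'r::comm_ring_1) \<Rightarrow> 'b set" where
  "fsupp S f = {\<sigma>\<in>arr S. f \<sigma> \<noteq> 0}"

definition suppG :: "'b tgroupoid \<Rightarrow> ('b \<Rightarrow> 'a) \<Rightarrow> ('b \<Rightarrow> 'r::comm_ring_1) \<Rightarrow> 'a set" where
  "suppG S q f = q ` fsupp S f"

text \<open>
  A function on the arrows of \<open>S\<close> is represented by its extension by zero to the whole type.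
\<close>

definition steinberg ::
  "'a tgroupoid \<Rightarrow> 'b tgroupoid \<Rightarrow> ('a \<times> 'r::comm_ring_1 \<Rightarrow> 'b) \<Rightarrow> ('b \<Rightarrow> 'a) \<Rightarrow> ('b \<Rightarrow> 'r) set" where
  "steinberg G S i q =
     {f. (\<forall>\<sigma>. \<sigma> \<notin> arr S \<longrightarrow> f \<sigma> = 0) \<and>
         (\<forall>\<sigma>\<in>arr S. \<exists>U. openin (arr_top S) U \<and> \<sigma> \<in> U \<and> (\<forall>\<tau>\<in>U. f \<tau> = f \<sigma>)) \<and>
         (\<forall>t\<in>Units_R. \<forall>\<sigma>\<in>arr S. f (twist_act S i q t \<sigma>) = unit_inv t * f \<sigma>) \<and>
         compactin (arr_top G) (suppG S q f)}"

text \<open>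
  Convolution, with the section of \<open>q\<close> over \<open>suppG S q f\<close> picked by a choice operator: on
  \<open>steinberg G S i q\<close> the value does not depend on it, by equivariance, and the sum is finite
  when \<open>G\<close> is Hausdorff.
\<close>

definition supp_section ::
  "'b tgroupoid \<Rightarrow> ('b \<Rightarrow> 'a) \<Rightarrow> ('b \<Rightarrow> 'r::comm_ring_1) \<Rightarrow> 'a \<Rightarrow> 'b" where
  "supp_section S q f \<alpha> = (SOME \<sigma>. \<sigma> \<in> fsupp S f \<and> q \<sigma> = \<alpha>)"

definition conv ::
  "'a tgroupoid \<Rightarrow> 'b tgroupoid \<Rightarrow> ('b \<Rightarrow> 'a) \<Rightarrow>
   ('b \<Rightarrow> 'r::comm_ring_1) \<Rightarrow> ('b \<Rightarrow> 'r) \<Rightarrow> 'b \<Rightarrow> 'r" where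
  "conv G S q f g \<sigma> =
     (if \<sigma> \<in> arr S then
        \<Sum>\<alpha> \<in> {\<alpha>\<in>arr G. rng G \<alpha> = q (rng S \<sigma>)} \<inter> suppG S q f.
          f (supp_section S q f \<alpha>) * g (mul S (ginv S (supp_section S q f \<alpha>)) \<sigma>)
      else 0)"

definition diagonal ::
  "'a tgroupoid \<Rightarrow> 'b tgroupoid \<Rightarrow> ('a \<times> 'r::comm_ring_1 \<Rightarrow> 'b) \<Rightarrow> ('b \<Rightarrow> 'a) \<Rightarrow> ('b \<Rightarrow> 'r) set" where
  "diagonal G S i q =
     {f \<in> steinberg G S i q. fsupp S f \<subseteq> {\<sigma>\<in>arr S. q \<sigma> \<in> gunits G}}"

definition normaliser ::
  "'a tgroupoid \<Rightarrow> 'b tgroupoid \<Rightarrow> ('a \<times> 'r::comm_ring_1 \<Rightarrow> 'b) \<Rightarrow> ('b \<Rightarrow> 'a) \<Rightarrow> ('b \<Rightarrow> 'r) \<Rightarrow> bool"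
  where
  "normaliser G S i q n \<longleftrightarrow>
     n \<in> steinberg G S i q \<and>
     (\<exists>k\<in>steinberg G S i q.
        conv G S q (conv G S q k n) k = k \<and>
        conv G S q (conv G S q n k) n = n \<and>
        (\<forall>b\<in>diagonal G S i q.
           conv G S q (conv G S q k b) n \<in> diagonal G S i q \<and>
           conv G S q (conv G S q n b) k \<in> diagonal G S i q))"

definition local_bisection_hypothesis ::
  "'a tgroupoid \<Rightarrow> 'b tgroupoid \<Rightarrow> ('a \<times> 'r::comm_ring_1 \<Rightarrow> 'b) \<Rightarrow> ('b \<Rightarrow> 'a) \<Rightarrow> bool" where
  "local_bisection_hypothesis G S i q \<longleftrightarrow>
     (\<forall>n. normaliser G S i q n \<longrightarrow> bisection G (suppG S q n))"

text \<open>
  The algebras need not be unital, so no condition on a unit is imposed.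
\<close>

definition steinberg_iso ::
  "'a tgroupoid \<Rightarrow> 'b tgroupoid \<Rightarrow> ('a \<times> 'r::comm_ring_1 \<Rightarrow> 'b) \<Rightarrow> ('b \<Rightarrow> 'a) \<Rightarrow>
   'c tgroupoid \<Rightarrow> 'd tgroupoid \<Rightarrow> ('c \<times> 'r \<Rightarrow> 'd) \<Rightarrow> ('d \<Rightarrow> 'c) \<Rightarrow>
   (('b \<Rightarrow> 'r) \<Rightarrow> ('d \<Rightarrow> 'r)) \<Rightarrow> bool" where
  "steinberg_iso G1 S1 i1 q1 G2 S2 i2 q2 \<Psi> \<longleftrightarrow>
     bij_betw \<Psi> (steinberg G1 S1 i1 q1) (steinberg G2 S2 i2 q2) \<and>
     (\<forall>f\<in>steinberg G1 S1 i1 q1. \<forall>g\<in>steinberg G1 S1 i1 q1.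
        \<Psi> (\<lambda>\<sigma>. f \<sigma> + g \<sigma>) = (\<lambda>\<tau>. \<Psi> f \<tau> + \<Psi> g \<tau>) \<and>
        \<Psi> (conv G1 S1 q1 f g) = conv G2 S2 q2 (\<Psi> f) (\<Psi> g)) \<and>
     (\<forall>c. \<forall>f\<in>steinberg G1 S1 i1 q1. \<Psi> (\<lambda>\<sigma>. c * f \<sigma>) = (\<lambda>\<tau>. c * \<Psi> f \<tau>))"

definition diagonal_preserving ::
  "'a tgroupoid \<Rightarrow> 'b tgroupoid \<Rightarrow> ('a \<times> 'r::comm_ring_1 \<Rightarrow> 'b) \<Rightarrow> ('b \<Rightarrow> 'a) \<Rightarrow>
   'c tgroupoid \<Rightarrow> 'd tgroupoid \<Rightarrow> ('c \<times> 'r \<Rightarrow> 'd) \<Rightarrow> ('d \<Rightarrow> 'c) \<Rightarrow>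
   (('b \<Rightarrow> 'r) \<Rightarrow> ('d \<Rightarrow> 'r)) \<Rightarrow> bool" where
  "diagonal_preserving G1 S1 i1 q1 G2 S2 i2 q2 \<Psi> \<longleftrightarrow>
     \<Psi> ` diagonal G1 S1 i1 q1 = diagonal G2 S2 i2 q2"

end

theory Submission
  imports Defs
begin

text \<open>
  An isomorphism of twists acts on functions by composition, and the two convolution sums correspond
  term by term along the isomorphism of the base groupoids (\<open>algebras_isomorphic\<close>). The converse is
  a reconstruction of the twist from the algebra and its diagonal.

  An arrow \<open>\<sigma>\<close> of a twist is determined by its source together with any monomial \<open>n\<close> normalised at
  it, that is, a unit-valued function supported on a bisection and with \<open>n \<sigma> = 1\<close>: the set where
  \<open>n\<close> is one is open and the source map is injective on it. Such monomials exist at every arrow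
  (\<open>ex_monomial\<close>), and products of monomials normalised at \<open>\<sigma>\<close> and \<open>\<tau>\<close> are normalised at the
  product \<open>\<sigma> \<tau>\<close> (\<open>conv_mul\<close>). So the arrows, their multiplication and their topology are
  encoded in the monomials and in the points of the unit space, and it remains to see that an
  isomorphism \<open>\<Psi>\<close> of algebras preserving the diagonals transports both.

  The points: since the ring is indecomposable, the idempotents of the diagonal are the indicator
  functions \<open>e K\<close> of compact open sets of units (\<open>idempotent_D\<close>). Hence \<open>\<Psi>\<close> induces a bijection
  between compact open sets that preserves intersections, and by Stone duality this comes from a
  homeomorphism \<open>\<phi>\<close> of the unit spaces (\<open>stone_homeomorphism\<close>).

  The monomials: they are normalisers of the diagonal, and being a normaliser is invariant under
  \<open>\<Psi>\<close>. If the target satisfies the local bisection hypothesis, the image of a monomial is supported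
  on a bisection, and it is unit-valued because its product with its partner is some \<open>e K\<close>
  (\<open>\<Psi>_N\<close>). The theorem assumes the hypothesis for the first twist, so the reconstruction is
  applied to the inverse of the given isomorphism.

  Now \<open>\<tau>\<close> goes to the arrow with source \<open>\<phi>\<close> of the source of \<open>\<tau>\<close> at which \<open>\<Psi> n\<close> is one, for
  any monomial \<open>n\<close> normalised at \<open>\<tau>\<close>. Two monomials normalised at \<open>\<tau>\<close> have the same product
  with \<open>e K\<close> for a small neighbourhood \<open>K\<close> of the source (\<open>germ\<close>); this is a statement about
  the algebra, so the choice of \<open>n\<close> does not matter (\<open>image_independent\<close>), and the same argument
  read backwards gives injectivity (\<open>\<psi>_inj\<close>). Surjectivity holds because the monomials span the
  algebra (\<open>span_induct\<close>), so that every arrow of the target lies in the support of the image of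
  one of them (\<open>\<psi>_surj\<close>).
\<close>

section \<open>Units of the ring\<close>

lemma unit_inv_eqI: "(t::'r::comm_ring_1) * u = 1 \<Longrightarrow> unit_inv t = u"
  unfolding unit_inv_def
proof (rule the_equality)
  fix v assume "t * u = 1" "t * v = 1"
  then show "v = u"
    by (metis mult.assoc mult.commute mult.right_neutral)
qed

lemma unit_inv_right: "t \<in> Units_R \<Longrightarrow> t * unit_inv t = (1::'r::comm_ring_1)"
  unfolding Units_R_def using unit_inv_eqI by fastforce

lemma unit_inv_left: "t \<in> Units_R \<Longrightarrow> unit_inv t * t = (1::'r::comm_ring_1)"
  by (simp add: unit_inv_right mult.commute)

lemma one_Units [simp]: "1 \<in> Units_R"
  unfolding Units_R_def by auto

lemma unit_inv_Units [simp]: "t \<in> Units_R \<Longrightarrow> unit_inv t \<in> Units_R"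
  unfolding Units_R_def using unit_inv_eqI by (force simp: mult.commute)

lemma mult_Units [simp]: "t \<in> Units_R \<Longrightarrow> u \<in> Units_R \<Longrightarrow> t * u \<in> (Units_R :: 'r::comm_ring_1 set)"
  unfolding Units_R_def by clarsimp (metis mult.assoc mult.commute mult.right_neutral)

lemma unit_inv_one [simp]: "unit_inv 1 = 1"
  by (rule unit_inv_eqI) simp

lemma unit_inv_unit_inv [simp]: "t \<in> Units_R \<Longrightarrow> unit_inv (unit_inv t) = t"
  by (rule unit_inv_eqI) (rule unit_inv_left)

lemma unit_inv_mult:
  assumes "t \<in> Units_R" "u \<in> Units_R"
  shows "unit_inv (t * u) = unit_inv t * unit_inv u"
proof (rule unit_inv_eqI)
  have "t * u * (unit_inv t * unit_inv u) = (t * unit_inv t) * (u * unit_inv u)"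
    by (simp add: ac_simps)
  then show "t * u * (unit_inv t * unit_inv u) = 1"
    by (simp add: unit_inv_right assms)
qed

lemma unit_inv_cancel [simp]:
  assumes "t \<in> Units_R"
  shows "unit_inv t * (t * a) = a" "t * (unit_inv t * a) = a"
  by (simp_all add: assms unit_inv_left unit_inv_right flip: mult.assoc)

lemma Units_mult_eq_0_iff [simp]:
  assumes "t \<in> Units_R"
  shows "t * a = 0 \<longleftrightarrow> a = (0::'r::comm_ring_1)"
  using unit_inv_cancel(1)[OF assms, of a] by auto

section \<open>Groupoids\<close>

locale groupoid =
  fixes G :: "'a tgroupoid"
  assumes is_groupoid: "is_groupoid G"
begin

lemma rng_arr [simp]: "a \<in> arr G \<Longrightarrow> rng G a \<in> arr G"
  and src_arr [simp]: "a \<in> arr G \<Longrightarrow> src G a \<in> arr G"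
  and inv_arr [simp]: "a \<in> arr G \<Longrightarrow> ginv G a \<in> arr G"
  and rng_rng [simp]: "a \<in> arr G \<Longrightarrow> rng G (rng G a) = rng G a"
  and src_rng [simp]: "a \<in> arr G \<Longrightarrow> src G (rng G a) = rng G a"
  and rng_src [simp]: "a \<in> arr G \<Longrightarrow> rng G (src G a) = src G a"
  and src_src [simp]: "a \<in> arr G \<Longrightarrow> src G (src G a) = src G a"
  and mul_rng [simp]: "a \<in> arr G \<Longrightarrow> mul G (rng G a) a = a"
  and mul_src [simp]: "a \<in> arr G \<Longrightarrow> mul G a (src G a) = a"
  and rng_inv [simp]: "a \<in> arr G \<Longrightarrow> rng G (ginv G a) = src G a"
  and src_inv [simp]: "a \<in> arr G \<Longrightarrow> src G (ginv G a) = rng G a"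
  and mul_inv [simp]: "a \<in> arr G \<Longrightarrow> mul G a (ginv G a) = rng G a"
  and inv_mul [simp]: "a \<in> arr G \<Longrightarrow> mul G (ginv G a) a = src G a"
  using is_groupoid unfolding is_groupoid_def by blast+

lemma mul_arr [simp]: "a \<in> arr G \<Longrightarrow> b \<in> arr G \<Longrightarrow> src G a = rng G b \<Longrightarrow> mul G a b \<in> arr G"
  and rng_mul [simp]: "a \<in> arr G \<Longrightarrow> b \<in> arr G \<Longrightarrow> src G a = rng G b \<Longrightarrow> rng G (mul G a b) = rng G a"
  and src_mul [simp]: "a \<in> arr G \<Longrightarrow> b \<in> arr G \<Longrightarrow> src G a = rng G b \<Longrightarrow> src G (mul G a b) = src G b"
  using is_groupoid unfolding is_groupoid_def composable_def by auto

lemma mul_assoc: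
  "a \<in> arr G \<Longrightarrow> b \<in> arr G \<Longrightarrow> c \<in> arr G \<Longrightarrow> src G a = rng G b \<Longrightarrow> src G b = rng G c \<Longrightarrow>
   mul G (mul G a b) c = mul G a (mul G b c)"
  using is_groupoid unfolding is_groupoid_def composable_def by auto

lemma cancel_inv_left [simp]:
  assumes "a \<in> arr G" "b \<in> arr G" "src G a = rng G b"
  shows "mul G (ginv G a) (mul G a b) = b"
  using assms by (simp flip: mul_assoc)

lemma cancel_left_inv [simp]:
  assumes "a \<in> arr G" "b \<in> arr G" "rng G a = rng G b"
  shows "mul G a (mul G (ginv G a) b) = b"
  using assms by (simp flip: mul_assoc)

lemma inv_unique:
  assumes "a \<in> arr G" "b \<in> arr G" "src G a = rng G b" "mul G a b = rng G a"
  shows "b = ginv G a"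
  using cancel_inv_left[of a b] assms mul_src[of "ginv G a"] by simp

lemma inv_inv [simp]: "a \<in> arr G \<Longrightarrow> ginv G (ginv G a) = a"
  using inv_unique[of "ginv G a" a] by simp

lemma gunits_arr [simp]: "x \<in> gunits G \<Longrightarrow> x \<in> arr G"
  and gunits_rng [simp]: "x \<in> gunits G \<Longrightarrow> rng G x = x"
  and gunits_src [simp]: "x \<in> gunits G \<Longrightarrow> src G x = x"
  unfolding gunits_def by auto

lemma rng_gunits [simp]: "a \<in> arr G \<Longrightarrow> rng G a \<in> gunits G"
  unfolding gunits_def by auto

lemma src_gunits [simp]: "a \<in> arr G \<Longrightarrow> src G a \<in> gunits G"
  using rng_src[of a] rng_gunits[of "src G a"] by simp

lemma gunits_sub: "gunits G \<subseteq> arr G"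
  by auto

lemma inv_unit [simp]: "x \<in> gunits G \<Longrightarrow> ginv G x = x"
  by (metis gunits_arr gunits_rng gunits_src inv_unique mul_rng)

lemma gunits_iff: "x \<in> gunits G \<longleftrightarrow> x \<in> arr G \<and> rng G x = x"
  using gunits_arr gunits_rng rng_gunits by metis

lemma idem_unit:
  assumes "a \<in> arr G" "src G a = rng G a" "mul G a a = a"
  shows "a \<in> gunits G"
proof -
  have "a = src G a"
    using cancel_inv_left[of a a] assms by simp
  then show ?thesis
    using assms(1) src_gunits by metis
qed

lemma inv_mul_unit:
  assumes "a \<in> arr G" "b \<in> arr G" "rng G a = rng G b" "mul G (ginv G a) b \<in> gunits G"
  shows "a = b"
proof -
  have "mul G (ginv G a) b = src G a"
    using assms gunits_rng[OF assms(4)] rng_mul[of "ginv G a" b] by (metis inv_arr rng_inv src_inv)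
  then show ?thesis
    using cancel_left_inv[of a b] assms by simp
qed

end

lemma hom_arr: "groupoid_hom G H f \<Longrightarrow> a \<in> arr G \<Longrightarrow> f a \<in> arr H"
  unfolding groupoid_hom_def by auto

lemma hom_mul:
  assumes "groupoid_hom G H f" "a \<in> arr G" "b \<in> arr G" "src G a = rng G b"
  shows "f (mul G a b) = mul H (f a) (f b)" "src H (f a) = rng H (f b)"
proof -
  have "(a, b) \<in> composable G"
    using assms by (simp add: composable_def)
  with assms(1) have "(f a, f b) \<in> composable H \<and> f (mul G a b) = mul H (f a) (f b)"
    unfolding groupoid_hom_def by blast
  then show "f (mul G a b) = mul H (f a) (f b)" "src H (f a) = rng H (f b)"
    by (auto simp: composable_def)
qed

lemma
  assumes f: "groupoid_hom G H f" and G: "is_groupoid G" and H: "is_groupoid H" and a: "a \<in> arr G"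
  shows hom_rng: "f (rng G a) = rng H (f a)"
    and hom_src: "f (src G a) = src H (f a)"
    and hom_inv: "f (ginv G a) = ginv H (f a)"
proof -
  interpret G: groupoid G using G by unfold_locales
  interpret H: groupoid H using H by unfold_locales
  have unit: "f x \<in> gunits H" if "x \<in> gunits G" for x
  proof (rule H.idem_unit)
    show "f x \<in> arr H" using f that by (simp add: hom_arr)
    show "src H (f x) = rng H (f x)" using hom_mul(2)[OF f, of x x] that by simp
    show "mul H (f x) (f x) = f x" using hom_mul(1)[OF f, of x x] that G.mul_rng[of x] by simp
  qed
  show r: "f (rng G a) = rng H (f a)"
    using hom_mul(2)[OF f, of "rng G a" a] unit[of "rng G a"] a by simp
  show s: "f (src G a) = src H (f a)"
    using hom_mul(2)[OF f, of a "src G a"] unit[of "src G a"] a by simp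
  show "f (ginv G a) = ginv H (f a)"
  proof (rule H.inv_unique)
    show "f a \<in> arr H" "f (ginv G a) \<in> arr H" using f a by (simp_all add: hom_arr)
    show "src H (f a) = rng H (f (ginv G a))" using hom_mul(2)[OF f, of a "ginv G a"] a by simp
    show "mul H (f a) (f (ginv G a)) = rng H (f a)"
      using hom_mul(1)[OF f, of a "ginv G a"] a r by simp
  qed
qed

lemma hom_gunits:
  assumes "groupoid_hom G H f" "is_groupoid G" "is_groupoid H" "x \<in> gunits G"
  shows "f x \<in> gunits H"
  using hom_rng[OF assms(1-3)] assms(1,4) hom_arr[OF assms(1)]
  unfolding gunits_def by auto

text \<open>
  The product of two compact sets of arrows is the image of the composable pairs in their product,
  and these form a closed set because the unit space is Hausdorff.
\<close>

lemma compactin_mul: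
  assumes G: "topological_groupoid G" and K: "compactin (arr_top G) K" and L: "compactin (arr_top G) L"
  shows "compactin (arr_top G) {mul G a b |a b. a \<in> K \<and> b \<in> L \<and> src G a = rng G b}"
proof -
  let ?PT = "prod_topology (arr_top G) (arr_top G)"
  have rc: "continuous_map (arr_top G) (unit_space G) (rng G)"
    and sc: "continuous_map (arr_top G) (unit_space G) (src G)"
    and mc: "continuous_map (subtopology ?PT (composable G)) (arr_top G) (\<lambda>(a, b). mul G a b)"
    and hd: "Hausdorff_space (unit_space G)"
    using G unfolding topological_groupoid_def by auto
  have KL: "K \<subseteq> arr G" "L \<subseteq> arr G"
    using K L compactin_subset_topspace by blast+
  have comp_eq: "composable G = {p \<in> topspace ?PT. (src G \<circ> fst) p = (rng G \<circ> snd) p}"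
    by (auto simp: composable_def)
  have "continuous_map ?PT (unit_space G) (src G \<circ> fst)" "continuous_map ?PT (unit_space G) (rng G \<circ> snd)"
    using continuous_map_compose[OF continuous_map_fst sc] continuous_map_compose[OF continuous_map_snd rc] by auto
  then have "closedin ?PT (composable G)"
    unfolding comp_eq
    by (intro closedin_continuous_maps_eq[OF hd])
  moreover have "compactin ?PT (K \<times> L)"
    using K L by (simp add: compactin_Times)
  ultimately have "compactin ?PT (composable G \<inter> K \<times> L)"
    by (rule closed_Int_compactin)
  then have "compactin (subtopology ?PT (composable G)) (composable G \<inter> K \<times> L)"
    by (simp add: compactin_subtopology)
  then have "compactin (arr_top G) ((\<lambda>(a, b). mul G a b) ` (composable G \<inter> K \<times> L))"
    using image_compactin mc by blast
  moreover have "(\<lambda>(a, b). mul G a b) ` (composable G \<inter> K \<times> L)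
      = {mul G a b |a b. a \<in> K \<and> b \<in> L \<and> src G a = rng G b}"
    using KL by (force simp: composable_def)
  ultimately show ?thesis by simp
qed

section \<open>Stone duality for compact open sets\<close>

definition compact_opens :: "'a topology \<Rightarrow> 'a set set" where
  "compact_opens T = {K. compactin T K \<and> openin T K}"

lemma compact_opensD:
  assumes "K \<in> compact_opens T"
  shows "compactin T K" "openin T K" "K \<subseteq> topspace T"
  using assms openin_subset unfolding compact_opens_def by auto

lemma compact_opens_empty: "{} \<in> compact_opens T"
  unfolding compact_opens_def by simp

lemma compact_opens_closedin:
  assumes "Hausdorff_space T" "K \<in> compact_opens T"
  shows "closedin T K"
  using assms compactin_imp_closedin unfolding compact_opens_def by auto

lemma compact_opens_Int:
  assumes "Hausdorff_space T" "K \<in> compact_opens T" "L \<in> compact_opens T"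
  shows "K \<inter> L \<in> compact_opens T"
  using assms compact_opens_closedin[OF assms(1,2)]
  unfolding compact_opens_def by (auto intro: closed_Int_compactin)

lemma compact_opens_Diff:
  assumes "Hausdorff_space T" "K \<in> compact_opens T" "L \<in> compact_opens T"
  shows "K - L \<in> compact_opens T"
proof -
  have "openin T (K - L)" "closedin T (K - L)"
    using assms compact_opens_closedin[OF assms(1)] unfolding compact_opens_def
    by (auto intro: openin_diff closedin_diff)
  then show ?thesis
    using assms(2) closed_compactin[of T K "K - L"] unfolding compact_opens_def by auto
qed

text \<open>
  Unit spaces of ample groupoids are of this kind. They need not be compact, so the compact open
  sets form a generalised Boolean algebra, without a top element in general.
\<close>

locale zero_dim =
  fixes T :: "'a topology"
  assumes haus: "Hausdorff_space T"
    and base: "\<And>U x. openin T U \<Longrightarrow> x \<in> U \<Longrightarrow> \<exists>K\<in>compact_opens T. x \<in> K \<and> K \<subseteq> U"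
begin

lemma separate:
  assumes "x \<in> topspace T" "y \<in> topspace T" "x \<noteq> y"
  shows "\<exists>K\<in>compact_opens T. x \<in> K \<and> y \<notin> K"
proof -
  obtain U V where "openin T U" "openin T V" "x \<in> U" "y \<in> V" "disjnt U V"
    using haus assms unfolding Hausdorff_space_def by metis
  then show ?thesis
    using base[of U x] unfolding disjnt_def by blast
qed

lemma eqI:
  assumes "x \<in> topspace T" "y \<in> topspace T" "\<And>K. K \<in> compact_opens T \<Longrightarrow> x \<in> K \<Longrightarrow> y \<in> K"
  shows "x = y"
  using separate assms by blast

end

locale compact_open_iso = X: zero_dim X + Y: zero_dim Y
  for X :: "'a topology" and Y :: "'b topology" +
  fixes \<kappa> :: "'a set \<Rightarrow> 'b set"
  assumes bij: "bij_betw \<kappa> (compact_opens X) (compact_opens Y)"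
    and Int: "\<And>K L. K \<in> compact_opens X \<Longrightarrow> L \<in> compact_opens X \<Longrightarrow> \<kappa> (K \<inter> L) = \<kappa> K \<inter> \<kappa> L"
begin

lemma in_CO: "K \<in> compact_opens X \<Longrightarrow> \<kappa> K \<in> compact_opens Y"
  using bij unfolding bij_betw_def by auto

lemma empty: "\<kappa> {} = {}"
proof -
  obtain K where K: "K \<in> compact_opens X" "\<kappa> K = {}"
    using bij compact_opens_empty[of Y] unfolding bij_betw_def by (metis imageE)
  then show ?thesis using Int[of K "{}"] compact_opens_empty[of X] by simp
qed

lemma disjoint: "K \<in> compact_opens X \<Longrightarrow> L \<in> compact_opens X \<Longrightarrow> K \<inter> L = {} \<Longrightarrow> \<kappa> K \<inter> \<kappa> L = {}"
  using Int empty by metis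

lemma inverse: "compact_open_iso Y X (inv_into (compact_opens X) \<kappa>)"
proof unfold_locales
  let ?l = "inv_into (compact_opens X) \<kappa>"
  show b: "bij_betw ?l (compact_opens Y) (compact_opens X)"
    by (rule bij_betw_inv_into[OF bij])
  have r: "\<kappa> (?l K) = K" "?l K \<in> compact_opens X" if "K \<in> compact_opens Y" for K
    using that bij b by (auto simp: bij_betw_inv_into_right bij_betwE)
  show "?l (K \<inter> L) = ?l K \<inter> ?l L" if "K \<in> compact_opens Y" "L \<in> compact_opens Y" for K L
  proof -
    have "\<kappa> (?l K \<inter> ?l L) = K \<inter> L" using r that Int by simp
    moreover have "?l K \<inter> ?l L \<in> compact_opens X" using r that compact_opens_Int[OF X.haus] by simp
    ultimately show ?thesis using bij bij_betw_inv_into_left by metis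
  qed
qed

text \<open>
  The compact open sets containing \<open>x\<close> go to a filter base of compact sets, which therefore has a
  common point. There is only one, since any compact open set of \<open>Y\<close> around a second candidate
  comes from a set that either contains \<open>x\<close> or is disjoint from a neighbourhood of \<open>x\<close>.
\<close>

lemma ex_point:
  assumes x: "x \<in> topspace X"
  shows "\<exists>y\<in>topspace Y. \<forall>K\<in>compact_opens X. x \<in> K \<longleftrightarrow> y \<in> \<kappa> K"
proof -
  let ?F = "\<kappa> ` {K \<in> compact_opens X. x \<in> K}"
  obtain K0 where K0: "K0 \<in> compact_opens X" "x \<in> K0"
    using X.base[of "topspace X" x] x by auto
  have fin: "\<exists>K\<in>compact_opens X. x \<in> K \<and> \<kappa> K \<subseteq> \<Inter>\<F>" if "finite \<F>" "\<F> \<subseteq> ?F" for \<F>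
    using that
  proof (induction \<F> rule: finite_induct)
    case empty
    then show ?case using K0 by auto
  next
    case (insert C \<F>)
    then obtain K L where "K \<in> compact_opens X" "x \<in> K" "\<kappa> K \<subseteq> \<Inter>\<F>" "L \<in> compact_opens X" "x \<in> L" "C = \<kappa> L"
      by auto
    then show ?case
      using Int[of K L] compact_opens_Int[OF X.haus, of K L] by (intro bexI[of _ "K \<inter> L"]) blast+
  qed
  have nonempty: "\<kappa> K \<noteq> {}" if "K \<in> compact_opens X" "x \<in> K" for K
  proof
    assume "\<kappa> K = {}"
    then have "K = {}"
      using inj_onD[OF bij_betw_imp_inj_on[OF bij], of K "{}"] empty that(1) compact_opens_empty[of X] by simp
    then show False using that(2) by simp
  qed
  have closed: "\<forall>C\<in>?F. closedin Y C"
    by (simp add: compact_opens_closedin[OF Y.haus in_CO])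
  have fip: "\<kappa> K0 \<inter> \<Inter>\<F> \<noteq> {}" if "finite \<F>" "\<F> \<subseteq> ?F" for \<F>
  proof -
    have "finite (insert (\<kappa> K0) \<F>)" "insert (\<kappa> K0) \<F> \<subseteq> ?F"
      using K0 that by simp_all
    from fin[OF this] obtain K where K: "K \<in> compact_opens X" "x \<in> K" "\<kappa> K \<subseteq> \<Inter>(insert (\<kappa> K0) \<F>)"
      by (elim bexE conjE)
    have "\<kappa> K \<noteq> {}"
      using K by (intro nonempty)
    then show ?thesis
      using K(3) by (metis Inter_insert subset_empty)
  qed
  have "\<kappa> K0 \<inter> \<Inter>?F \<noteq> {}"
    using compactin_fip[THEN iffD1, OF compact_opensD(1)[OF in_CO[OF K0(1)]]] closed fip by meson
  then obtain y where y0: "y \<in> \<kappa> K0 \<inter> \<Inter>?F"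
    by (meson ex_in_conv)
  have y: "y \<in> \<kappa> K0" "\<And>K. K \<in> compact_opens X \<Longrightarrow> x \<in> K \<Longrightarrow> y \<in> \<kappa> K"
    using y0 by simp_all
  have conv: "x \<in> K" if K: "K \<in> compact_opens X" "y \<in> \<kappa> K" for K
  proof (rule ccontr)
    assume "x \<notin> K"
    then have "y \<in> \<kappa> (K0 - K)"
      using K0 y(2)[of "K0 - K"] compact_opens_Diff[OF X.haus K0(1) K(1)] by simp
    moreover have "\<kappa> (K0 - K) \<inter> \<kappa> K = {}"
      using K compact_opens_Diff[OF X.haus K0(1) K(1)] by (intro disjoint) auto
    ultimately show False using K by auto
  qed
  show ?thesis
  proof (intro bexI[of _ y] ballI iffI)
    show "y \<in> topspace Y"
      using y(1) compact_opensD(3)[OF in_CO[OF K0(1)]] by (rule subsetD[rotated])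
  qed (fact y(2) conv)+
qed

text \<open>
  The inverse of \<open>\<kappa>\<close> satisfies the same assumptions, so points correspond in both directions; bases
  of the two topologies correspond by construction.
\<close>

lemma stone_homeomorphism:
  shows "\<exists>\<phi>. homeomorphic_map X Y \<phi> \<and> (\<forall>K\<in>compact_opens X. \<phi> ` K = \<kappa> K)"
proof -
  interpret I: compact_open_iso Y X "inv_into (compact_opens X) \<kappa>" by (rule inverse)
  define \<phi> where "\<phi> x = (SOME y. y \<in> topspace Y \<and> (\<forall>K\<in>compact_opens X. x \<in> K \<longleftrightarrow> y \<in> \<kappa> K))" for x
  have \<phi>: "\<phi> x \<in> topspace Y" "\<And>K. K \<in> compact_opens X \<Longrightarrow> x \<in> K \<longleftrightarrow> \<phi> x \<in> \<kappa> K" if "x \<in> topspace X" for x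
    using someI_ex[of "\<lambda>y. y \<in> topspace Y \<and> (\<forall>K\<in>compact_opens X. x \<in> K \<longleftrightarrow> y \<in> \<kappa> K)"] ex_point[OF that]
    unfolding \<phi>_def by blast+
  have inj: "inj_on \<phi> (topspace X)"
    using \<phi> X.eqI by (intro inj_onI) metis
  have surj: "\<exists>x\<in>topspace X. \<phi> x = y" if y: "y \<in> topspace Y" for y
  proof -
    obtain x where x: "x \<in> topspace X" "\<And>L. L \<in> compact_opens Y \<Longrightarrow> y \<in> L \<longleftrightarrow> x \<in> inv_into (compact_opens X) \<kappa> L"
      using I.ex_point[OF y] by auto
    have "y = \<phi> x"
    proof (rule Y.eqI[OF y])
      show "\<phi> x \<in> topspace Y" using \<phi> x by auto
      fix L assume L: "L \<in> compact_opens Y" "y \<in> L"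
      then show "\<phi> x \<in> L"
        using x \<phi>(2)[OF x(1) I.in_CO[OF L(1)]] bij_betw_inv_into_right[OF bij L(1)] by simp
    qed
    then show ?thesis using x by blast
  qed
  have im: "\<phi> ` K = \<kappa> K" if K: "K \<in> compact_opens X" for K
  proof
    show "\<phi> ` K \<subseteq> \<kappa> K" using \<phi> K compact_opensD(3)[OF K] by auto
    show "\<kappa> K \<subseteq> \<phi> ` K"
    proof
      fix y assume y: "y \<in> \<kappa> K"
      then have "y \<in> topspace Y" using compact_opensD(3)[OF in_CO[OF K]] by auto
      then obtain x where "x \<in> topspace X" "\<phi> x = y" using surj by auto
      then show "y \<in> \<phi> ` K" using \<phi> K y by auto
    qed
  qed
  have "homeomorphic_map X Y \<phi>"
  proof (rule bijective_open_imp_homeomorphic_map)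
    show "continuous_map X Y \<phi>"
      unfolding continuous_map_def
    proof (intro conjI allI impI)
      show "\<phi> \<in> topspace X \<rightarrow> topspace Y" using \<phi> by auto
      fix V assume V: "openin Y V"
      show "openin X {x \<in> topspace X. \<phi> x \<in> V}"
      proof (subst openin_subopen, intro ballI)
        fix x assume x: "x \<in> {x \<in> topspace X. \<phi> x \<in> V}"
        then obtain L where L: "L \<in> compact_opens Y" "\<phi> x \<in> L" "L \<subseteq> V"
          using Y.base V by blast
        let ?K = "inv_into (compact_opens X) \<kappa> L"
        have K: "?K \<in> compact_opens X" "\<kappa> ?K = L"
          using L I.in_CO bij_betw_inv_into_right[OF bij L(1)] by auto
        have "x \<in> ?K"
          using \<phi>(2)[OF _ K(1)] x L K(2) by simp
        moreover have "?K \<subseteq> {x \<in> topspace X. \<phi> x \<in> V}"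
          using \<phi>(2)[OF _ K(1)] L K(2) compact_opensD(3)[OF K(1)] by blast
        ultimately show "\<exists>T. openin X T \<and> x \<in> T \<and> T \<subseteq> {x \<in> topspace X. \<phi> x \<in> V}"
          using compact_opensD(2)[OF K(1)] by blast
      qed
    qed
    show "open_map X Y \<phi>"
      unfolding open_map_def
    proof (intro allI impI)
      fix U assume U: "openin X U"
      show "openin Y (\<phi> ` U)"
      proof (subst openin_subopen, intro ballI)
        fix y assume "y \<in> \<phi> ` U"
        then obtain x where x: "x \<in> U" "y = \<phi> x"
          by auto
        obtain K where "K \<in> compact_opens X" "x \<in> K" "K \<subseteq> U"
          using X.base[OF U x(1)] by auto
        with x show "\<exists>T. openin Y T \<and> y \<in> T \<and> T \<subseteq> \<phi> ` U"
          using im[of K] compact_opensD(2)[OF in_CO[of K]] by (intro exI[of _ "\<kappa> K"]) (metis image_eqI image_mono)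
      qed
    qed
    show "\<phi> ` topspace X = topspace Y" using \<phi>(1) surj by (auto simp: image_iff)
    show "inj_on \<phi> (topspace X)" by (rule inj)
  qed
  then show ?thesis using im by auto
qed

end

section \<open>Ample groupoids\<close>

lemma topspace_unit_space [simp]:
  assumes "is_groupoid G"
  shows "topspace (unit_space G) = gunits G"
proof -
  interpret groupoid G using assms by unfold_locales
  show ?thesis using gunits_sub by (auto simp: unit_space_def)
qed

lemma bisection_inj:
  assumes "bisection G D"
  shows "inj_on (rng G) D" "inj_on (src G) D"
proof -
  obtain U where U: "openin (arr_top G) U" "D \<subseteq> U" "homeo_onto_open G U (rng G)" "homeo_onto_open G U (src G)"
    using assms unfolding bisection_def by auto
  have "topspace (subtopology (arr_top G) U) = U"
    using openin_subset[OF U(1)] by auto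
  then have "inj_on (rng G) U" "inj_on (src G) U"
    using U(3,4) homeomorphic_imp_injective_map unfolding homeo_onto_open_def by metis+
  then show "inj_on (rng G) D" "inj_on (src G) D"
    using U(2) inj_on_subset by blast+
qed

lemma homeo_onto_open_image:
  assumes "homeo_onto_open G U f" "openin (arr_top G) D" "D \<subseteq> U"
  shows "openin (unit_space G) (f ` D)"
proof -
  have "openin (subtopology (arr_top G) U) D"
    using assms(2,3) by (auto simp: openin_subtopology)
  then have "openin (subtopology (unit_space G) (f ` U)) (f ` D)"
    using assms(1) homeomorphic_imp_open_map unfolding homeo_onto_open_def open_map_def by blast
  then show ?thesis
    using assms(1) openin_trans_full unfolding homeo_onto_open_def by blast
qed

lemma bisection_open_image:
  assumes "bisection G D" "openin (arr_top G) D"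
  shows "openin (unit_space G) (rng G ` D)" "openin (unit_space G) (src G ` D)"
proof -
  obtain U where "D \<subseteq> U" "homeo_onto_open G U (rng G)" "homeo_onto_open G U (src G)"
    using assms(1) unfolding bisection_def by auto
  then show "openin (unit_space G) (rng G ` D)" "openin (unit_space G) (src G ` D)"
    using homeo_onto_open_image[OF _ assms(2)] by auto
qed

locale ample_groupoid =
  fixes G :: "'a tgroupoid"
  assumes ample: "ample G" and haus: "Hausdorff_space (arr_top G)"
begin

lemma topological: "topological_groupoid G"
  using ample unfolding ample_def etale_def by auto

sublocale groupoid G
  using topological unfolding topological_groupoid_def by unfold_locales auto

lemma rng_cont: "continuous_map (arr_top G) (unit_space G) (rng G)"
  and src_cont: "continuous_map (arr_top G) (unit_space G) (src G)"
  and inv_cont: "continuous_map (arr_top G) (arr_top G) (ginv G)"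
  and unit_haus: "Hausdorff_space (unit_space G)"
  using topological unfolding topological_groupoid_def by auto

lemma topspace_units [simp]: "topspace (unit_space G) = gunits G"
  by (simp add: is_groupoid)

lemma ample_base:
  assumes "openin (arr_top G) U" "a \<in> U"
  obtains K where "compactin (arr_top G) K" "openin (arr_top G) K" "bisection G K" "a \<in> K" "K \<subseteq> U"
  using ample assms unfolding ample_def by meson

text \<open>
  Near a unit, an arrow and its range lie in a common open set on which the range map is
  injective; the two have the same range, so they coincide.
\<close>

lemma units_open: "openin (arr_top G) (gunits G)"
proof (subst openin_subopen, intro ballI)
  fix x assume x: "x \<in> gunits G"
  obtain K where K: "openin (arr_top G) K" "bisection G K" "x \<in> K"
    using ample_base[of "arr G" x] x by auto
  let ?V = "{a \<in> arr G. rng G a \<in> K} \<inter> K"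
  have "continuous_map (arr_top G) (arr_top G) (rng G)"
    using rng_cont unfolding unit_space_def by (rule continuous_map_into_fulltopology)
  then have "openin (arr_top G) ?V"
    using K by (intro openin_Int openin_continuous_map_preimage)
  moreover have "?V \<subseteq> gunits G"
  proof
    fix a assume a: "a \<in> ?V"
    then have "rng G a = a"
      using inj_onD[OF bisection_inj(1)[OF K(2)], of "rng G a" a] by simp
    then show "a \<in> gunits G" using a by (intro iffD2[OF gunits_iff]) auto
  qed
  ultimately show "\<exists>T. openin (arr_top G) T \<and> x \<in> T \<and> T \<subseteq> gunits G"
    using K x by (intro exI[of _ ?V]) auto
qed

lemma openin_units_iff: "openin (unit_space G) U \<longleftrightarrow> openin (arr_top G) U \<and> U \<subseteq> gunits G"
  unfolding unit_space_def using units_open by (rule openin_open_subtopology)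

lemma open_rng_src: "open_map (arr_top G) (unit_space G) (rng G)" "open_map (arr_top G) (unit_space G) (src G)"
proof -
  have *: "\<exists>K. openin (arr_top G) K \<and> a \<in> K \<and> K \<subseteq> U \<and>
      openin (unit_space G) (rng G ` K) \<and> openin (unit_space G) (src G ` K)"
    if U: "openin (arr_top G) U" "a \<in> U" for U a
  proof -
    obtain K where K: "openin (arr_top G) K" "bisection G K" "a \<in> K" "K \<subseteq> U"
      using ample_base[OF U] by auto
    then show ?thesis
      using bisection_open_image[OF K(2,1)] by (intro exI[of _ K] conjI)
  qed
  show "open_map (arr_top G) (unit_space G) (rng G)"
    unfolding open_map_def
  proof (intro allI impI, subst openin_subopen, intro ballI)
    fix U y assume "openin (arr_top G) U" "y \<in> rng G ` U"
    then obtain a K where "y = rng G a" "openin (arr_top G) K" "a \<in> K" "K \<subseteq> U" "openin (unit_space G) (rng G ` K)"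
      using * by (metis imageE)
    then show "\<exists>T. openin (unit_space G) T \<and> y \<in> T \<and> T \<subseteq> rng G ` U"
      by (intro exI[of _ "rng G ` K"]) auto
  qed
  show "open_map (arr_top G) (unit_space G) (src G)"
    unfolding open_map_def
  proof (intro allI impI, subst openin_subopen, intro ballI)
    fix U y assume "openin (arr_top G) U" "y \<in> src G ` U"
    then obtain a K where "y = src G a" "openin (arr_top G) K" "a \<in> K" "K \<subseteq> U" "openin (unit_space G) (src G ` K)"
      using * by (metis imageE)
    then show "\<exists>T. openin (unit_space G) T \<and> y \<in> T \<and> T \<subseteq> src G ` U"
      by (intro exI[of _ "src G ` K"]) auto
  qed
qed

abbreviation CO :: "'a set set" where "CO \<equiv> compact_opens (unit_space G)"

lemma CO_iff: "K \<in> CO \<longleftrightarrow> compactin (arr_top G) K \<and> openin (arr_top G) K \<and> K \<subseteq> gunits G"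
  unfolding compact_opens_def mem_Collect_eq openin_units_iff
  by (auto simp: unit_space_def compactin_subtopology)

lemma CO_sub: "K \<in> CO \<Longrightarrow> K \<subseteq> gunits G"
  by (simp add: CO_iff)

sublocale units: zero_dim "unit_space G"
proof
  show "Hausdorff_space (unit_space G)" by (rule unit_haus)
  fix U x assume U: "openin (unit_space G) U" "x \<in> U"
  then have "openin (arr_top G) U" "U \<subseteq> gunits G"
    by (simp_all add: openin_units_iff)
  moreover obtain K where "compactin (arr_top G) K" "openin (arr_top G) K" "x \<in> K" "K \<subseteq> U"
    using ample_base[OF \<open>openin (arr_top G) U\<close> U(2)] by auto
  ultimately show "\<exists>K\<in>CO. x \<in> K \<and> K \<subseteq> U"
    by (intro bexI[of _ K]) (auto simp: CO_iff)
qed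

definition clopen :: "'a set \<Rightarrow> bool" where
  "clopen W \<longleftrightarrow> openin (arr_top G) W \<and> closedin (arr_top G) W"

lemma clopen_Int: "clopen V \<Longrightarrow> clopen W \<Longrightarrow> clopen (V \<inter> W)"
  and clopen_Un: "clopen V \<Longrightarrow> clopen W \<Longrightarrow> clopen (V \<union> W)"
  and clopen_Diff: "clopen V \<Longrightarrow> clopen W \<Longrightarrow> clopen (V - W)"
  unfolding clopen_def by (auto intro: openin_diff closedin_diff)

lemma clopen_compact_open: "compactin (arr_top G) K \<Longrightarrow> openin (arr_top G) K \<Longrightarrow> clopen K"
  unfolding clopen_def using compactin_imp_closedin haus by auto

lemma clopen_preimage:
  assumes "K \<in> CO"
  shows "clopen {a \<in> arr G. rng G a \<in> K}" "clopen {a \<in> arr G. src G a \<in> K}"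
  using compact_opens_closedin[OF unit_haus assms] compact_opensD(2)[OF assms]
    openin_continuous_map_preimage[OF rng_cont] closedin_continuous_map_preimage[OF rng_cont]
    openin_continuous_map_preimage[OF src_cont] closedin_continuous_map_preimage[OF src_cont]
  unfolding clopen_def by auto

lemma compact_clopen:
  assumes "clopen W" "compactin (arr_top G) K" "W \<subseteq> K"
  shows "compactin (arr_top G) W"
  using assms closed_compactin unfolding clopen_def by blast

lemma CO_image:
  assumes "compactin (arr_top G) K" "openin (arr_top G) K"
  shows "rng G ` K \<in> CO" "src G ` K \<in> CO"
  using assms image_compactin[OF _ rng_cont] image_compactin[OF _ src_cont] open_rng_src
  unfolding compact_opens_def open_map_def by auto

text \<open>
  A compact set is covered by finitely many open sets on which the range map is injective.
\<close>

lemma finite_fibre: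
  assumes K: "compactin (arr_top G) K"
  shows "finite {a \<in> K. rng G a = x}"
proof -
  let ?U = "{U. openin (arr_top G) U \<and> bisection G U}"
  have "K \<subseteq> \<Union>?U"
  proof
    fix a assume "a \<in> K"
    then have "a \<in> arr G" using compactin_subset_topspace[OF K] by auto
    then show "a \<in> \<Union>?U"
      using ample_base[of "arr G" a] by auto
  qed
  then obtain \<F> where F: "finite \<F>" "\<F> \<subseteq> ?U" "K \<subseteq> \<Union>\<F>"
    using K unfolding compactin_def by (metis (mono_tags, lifting) mem_Collect_eq)
  have "finite (rng G -` {x} \<inter> U)" if "U \<in> \<F>" for U
    using that F(2) by (intro finite_vimage_IntI bisection_inj(1)) auto
  then have "finite (\<Union>U\<in>\<F>. rng G -` {x} \<inter> U)"
    using F(1) by blast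
  moreover have "{a \<in> K. rng G a = x} \<subseteq> (\<Union>U\<in>\<F>. rng G -` {x} \<inter> U)"
    using F(3) by auto
  ultimately show ?thesis by (rule rev_finite_subset)
qed

end

section \<open>Arithmetic in a discrete twist\<close>

locale twist = G: ample_groupoid G
  for G :: "'a tgroupoid" +
  fixes S :: "'b tgroupoid" and i :: "'a \<times> 'r::comm_ring_1 \<Rightarrow> 'b" and q :: "'b \<Rightarrow> 'a"
  assumes indec: "indecomposable_ring TYPE('r)" and tw: "discrete_twist G S i q"
begin

lemma zero_neq_one [simp]: "(0::'r) \<noteq> 1" "(1::'r) \<noteq> 0"
  using indec unfolding indecomposable_ring_def by auto

lemma zero_not_unit [simp]: "(0::'r) \<notin> Units_R"
  unfolding Units_R_def by auto

lemma idem: "(e::'r) * e = e \<Longrightarrow> e = 0 \<or> e = 1"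
  using indec unfolding indecomposable_ring_def by auto

lemma S_top: "topological_groupoid S"
  using tw unfolding discrete_twist_def by auto

sublocale S: groupoid S
  using S_top unfolding topological_groupoid_def by unfold_locales auto

lemma
  shows gunits_S: "gunits S = i ` (gunits G \<times> {1})"
    and i_hom: "groupoid_hom (trivial_bundle G) S i"
    and i_cont: "continuous_map (arr_top (trivial_bundle G :: ('a \<times> 'r) tgroupoid)) (arr_top S) i"
    and q_hom: "groupoid_hom S G q"
    and q_cont: "continuous_map (arr_top S) (arr_top G) q"
    and q_units: "homeomorphic_map (unit_space S) (unit_space G) q"
    and fibre_over_unit: "x \<in> gunits G \<Longrightarrow> i ` ({x} \<times> Units_R) = {\<sigma>\<in>arr S. q \<sigma> = x}"
    and i_inj: "inj_on i (gunits G \<times> Units_R)"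
    and q_surj: "q ` arr S = arr G"
  using tw unfolding discrete_twist_def by (simp_all del: split_paired_All)

text \<open>
  The data of local triviality over \<open>B\<close>: a continuous section \<open>P\<close> whose translates by units
  give a chart of the part of the twist above \<open>B\<close>.
\<close>

definition trivialises :: "'a set \<Rightarrow> ('a \<Rightarrow> 'b) \<Rightarrow> bool" where
  "trivialises B P \<longleftrightarrow> openin (arr_top G) B \<and> bisection G B \<and>
     continuous_map (subtopology (arr_top G) B) (arr_top S) P \<and> (\<forall>\<beta>\<in>B. q (P \<beta>) = \<beta>) \<and>
     homeomorphic_map
       (prod_topology (subtopology (arr_top G) B) (discrete_topology (Units_R :: 'r set)))
       (subtopology (arr_top S) {\<sigma>\<in>arr S. q \<sigma> \<in> B})
       (\<lambda>(\<beta>, t). mul S (i (rng G \<beta>, t)) (P \<beta>))"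

lemma locally_trivial: "\<alpha> \<in> arr G \<Longrightarrow> \<exists>B P. \<alpha> \<in> B \<and> trivialises B P"
proof -
  have "\<forall>\<alpha>\<in>arr G. \<exists>B P. openin (arr_top G) B \<and> bisection G B \<and> \<alpha> \<in> B \<and>
        continuous_map (subtopology (arr_top G) B) (arr_top S) P \<and>
        (\<forall>\<beta>\<in>B. q (P \<beta>) = \<beta>) \<and>
        homeomorphic_map
          (prod_topology (subtopology (arr_top G) B) (discrete_topology (Units_R :: 'r set)))
          (subtopology (arr_top S) {\<sigma>\<in>arr S. q \<sigma> \<in> B})
          (\<lambda>(\<beta>, t). mul S (i (rng G \<beta>, t)) (P \<beta>))"
    using tw unfolding discrete_twist_def by (elim conjE)
  then show "\<alpha> \<in> arr G \<Longrightarrow> \<exists>B P. \<alpha> \<in> B \<and> trivialises B P"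
    unfolding trivialises_def by blast
qed

lemma i_central: "\<sigma> \<in> arr S \<Longrightarrow> t \<in> Units_R \<Longrightarrow> mul S (i (q (rng S \<sigma>), t)) \<sigma> = mul S \<sigma> (i (q (src S \<sigma>), t))"
  using tw unfolding discrete_twist_def by (elim conjE) simp

lemma q_arr [simp]: "\<sigma> \<in> arr S \<Longrightarrow> q \<sigma> \<in> arr G"
  using hom_arr[OF q_hom] .

lemma q_mul [simp]: "\<sigma> \<in> arr S \<Longrightarrow> \<tau> \<in> arr S \<Longrightarrow> src S \<sigma> = rng S \<tau> \<Longrightarrow> q (mul S \<sigma> \<tau>) = mul G (q \<sigma>) (q \<tau>)"
  using hom_mul(1)[OF q_hom] .

lemma q_rng [simp]: "\<sigma> \<in> arr S \<Longrightarrow> q (rng S \<sigma>) = rng G (q \<sigma>)"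
  and q_src [simp]: "\<sigma> \<in> arr S \<Longrightarrow> q (src S \<sigma>) = src G (q \<sigma>)"
  and q_inv [simp]: "\<sigma> \<in> arr S \<Longrightarrow> q (ginv S \<sigma>) = ginv G (q \<sigma>)"
  using hom_rng[OF q_hom S.is_groupoid G.is_groupoid] hom_src[OF q_hom S.is_groupoid G.is_groupoid]
    hom_inv[OF q_hom S.is_groupoid G.is_groupoid] by auto

lemma q_gunits: "x \<in> gunits S \<Longrightarrow> q x \<in> gunits G"
  using hom_gunits[OF q_hom S.is_groupoid G.is_groupoid] .

lemma q_inj_units: "inj_on q (gunits S)"
  using homeomorphic_imp_injective_map[OF q_units] S.is_groupoid by simp

lemma rng_eq_iff: "\<sigma> \<in> arr S \<Longrightarrow> \<tau> \<in> arr S \<Longrightarrow> rng S \<sigma> = rng S \<tau> \<longleftrightarrow> rng G (q \<sigma>) = rng G (q \<tau>)"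
  and src_eq_iff: "\<sigma> \<in> arr S \<Longrightarrow> \<tau> \<in> arr S \<Longrightarrow> src S \<sigma> = src S \<tau> \<longleftrightarrow> src G (q \<sigma>) = src G (q \<tau>)"
  and src_rng_iff: "\<sigma> \<in> arr S \<Longrightarrow> \<tau> \<in> arr S \<Longrightarrow> src S \<sigma> = rng S \<tau> \<longleftrightarrow> src G (q \<sigma>) = rng G (q \<tau>)"
  using inj_on_eq_iff[OF q_inj_units] S.rng_gunits S.src_gunits by (metis q_rng q_src)+

lemma i_arr [simp]: "x \<in> gunits G \<Longrightarrow> t \<in> Units_R \<Longrightarrow> i (x, t) \<in> arr S"
  and q_i [simp]: "x \<in> gunits G \<Longrightarrow> t \<in> Units_R \<Longrightarrow> q (i (x, t)) = x"
  using fibre_over_unit[of x] by blast+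

lemma rng_i [simp]: "x \<in> gunits G \<Longrightarrow> t \<in> Units_R \<Longrightarrow> rng S (i (x, t)) = i (x, 1)"
  and src_i [simp]: "x \<in> gunits G \<Longrightarrow> t \<in> Units_R \<Longrightarrow> src S (i (x, t)) = i (x, 1)"
proof -
  assume x: "x \<in> gunits G" and t: "t \<in> Units_R"
  have u: "i (x, 1) \<in> gunits S" using x gunits_S by auto
  show "rng S (i (x, t)) = i (x, 1)"
    using rng_eq_iff[of "i (x, t)" "i (x, 1)"] x t u by simp
  show "src S (i (x, t)) = i (x, 1)"
    using src_eq_iff[of "i (x, t)" "i (x, 1)"] x t u by simp
qed

lemma i_one [simp]: "\<sigma> \<in> arr S \<Longrightarrow> i (rng G (q \<sigma>), 1) = rng S \<sigma>"
  using rng_i[of "rng G (q \<sigma>)" 1] rng_eq_iff[of \<sigma> "i (rng G (q \<sigma>), 1)"] by simp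

lemma i_unit [simp]: "x \<in> gunits G \<Longrightarrow> i (x, 1) \<in> gunits S"
  using gunits_S by auto

lemma unit_i: "\<sigma> \<in> gunits S \<Longrightarrow> i (q \<sigma>, 1) = \<sigma>"
  using i_one[of \<sigma>] q_gunits[of \<sigma>] by simp

lemma i_mul [simp]:
  assumes "x \<in> gunits G" "t \<in> Units_R" "u \<in> Units_R"
  shows "mul S (i (x, t)) (i (x, u)) = i (x, t * u)"
proof -
  have T: "topspace (arr_top (trivial_bundle G :: ('a \<times> 'r) tgroupoid)) = gunits G \<times> Units_R"
    by (simp add: trivial_bundle_def)
  have "i (mul (trivial_bundle G) (x, t) (x, u)) = mul S (i (x, t)) (i (x, u))"
    using assms T by (intro hom_mul(1)[OF i_hom]) (auto simp: trivial_bundle_def)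
  then show ?thesis by (simp add: trivial_bundle_def)
qed

abbreviation act :: "'r \<Rightarrow> 'b \<Rightarrow> 'b" where "act \<equiv> twist_act S i q"

lemma act_eq: "\<sigma> \<in> arr S \<Longrightarrow> act t \<sigma> = mul S (i (rng G (q \<sigma>), t)) \<sigma>"
  by (simp add: twist_act_def)

lemma act_arr [simp]: "\<sigma> \<in> arr S \<Longrightarrow> t \<in> Units_R \<Longrightarrow> act t \<sigma> \<in> arr S"
  and src_act [simp]: "\<sigma> \<in> arr S \<Longrightarrow> t \<in> Units_R \<Longrightarrow> src S (act t \<sigma>) = src S \<sigma>"
  and q_act [simp]: "\<sigma> \<in> arr S \<Longrightarrow> t \<in> Units_R \<Longrightarrow> q (act t \<sigma>) = q \<sigma>"
  by (simp_all add: act_eq)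

lemma rng_act [simp]: "\<sigma> \<in> arr S \<Longrightarrow> t \<in> Units_R \<Longrightarrow> rng S (act t \<sigma>) = rng S \<sigma>"
  using rng_eq_iff[of "act t \<sigma>" \<sigma>] by simp

lemma act_one [simp]: "\<sigma> \<in> arr S \<Longrightarrow> act 1 \<sigma> = \<sigma>"
  by (simp add: act_eq i_one)

lemma act_act [simp]: "\<sigma> \<in> arr S \<Longrightarrow> t \<in> Units_R \<Longrightarrow> u \<in> Units_R \<Longrightarrow> act t (act u \<sigma>) = act (t * u) \<sigma>"
  using act_eq[of "act u \<sigma>" t] act_eq[of \<sigma>]
    S.mul_assoc[of "i (rng G (q \<sigma>), t)" "i (rng G (q \<sigma>), u)" \<sigma>] by simp

lemma mul_act_left:
  assumes "\<sigma> \<in> arr S" "\<tau> \<in> arr S" "src S \<sigma> = rng S \<tau>" "t \<in> Units_R"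
  shows "mul S (act t \<sigma>) \<tau> = act t (mul S \<sigma> \<tau>)"
  using assms by (simp add: act_eq S.mul_assoc src_rng_iff)

text \<open>
  The central copy of the units can be moved past \<open>\<sigma>\<close>.
\<close>

lemma mul_act_right:
  assumes "\<sigma> \<in> arr S" "\<tau> \<in> arr S" "src S \<sigma> = rng S \<tau>" "t \<in> Units_R"
  shows "mul S \<sigma> (act t \<tau>) = act t (mul S \<sigma> \<tau>)"
proof -
  let ?i = "i (rng G (q \<tau>), t)"
  have c: "src S \<sigma> = rng S ?i"
    using assms src_rng_iff[of \<sigma> ?i] src_rng_iff[of \<sigma> \<tau>] by simp
  have "mul S \<sigma> (act t \<tau>) = mul S (mul S \<sigma> ?i) \<tau>"
    using assms c by (simp add: act_eq S.mul_assoc)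
  also have "mul S \<sigma> ?i = act t \<sigma>"
    using assms i_central[of \<sigma> t] by (simp add: twist_act_def src_rng_iff)
  finally show ?thesis using mul_act_left[OF assms] by simp
qed

lemma inv_act:
  assumes "\<sigma> \<in> arr S" "t \<in> Units_R"
  shows "ginv S (act t \<sigma>) = act (unit_inv t) (ginv S \<sigma>)"
  using assms
  by (intro S.inv_unique[symmetric]) (simp_all add: mul_act_left mul_act_right unit_inv_right unit_inv_left)

text \<open>
  The quotient of two arrows above the same point lies above a unit.
\<close>

lemma fibre_act:
  assumes "\<sigma> \<in> arr S" "\<tau> \<in> arr S" "q \<sigma> = q \<tau>"
  obtains t where "t \<in> Units_R" "\<tau> = act t \<sigma>"
proof -
  let ?x = "rng G (q \<sigma>)"
  have c: "src S \<tau> = src S \<sigma>" "rng S \<tau> = rng S \<sigma>"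
    using assms by (simp_all add: src_eq_iff rng_eq_iff)
  have "mul S \<tau> (ginv S \<sigma>) \<in> {\<sigma>\<in>arr S. q \<sigma> = ?x}"
    using assms c by simp
  then obtain t where t: "t \<in> Units_R" "mul S \<tau> (ginv S \<sigma>) = i (?x, t)"
    using fibre_over_unit[of ?x] assms by auto
  have "act t \<sigma> = mul S (mul S \<tau> (ginv S \<sigma>)) \<sigma>"
    using assms t by (simp add: act_eq)
  also have "\<dots> = \<tau>"
    using assms c(2) S.mul_src[of \<tau>] c(1) by (simp add: S.mul_assoc)
  finally show thesis using that t by simp
qed

lemma act_i: "x \<in> gunits G \<Longrightarrow> t \<in> Units_R \<Longrightarrow> u \<in> Units_R \<Longrightarrow> act t (i (x, u)) = i (x, t * u)"
  by (simp add: act_eq)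

lemma unit_fibre:
  assumes "\<sigma> \<in> arr S" "q \<sigma> \<in> gunits G"
  obtains t where "t \<in> Units_R" "\<sigma> = i (q \<sigma>, t)"
  using fibre_over_unit[OF assms(2)] assms by force

abbreviation product_chart :: "'a set \<Rightarrow> ('a \<times> 'r) topology" where
  "product_chart B \<equiv> prod_topology (subtopology (arr_top G) B) (discrete_topology Units_R)"

lemma trivialisesD:
  assumes "trivialises B P"
  shows "openin (arr_top G) B" "B \<subseteq> arr G" "topspace (product_chart B) = B \<times> Units_R"
    and "\<And>\<beta>. \<beta> \<in> B \<Longrightarrow> P \<beta> \<in> arr S" "\<And>\<beta>. \<beta> \<in> B \<Longrightarrow> q (P \<beta>) = \<beta>"
    and "homeomorphic_map (product_chart B) (subtopology (arr_top S) {\<sigma>\<in>arr S. q \<sigma> \<in> B}) (\<lambda>(\<beta>, t). act t (P \<beta>))"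
proof -
  show B: "openin (arr_top G) B" and Bs: "B \<subseteq> arr G" and qP: "\<And>\<beta>. \<beta> \<in> B \<Longrightarrow> q (P \<beta>) = \<beta>"
    using assms openin_subset unfolding trivialises_def by auto
  have "continuous_map (subtopology (arr_top G) B) (arr_top S) P"
    using assms unfolding trivialises_def by auto
  then have "P \<in> topspace (subtopology (arr_top G) B) \<rightarrow> arr S"
    by (rule continuous_map_funspace)
  then show P: "P \<beta> \<in> arr S" if "\<beta> \<in> B" for \<beta>
    using that Bs by auto
  show ts: "topspace (product_chart B) = B \<times> Units_R"
    using Bs by auto
  show "homeomorphic_map (product_chart B) (subtopology (arr_top S) {\<sigma>\<in>arr S. q \<sigma> \<in> B}) (\<lambda>(\<beta>, t). act t (P \<beta>))"
  proof (rule homeomorphic_map_eq)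
    show "homeomorphic_map (product_chart B) (subtopology (arr_top S) {\<sigma>\<in>arr S. q \<sigma> \<in> B})
       (\<lambda>(\<beta>, t). mul S (i (rng G \<beta>, t)) (P \<beta>))"
      using assms unfolding trivialises_def by (elim conjE)
    show "(case p of (\<beta>, t) \<Rightarrow> mul S (i (rng G \<beta>, t)) (P \<beta>)) = (case p of (\<beta>, t) \<Rightarrow> act t (P \<beta>))"
      if "p \<in> topspace (product_chart B)" for p
      using that P qP unfolding ts by (auto simp: act_eq)
  qed
qed

text \<open>In local coordinates \<open>q\<close> is the projection that forgets a discrete factor.\<close>

lemma q_open: "open_map (arr_top S) (arr_top G) q"
  unfolding open_map_def
proof (intro allI impI, subst openin_subopen, intro ballI)
  fix U \<alpha> assume U: "openin (arr_top S) U" and a: "\<alpha> \<in> q ` U"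
  then obtain \<sigma> where s: "\<sigma> \<in> U" "\<alpha> = q \<sigma>" "\<sigma> \<in> arr S" using openin_subset by blast
  obtain B P where B: "\<alpha> \<in> B" "trivialises B P"
    using locally_trivial[of \<alpha>] s by auto
  note tr = trivialisesD[OF B(2)]
  let ?h = "\<lambda>(\<beta>, t). act t (P \<beta>)"
  let ?Q = "subtopology (arr_top S) {\<sigma>\<in>arr S. q \<sigma> \<in> B}"
  let ?V = "{p \<in> B \<times> Units_R. ?h p \<in> U}"
  have qh: "q (?h p) = fst p" if "p \<in> B \<times> Units_R" for p
    using that tr(4,5) by auto
  have "continuous_map (product_chart B) (arr_top S) ?h"
    using homeomorphic_imp_continuous_map[OF tr(6)] by (rule continuous_map_into_fulltopology)
  from openin_continuous_map_preimage[OF this U] have "openin (product_chart B) ?V"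
    unfolding tr(3) .
  then have "openin (subtopology (arr_top G) B) (fst ` ?V)"
    using open_map_fst unfolding open_map_def by blast
  then have "openin (arr_top G) (fst ` ?V)"
    using tr(1) openin_trans_full by blast
  moreover have "\<alpha> \<in> fst ` ?V"
  proof -
    have "\<sigma> \<in> topspace ?Q" using s B by auto
    then have "\<sigma> \<in> ?h ` (B \<times> Units_R)"
      using homeomorphic_imp_surjective_map[OF tr(6)] unfolding tr(3) by simp
    then obtain p where "p \<in> B \<times> Units_R" "\<sigma> = ?h p"
      by (rule imageE)
    then show ?thesis using s qh[of p] by (intro image_eqI[of _ _ p]) auto
  qed
  moreover have "fst ` ?V \<subseteq> q ` U"
    using qh by (auto intro!: image_eqI[of _ q]) 
  ultimately show "\<exists>T. openin (arr_top G) T \<and> \<alpha> \<in> T \<and> T \<subseteq> q ` U" by blast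
qed

end

section \<open>The Steinberg algebra as a module\<close>

context twist
begin

abbreviation A :: "('b \<Rightarrow> 'r) set" where "A \<equiv> steinberg G S i q"
abbreviation D :: "('b \<Rightarrow> 'r) set" where "D \<equiv> diagonal G S i q"
abbreviation supp :: "('b \<Rightarrow> 'r) \<Rightarrow> 'a set" where "supp \<equiv> suppG S q"

text \<open>
  Local constancy in the form of continuity, which is inherited by composites and gives open level
  sets.
\<close>

abbreviation lconst :: "('b \<Rightarrow> 'r) \<Rightarrow> bool" where
  "lconst f \<equiv> continuous_map (arr_top S) (discrete_topology UNIV) f"

definition equivariant :: "('b \<Rightarrow> 'r) \<Rightarrow> bool" where
  "equivariant f \<longleftrightarrow> (\<forall>t\<in>Units_R. \<forall>\<sigma>\<in>arr S. f (act t \<sigma>) = unit_inv t * f \<sigma>)"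

lemma equivariantD: "equivariant f \<Longrightarrow> t \<in> Units_R \<Longrightarrow> \<sigma> \<in> arr S \<Longrightarrow> f (act t \<sigma>) = unit_inv t * f \<sigma>"
  unfolding equivariant_def by auto

lemma lconst_iff:
  "lconst f \<longleftrightarrow> (\<forall>\<sigma>\<in>arr S. \<exists>U. openin (arr_top S) U \<and> \<sigma> \<in> U \<and> U \<subseteq> {\<tau>. f \<tau> = f \<sigma>})"
proof
  assume f: "lconst f"
  show "\<forall>\<sigma>\<in>arr S. \<exists>U. openin (arr_top S) U \<and> \<sigma> \<in> U \<and> U \<subseteq> {\<tau>. f \<tau> = f \<sigma>}"
  proof
    fix \<sigma> assume "\<sigma> \<in> arr S"
    moreover have "openin (arr_top S) {\<tau> \<in> arr S. f \<tau> \<in> {f \<sigma>}}"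
      by (rule openin_continuous_map_preimage[OF f]) simp
    ultimately show "\<exists>U. openin (arr_top S) U \<and> \<sigma> \<in> U \<and> U \<subseteq> {\<tau>. f \<tau> = f \<sigma>}"
      by (intro exI[of _ "{\<tau> \<in> arr S. f \<tau> \<in> {f \<sigma>}}"]) auto
  qed
next
  assume f: "\<forall>\<sigma>\<in>arr S. \<exists>U. openin (arr_top S) U \<and> \<sigma> \<in> U \<and> U \<subseteq> {\<tau>. f \<tau> = f \<sigma>}"
  show "lconst f"
    unfolding continuous_map_def
  proof (intro conjI allI impI)
    show "f \<in> arr S \<rightarrow> topspace (discrete_topology UNIV)" by simp
    fix V
    show "openin (arr_top S) {\<sigma> \<in> arr S. f \<sigma> \<in> V}"
    proof (subst openin_subopen, intro ballI)
      fix \<sigma> assume s: "\<sigma> \<in> {\<sigma> \<in> arr S. f \<sigma> \<in> V}"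
      then obtain U where U: "openin (arr_top S) U" "\<sigma> \<in> U" "U \<subseteq> {\<tau>. f \<tau> = f \<sigma>}"
        using f by auto
      then show "\<exists>T. openin (arr_top S) T \<and> \<sigma> \<in> T \<and> T \<subseteq> {\<sigma> \<in> arr S. f \<sigma> \<in> V}"
        using openin_subset[OF U(1)] s by (intro exI[of _ U]) auto
    qed
  qed
qed

lemma lconst_open: "lconst f \<Longrightarrow> openin (arr_top S) {\<sigma> \<in> arr S. f \<sigma> \<in> V}"
  by (erule openin_continuous_map_preimage) simp

lemma steinberg_iff:
  "f \<in> A \<longleftrightarrow> (\<forall>\<sigma>. \<sigma> \<notin> arr S \<longrightarrow> f \<sigma> = 0) \<and> lconst f \<and> equivariant f \<and> compactin (arr_top G) (supp f)"
  unfolding steinberg_def lconst_iff equivariant_def by (simp add: subset_eq)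

lemma A_out: "f \<in> A \<Longrightarrow> \<sigma> \<notin> arr S \<Longrightarrow> f \<sigma> = 0"
  and A_lconst: "f \<in> A \<Longrightarrow> lconst f"
  and A_equivariant: "f \<in> A \<Longrightarrow> equivariant f"
  and A_compact: "f \<in> A \<Longrightarrow> compactin (arr_top G) (supp f)"
  by (simp_all add: steinberg_iff)

lemma A_act: "f \<in> A \<Longrightarrow> t \<in> Units_R \<Longrightarrow> \<sigma> \<in> arr S \<Longrightarrow> f (act t \<sigma>) = unit_inv t * f \<sigma>"
  using A_equivariant equivariantD by blast

lemma supp_iff:
  assumes "equivariant f" "\<sigma> \<in> arr S"
  shows "q \<sigma> \<in> supp f \<longleftrightarrow> f \<sigma> \<noteq> 0"
proof
  assume "q \<sigma> \<in> supp f"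
  then obtain \<tau> where t: "\<tau> \<in> arr S" "f \<tau> \<noteq> 0" "q \<sigma> = q \<tau>"
    unfolding suppG_def fsupp_def by auto
  obtain u where "u \<in> Units_R" "\<tau> = act u \<sigma>"
    using fibre_act[OF assms(2) t(1,3)] .
  then show "f \<sigma> \<noteq> 0" using equivariantD[OF assms(1)] t assms(2) by auto
next
  assume "f \<sigma> \<noteq> 0"
  then show "q \<sigma> \<in> supp f" using assms(2) unfolding suppG_def fsupp_def by auto
qed

lemma supp_arr: "supp f \<subseteq> arr G"
  unfolding suppG_def fsupp_def by auto

lemma A_supp_iff: "f \<in> A \<Longrightarrow> \<sigma> \<in> arr S \<Longrightarrow> q \<sigma> \<in> supp f \<longleftrightarrow> f \<sigma> \<noteq> 0"
  using supp_iff A_equivariant by blast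

lemma ex_lift: "\<alpha> \<in> arr G \<Longrightarrow> \<exists>\<sigma>\<in>arr S. q \<sigma> = \<alpha>"
  using q_surj by (metis imageE)

lemma q_preimage_open: "openin (arr_top G) W \<Longrightarrow> openin (arr_top S) {\<sigma> \<in> arr S. q \<sigma> \<in> W}"
  by (rule openin_continuous_map_preimage[OF q_cont])

text \<open>
  The support and its complement are both unions of fibres of the open map \<open>q\<close>.
\<close>

lemma clopen_supp:
  assumes "lconst f" "equivariant f"
  shows "G.clopen (supp f)"
proof -
  have "openin (arr_top G) (q ` {\<sigma> \<in> arr S. f \<sigma> \<in> V})" for V
    using q_open lconst_open[OF assms(1)] unfolding open_map_def by auto
  from this[of "- {0}"] this[of "{0}"]
  have o: "openin (arr_top G) (supp f)" "openin (arr_top G) (q ` {\<sigma> \<in> arr S. f \<sigma> = 0})"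
    by (simp_all add: suppG_def fsupp_def)
  have "arr G - supp f = q ` {\<sigma> \<in> arr S. f \<sigma> = 0}"
  proof (intro set_eqI iffI)
    fix \<alpha> assume a: "\<alpha> \<in> arr G - supp f"
    then obtain \<sigma> where "\<sigma> \<in> arr S" "q \<sigma> = \<alpha>" using ex_lift by auto
    then show "\<alpha> \<in> q ` {\<sigma> \<in> arr S. f \<sigma> = 0}" using a supp_iff[OF assms(2), of \<sigma>] by auto
  next
    fix \<alpha> assume "\<alpha> \<in> q ` {\<sigma> \<in> arr S. f \<sigma> = 0}"
    then show "\<alpha> \<in> arr G - supp f" using supp_iff[OF assms(2)] by auto
  qed
  then show ?thesis using o supp_arr unfolding G.clopen_def closedin_def by simp
qed

lemma A_clopen_supp: "f \<in> A \<Longrightarrow> G.clopen (supp f)"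
  by (simp add: clopen_supp steinberg_iff)

lemma A_intro:
  assumes "\<And>\<sigma>. \<sigma> \<notin> arr S \<Longrightarrow> f \<sigma> = 0" "lconst f" "equivariant f" "compactin (arr_top G) K" "supp f \<subseteq> K"
  shows "f \<in> A"
  using G.compact_clopen[OF clopen_supp[OF assms(2,3)] assms(4,5)] assms by (simp add: steinberg_iff)

lemma lconst_binop:
  assumes "lconst f" "lconst g"
  shows "lconst (\<lambda>\<sigma>. h (f \<sigma>) (g \<sigma>))"
  unfolding lconst_iff
proof
  fix \<sigma> assume s: "\<sigma> \<in> arr S"
  obtain U where U: "openin (arr_top S) U" "\<sigma> \<in> U" "U \<subseteq> {\<tau>. f \<tau> = f \<sigma>}"
    using assms(1) s unfolding lconst_iff by auto
  obtain V where V: "openin (arr_top S) V" "\<sigma> \<in> V" "V \<subseteq> {\<tau>. g \<tau> = g \<sigma>}"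
    using assms(2) s unfolding lconst_iff by auto
  show "\<exists>U. openin (arr_top S) U \<and> \<sigma> \<in> U \<and> U \<subseteq> {\<tau>. h (f \<tau>) (g \<tau>) = h (f \<sigma>) (g \<sigma>)}"
  proof (intro exI[of _ "U \<inter> V"] conjI subsetI CollectI)
    fix \<tau> assume "\<tau> \<in> U \<inter> V"
    then have "f \<tau> = f \<sigma>" "g \<tau> = g \<sigma>" using U V by blast+
    then show "h (f \<tau>) (g \<tau>) = h (f \<sigma>) (g \<sigma>)" by simp
  qed (use U V in auto)
qed

lemma A_add:
  assumes "f \<in> A" "g \<in> A"
  shows "(\<lambda>\<sigma>. f \<sigma> + g \<sigma>) \<in> A"
proof (rule A_intro)
  show "f \<sigma> + g \<sigma> = 0" if "\<sigma> \<notin> arr S" for \<sigma> using that assms by (simp add: A_out)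
  show "lconst (\<lambda>\<sigma>. f \<sigma> + g \<sigma>)" using lconst_binop[OF A_lconst[OF assms(1)] A_lconst[OF assms(2)], of "(+)"] .
  show "equivariant (\<lambda>\<sigma>. f \<sigma> + g \<sigma>)" using assms by (simp add: equivariant_def A_act distrib_left)
  show "compactin (arr_top G) (supp f \<union> supp g)" using assms by (intro compactin_Un A_compact)
  show "supp (\<lambda>\<sigma>. f \<sigma> + g \<sigma>) \<subseteq> supp f \<union> supp g" unfolding suppG_def fsupp_def by auto
qed

lemma A_scale:
  assumes "f \<in> A"
  shows "(\<lambda>\<sigma>. c * f \<sigma>) \<in> A"
proof (rule A_intro)
  show "c * f \<sigma> = 0" if "\<sigma> \<notin> arr S" for \<sigma> using that assms by (simp add: A_out)
  show "lconst (\<lambda>\<sigma>. c * f \<sigma>)" using lconst_binop[OF A_lconst[OF assms] A_lconst[OF assms], of "\<lambda>a b. c * a"] .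
  show "equivariant (\<lambda>\<sigma>. c * f \<sigma>)" using assms by (simp add: equivariant_def A_act ac_simps)
  show "compactin (arr_top G) (supp f)" using assms by (rule A_compact)
  show "supp (\<lambda>\<sigma>. c * f \<sigma>) \<subseteq> supp f" unfolding suppG_def fsupp_def by auto
qed

lemma A_zero: "(\<lambda>\<sigma>. 0) \<in> A"
  by (rule A_intro[where K = "{}"]) (auto simp: equivariant_def suppG_def fsupp_def)

lemma lconst_clopenI:
  assumes "G.clopen W" "\<And>\<sigma>. \<sigma> \<in> arr S \<Longrightarrow> q \<sigma> \<notin> W \<Longrightarrow> f \<sigma> = 0"
    and "\<And>\<sigma>. \<sigma> \<in> arr S \<Longrightarrow> q \<sigma> \<in> W \<Longrightarrow> \<exists>U. openin (arr_top S) U \<and> \<sigma> \<in> U \<and> U \<inter> {\<tau>. q \<tau> \<in> W} \<subseteq> {\<tau>. f \<tau> = f \<sigma>}"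
  shows "lconst f"
  unfolding lconst_iff
proof
  fix \<sigma> assume s: "\<sigma> \<in> arr S"
  have op: "openin (arr_top S) {\<sigma> \<in> arr S. q \<sigma> \<in> W}" "openin (arr_top S) {\<sigma> \<in> arr S. q \<sigma> \<in> arr G - W}"
    using assms(1) unfolding G.clopen_def by (intro q_preimage_open; simp add: closedin_def)+
  show "\<exists>U. openin (arr_top S) U \<and> \<sigma> \<in> U \<and> U \<subseteq> {\<tau>. f \<tau> = f \<sigma>}"
  proof (cases "q \<sigma> \<in> W")
    case True
    then obtain U where "openin (arr_top S) U" "\<sigma> \<in> U" "U \<inter> {\<tau>. q \<tau> \<in> W} \<subseteq> {\<tau>. f \<tau> = f \<sigma>}"
      using assms(3) s by auto
    then show ?thesis using True s op(1) by (intro exI[of _ "U \<inter> {\<sigma> \<in> arr S. q \<sigma> \<in> W}"]) auto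
  next
    case False
    then show ?thesis
      using op(2) s assms(2) by (intro exI[of _ "{\<sigma> \<in> arr S. q \<sigma> \<in> arr G - W}"]) auto
  qed
qed

definition res :: "'a set \<Rightarrow> ('b \<Rightarrow> 'r) \<Rightarrow> 'b \<Rightarrow> 'r" where
  "res W f = (\<lambda>\<sigma>. if q \<sigma> \<in> W then f \<sigma> else 0)"

lemma supp_res: "supp (res W f) = supp f \<inter> W"
  unfolding suppG_def fsupp_def res_def by auto

lemma A_res:
  assumes "f \<in> A" "G.clopen W"
  shows "res W f \<in> A"
proof (rule A_intro)
  show "res W f \<sigma> = 0" if "\<sigma> \<notin> arr S" for \<sigma> using that assms by (simp add: res_def A_out)
  show "lconst (res W f)"
  proof (rule lconst_clopenI[OF assms(2)])
    show "res W f \<sigma> = 0" if "q \<sigma> \<notin> W" for \<sigma> using that by (simp add: res_def)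
    fix \<sigma> assume s: "\<sigma> \<in> arr S" "q \<sigma> \<in> W"
    then obtain U where "openin (arr_top S) U" "\<sigma> \<in> U" "U \<subseteq> {\<tau>. f \<tau> = f \<sigma>}"
      using A_lconst[OF assms(1)] unfolding lconst_iff by auto
    then show "\<exists>U. openin (arr_top S) U \<and> \<sigma> \<in> U \<and> U \<inter> {\<tau>. q \<tau> \<in> W} \<subseteq> {\<tau>. res W f \<tau> = res W f \<sigma>}"
      using s by (intro exI[of _ U]) (auto simp: res_def)
  qed
  show "equivariant (res W f)" using assms by (simp add: equivariant_def res_def A_act)
  show "compactin (arr_top G) (supp f)" using assms by (intro A_compact)
  show "supp (res W f) \<subseteq> supp f" by (simp add: supp_res)
qed

section \<open>Monomials\<close>

text \<open>
  These are the normalisers that every twist has: unit-valued functions supported on a bisection.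
  As the support is compact and open, being a bisection amounts to injectivity of the range and source maps.
\<close>

definition monomials :: "('b \<Rightarrow> 'r) set" where
  "monomials = {n \<in> A. (\<forall>\<sigma>\<in>arr S. n \<sigma> \<noteq> 0 \<longrightarrow> n \<sigma> \<in> Units_R) \<and>
     inj_on (rng G) (supp n) \<and> inj_on (src G) (supp n)}"

abbreviation N :: "('b \<Rightarrow> 'r) set" where "N \<equiv> monomials"

lemma N_A: "n \<in> N \<Longrightarrow> n \<in> A"
  and N_unit: "n \<in> N \<Longrightarrow> \<sigma> \<in> arr S \<Longrightarrow> n \<sigma> \<noteq> 0 \<Longrightarrow> n \<sigma> \<in> Units_R"
  and N_rng: "n \<in> N \<Longrightarrow> inj_on (rng G) (supp n)"
  and N_src: "n \<in> N \<Longrightarrow> inj_on (src G) (supp n)"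
  unfolding monomials_def by auto

lemma N_res:
  assumes "n \<in> N" "G.clopen W"
  shows "res W n \<in> N"
proof -
  have "inj_on (rng G) (supp n \<inter> W)" "inj_on (src G) (supp n \<inter> W)"
    using inj_on_subset[OF N_rng[OF assms(1)]] inj_on_subset[OF N_src[OF assms(1)]] by auto
  then show ?thesis
    using N_unit[OF assms(1)] A_res[OF N_A[OF assms(1)] assms(2)]
    unfolding monomials_def mem_Collect_eq supp_res by (auto simp: res_def)
qed

lemma N_scale:
  assumes "n \<in> N" "u \<in> Units_R"
  shows "(\<lambda>\<sigma>. u * n \<sigma>) \<in> N"
proof -
  have "supp (\<lambda>\<sigma>. u * n \<sigma>) = supp n"
    using assms(2) unfolding suppG_def fsupp_def by simp
  then show ?thesis
    using assms A_scale[of n u] unfolding monomials_def by simp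
qed

lemma ex_normalised:
  assumes "n \<in> N" "\<sigma> \<in> arr S" "n \<sigma> \<noteq> 0"
  obtains \<tau> where "\<tau> \<in> arr S" "q \<tau> = q \<sigma>" "n \<tau> = 1"
proof -
  have "n \<sigma> \<in> Units_R" using assms by (rule N_unit)
  then show thesis
    using that[of "act (n \<sigma>) \<sigma>"] assms by (simp add: A_act N_A unit_inv_left)
qed

lemma eq_if_normalised:
  assumes "n \<in> N" "\<sigma> \<in> arr S" "\<tau> \<in> arr S" "q \<sigma> = q \<tau>" "n \<sigma> = 1" "n \<tau> = 1"
  shows "\<sigma> = \<tau>"
proof -
  obtain t where t: "t \<in> Units_R" "\<tau> = act t \<sigma>"
    using fibre_act[OF assms(2-4)] .
  then have "unit_inv t = 1"
    using A_act[OF N_A[OF assms(1)], of t \<sigma>] assms by simp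
  then have "t = 1" using t unit_inv_right[of t] by simp
  then show ?thesis using t assms by simp
qed

text \<open>
  In a chart over a bisection, the inverse of the second coordinate is a monomial once it is
  cut down to a compact open set.
\<close>

lemma ex_monomial:
  assumes s: "\<sigma> \<in> arr S"
  shows "\<exists>n\<in>N. n \<sigma> = 1"
proof -
  obtain B P where B: "q \<sigma> \<in> B" "trivialises B P"
    using locally_trivial[of "q \<sigma>"] s by auto
  note tr = trivialisesD[OF B(2)]
  obtain K where K: "compactin (arr_top G) K" "openin (arr_top G) K" "bisection G K" "q \<sigma> \<in> K" "K \<subseteq> B"
    using G.ample_base[OF tr(1) B(1)] .
  have Kc: "G.clopen K" using G.clopen_compact_open K by auto
  let ?h = "\<lambda>(\<beta>, t). act t (P \<beta>)"
  let ?Q = "subtopology (arr_top S) {\<sigma>\<in>arr S. q \<sigma> \<in> B}"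
  have Qo: "openin (arr_top S) {\<sigma>\<in>arr S. q \<sigma> \<in> B}" by (rule q_preimage_open[OF tr(1)])
  obtain h' where h': "homeomorphic_maps (product_chart B) ?Q ?h h'"
    using tr(6) unfolding homeomorphic_map_maps by auto
  have h'h: "h' (act t (P \<beta>)) = (\<beta>, t)" if "\<beta> \<in> B" "t \<in> Units_R" for \<beta> t
    using h' that unfolding homeomorphic_maps_def tr(3) by auto
  have coord: "\<exists>t\<in>Units_R. \<tau> = act t (P (q \<tau>))" if "\<tau> \<in> arr S" "q \<tau> \<in> B" for \<tau>
    using fibre_act[of "P (q \<tau>)" \<tau>] that tr(4,5) by metis
  obtain u where u: "u \<in> Units_R" "\<sigma> = act u (P (q \<sigma>))"
    using coord s B by auto
  \<comment> \<open>The factor \<open>u\<close> normalises the value at \<open>\<sigma>\<close>.\<close>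
  define n where "n = (\<lambda>\<tau>. if \<tau> \<in> arr S \<and> q \<tau> \<in> K then unit_inv (snd (h' \<tau>)) * u else 0)"
  have n: "n (act t (P \<beta>)) = unit_inv t * u" if "\<beta> \<in> K" "t \<in> Units_R" for \<beta> t
    using that K tr(4,5)[of \<beta>] h'h[of \<beta> t] by (auto simp: n_def)
  have n0: "n \<tau> = 0" if "q \<tau> \<notin> K" for \<tau>
    using that by (simp add: n_def)
  have sup: "supp n \<subseteq> K"
    unfolding suppG_def fsupp_def using n0 by auto
  have "n \<in> A"
  proof (rule A_intro[OF _ _ _ K(1) sup])
    show "n \<tau> = 0" if "\<tau> \<notin> arr S" for \<tau> using that by (simp add: n_def)
    show "equivariant n"
      unfolding equivariant_def
    proof (intro ballI)
      fix t :: 'r and \<tau> assume t: "t \<in> Units_R" "\<tau> \<in> arr S"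
      show "n (act t \<tau>) = unit_inv t * n \<tau>"
      proof (cases "q \<tau> \<in> K")
        case True
        then obtain v where v: "v \<in> Units_R" "\<tau> = act v (P (q \<tau>))"
          using coord t K by blast
        have "act t \<tau> = act (t * v) (P (q \<tau>))"
          using v t True K tr(4)[of "q \<tau>"] act_act by (metis subsetD)
        then have "n (act t \<tau>) = unit_inv (t * v) * u"
          using n True t v by simp
        also have "\<dots> = unit_inv t * n \<tau>"
          using n[OF True v(1)] v t by (simp add: unit_inv_mult mult.assoc)
        finally show ?thesis .
      next
        case False
        then show ?thesis using t by (simp add: n0)
      qed
    qed
    show "lconst n"
    proof (rule lconst_clopenI[OF Kc])
      show "n \<tau> = 0" if "q \<tau> \<notin> K" for \<tau> using n0 that .
      fix \<tau> assume t: "\<tau> \<in> arr S" "q \<tau> \<in> K"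
      have "continuous_map ?Q (product_chart B) h'"
        using h' unfolding homeomorphic_maps_def by (elim conjE)
      then have "continuous_map ?Q (discrete_topology Units_R) (snd \<circ> h')"
        using continuous_map_snd by (rule continuous_map_compose)
      then have "openin ?Q {\<rho> \<in> topspace ?Q. (snd \<circ> h') \<rho> \<in> {snd (h' \<tau>)} \<inter> Units_R}"
        by (rule openin_continuous_map_preimage) simp
      then have "openin (arr_top S) {\<rho> \<in> topspace ?Q. (snd \<circ> h') \<rho> \<in> {snd (h' \<tau>)} \<inter> Units_R}" (is "openin _ ?U")
        using Qo by (rule openin_trans_full)
      moreover have "\<tau> \<in> ?U"
      proof -
        obtain v where v: "v \<in> Units_R" "\<tau> = act v (P (q \<tau>))"
          using coord t K by blast
        then have "h' \<tau> = (q \<tau>, v)" using h'h t K by (metis subsetD)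
        then show ?thesis using t v K by auto
      qed
      moreover have "?U \<inter> {\<rho>. q \<rho> \<in> K} \<subseteq> {\<rho>. n \<rho> = n \<tau>}"
        using t by (auto simp: n_def)
      ultimately show "\<exists>U. openin (arr_top S) U \<and> \<tau> \<in> U \<and> U \<inter> {\<rho>. q \<rho> \<in> K} \<subseteq> {\<rho>. n \<rho> = n \<tau>}"
        by blast
    qed
  qed
  moreover have "n \<tau> \<in> Units_R" if t: "\<tau> \<in> arr S" "n \<tau> \<noteq> 0" for \<tau>
  proof -
    have tK: "q \<tau> \<in> K" using n0 t by auto
    then obtain v where v: "v \<in> Units_R" "\<tau> = act v (P (q \<tau>))"
      using coord[OF t(1)] K(5) by blast
    then have "n \<tau> = unit_inv v * u" using n[OF tK v(1)] by simp
    then show ?thesis using u v by simp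
  qed
  moreover have "inj_on (rng G) (supp n)" "inj_on (src G) (supp n)"
    using bisection_inj[OF K(3)] sup inj_on_subset by blast+
  moreover have "n \<sigma> = 1"
    using n[OF K(4) u(1)] u by (simp add: unit_inv_left)
  ultimately show ?thesis unfolding monomials_def by blast
qed

section \<open>Indicator functions on the unit space\<close>

text \<open>
  The indicator function of a set \<open>K\<close> of units. Equivariance forces the value \<open>unit_inv t\<close> at
  \<open>i (x, t)\<close>, and the description operator recovers \<open>t\<close>.
\<close>

definition e :: "'a set \<Rightarrow> 'b \<Rightarrow> 'r" where
  "e K \<sigma> = (if \<sigma> \<in> arr S \<and> q \<sigma> \<in> K then unit_inv (THE t. t \<in> Units_R \<and> \<sigma> = i (q \<sigma>, t)) else 0)"

lemma e_i:
  assumes "K \<subseteq> gunits G" "x \<in> gunits G" "t \<in> Units_R"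
  shows "e K (i (x, t)) = (if x \<in> K then unit_inv t else 0)"
proof -
  have "(THE u. u \<in> Units_R \<and> i (x, t) = i (q (i (x, t)), u)) = t"
    using assms i_inj by (intro the_equality) (auto dest: inj_onD)
  then show ?thesis using assms by (simp add: e_def)
qed

lemma e_unit: "K \<subseteq> gunits G \<Longrightarrow> \<sigma> \<in> gunits S \<Longrightarrow> e K \<sigma> = (if q \<sigma> \<in> K then 1 else 0)"
  using e_i[of K "q \<sigma>" 1] q_gunits[of \<sigma>] unit_i[of \<sigma>] by simp

lemma e_act:
  assumes "K \<subseteq> gunits G" "t \<in> Units_R" "\<sigma> \<in> arr S"
  shows "e K (act t \<sigma>) = unit_inv t * e K \<sigma>"
proof (cases "q \<sigma> \<in> K")
  case True
  then obtain u where u: "u \<in> Units_R" "\<sigma> = i (q \<sigma>, u)"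
    using unit_fibre assms by blast
  then have "act t \<sigma> = i (q \<sigma>, t * u)"
    using act_i[of "q \<sigma>" t u] assms True by auto
  then show ?thesis
    using e_i[of K "q \<sigma>" "t * u"] e_i[of K "q \<sigma>" u] assms True u by (auto simp: unit_inv_mult)
next
  case False
  then show ?thesis using assms by (simp add: e_def)
qed

text \<open>
  Near a unit \<open>x\<close>, a monomial with value one at \<open>i (x, 1)\<close> has value one at the units
  \<open>i (y, 1)\<close> with \<open>y\<close> close to \<open>x\<close>, because \<open>i\<close> is continuous; so it coincides with the indicator function.
\<close>

lemma e_lconst:
  assumes K: "K \<in> G.CO"
  shows "lconst (e K)"
proof (rule lconst_clopenI)
  have KX: "K \<subseteq> gunits G" using G.CO_sub[OF K] .
  show "G.clopen K" using K G.CO_iff G.clopen_compact_open by blast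
  show "e K \<sigma> = 0" if "q \<sigma> \<notin> K" for \<sigma> using that by (simp add: e_def)
  fix \<sigma> assume s: "\<sigma> \<in> arr S" "q \<sigma> \<in> K"
  let ?x = "q \<sigma>"
  have x: "?x \<in> gunits G" using s KX by auto
  obtain n where n: "n \<in> N" "n (i (?x, 1)) = 1" using ex_monomial[of "i (?x, 1)"] x by auto
  have "continuous_map (unit_space G) (prod_topology (unit_space G) (discrete_topology Units_R)) (\<lambda>x. (x, 1::'r))"
    by (intro continuous_map_pairedI) auto
  moreover have "continuous_map (prod_topology (unit_space G) (discrete_topology Units_R)) (arr_top S) i"
    using i_cont by (simp add: trivial_bundle_def)
  ultimately have "continuous_map (unit_space G) (arr_top S) (i \<circ> (\<lambda>x. (x, 1::'r)))"
    by (rule continuous_map_compose)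
  from openin_continuous_map_preimage[OF this lconst_open[OF A_lconst[OF N_A[OF n(1)]], of "{1}"]]
  have W: "openin (unit_space G) {x \<in> gunits G. i (x, 1) \<in> {\<sigma> \<in> arr S. n \<sigma> \<in> {1}}}" (is "openin _ ?W")
    by simp
  have ne: "n \<tau> = e K \<tau>" if \<tau>: "\<tau> \<in> arr S" "q \<tau> \<in> ?W" "q \<tau> \<in> K" for \<tau>
  proof -
    obtain t where t: "t \<in> Units_R" "\<tau> = i (q \<tau>, t)"
      using unit_fibre[of \<tau>] \<tau> by blast
    then have "\<tau> = act t (i (q \<tau>, 1))" using act_i[of "q \<tau>" t 1] \<tau> by auto
    then have "n \<tau> = unit_inv t * n (i (q \<tau>, 1))"
      using A_act[OF N_A[OF n(1)] t(1), of "i (q \<tau>, 1)"] that by auto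
    also have "\<dots> = e K \<tau>" using e_i[OF KX, of "q \<tau>" t] t that by auto
    finally show ?thesis .
  qed
  obtain U where U: "openin (arr_top S) U" "\<sigma> \<in> U" "U \<subseteq> {\<tau>. n \<tau> = n \<sigma>}"
    using A_lconst[OF N_A[OF n(1)]] s unfolding lconst_iff by auto
  let ?U = "U \<inter> {\<tau> \<in> arr S. q \<tau> \<in> ?W}"
  have "openin (arr_top S) ?U"
    using U W by (intro openin_Int q_preimage_open) (auto simp: G.openin_units_iff)
  moreover have "\<sigma> \<in> ?U" using U s x n by auto
  moreover have "?U \<inter> {\<tau>. q \<tau> \<in> K} \<subseteq> {\<tau>. e K \<tau> = e K \<sigma>}"
  proof
    fix \<tau> assume t: "\<tau> \<in> ?U \<inter> {\<tau>. q \<tau> \<in> K}"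
    then have "e K \<tau> = n \<tau>" "n \<tau> = n \<sigma>" using ne[of \<tau>] U(3) by auto
    then show "\<tau> \<in> {\<tau>. e K \<tau> = e K \<sigma>}" using ne[of \<sigma>] \<open>\<sigma> \<in> ?U\<close> s by simp
  qed
  ultimately show "\<exists>U. openin (arr_top S) U \<and> \<sigma> \<in> U \<and> U \<inter> {\<tau>. q \<tau> \<in> K} \<subseteq> {\<tau>. e K \<tau> = e K \<sigma>}"
    by blast
qed

lemma supp_e:
  assumes "K \<subseteq> gunits G"
  shows "supp (e K) = K"
proof (intro set_eqI iffI)
  fix x assume "x \<in> supp (e K)"
  then show "x \<in> K" unfolding suppG_def fsupp_def by (auto simp: e_def split: if_splits)
next
  fix x assume x: "x \<in> K"
  then have "e K (i (x, 1)) = 1" "i (x, 1) \<in> arr S" "q (i (x, 1)) = x"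
    using e_i[of K x 1] assms by auto
  then show "x \<in> supp (e K)" unfolding suppG_def fsupp_def by (auto intro!: image_eqI[of _ q "i (x, 1)"])
qed

lemma e_N: 
  assumes K: "K \<in> G.CO"
  shows "e K \<in> N"
proof -
  have KX: "K \<subseteq> gunits G" using G.CO_sub[OF K] .
  have "e K \<in> A"
  proof (rule A_intro[OF _ e_lconst[OF K]])
    show "e K \<sigma> = 0" if "\<sigma> \<notin> arr S" for \<sigma> using that by (simp add: e_def)
    show "equivariant (e K)" unfolding equivariant_def using e_act[OF KX] by auto
    show "compactin (arr_top G) K" using K by (simp add: G.CO_iff)
    show "supp (e K) \<subseteq> K" using supp_e[OF KX] by simp
  qed
  moreover have "e K \<sigma> \<in> Units_R" if s: "\<sigma> \<in> arr S" "e K \<sigma> \<noteq> 0" for \<sigma>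
  proof -
    have "q \<sigma> \<in> K" using s by (auto simp: e_def split: if_splits)
    moreover from this obtain t where "t \<in> Units_R" "\<sigma> = i (q \<sigma>, t)"
      using unit_fibre[of \<sigma>] s KX by blast
    ultimately show ?thesis using e_i[OF KX, of "q \<sigma>" t] KX by auto
  qed
  moreover have "inj_on (rng G) K" "inj_on (src G) K"
    using KX G.gunits_rng G.gunits_src by (metis inj_onI subsetD)+
  ultimately show ?thesis using supp_e[OF KX] unfolding monomials_def by auto
qed

lemma D_iff: "f \<in> D \<longleftrightarrow> f \<in> A \<and> supp f \<subseteq> gunits G"
  unfolding diagonal_def suppG_def fsupp_def by auto

lemma e_D: "K \<in> G.CO \<Longrightarrow> e K \<in> D"
  using e_N N_A supp_e G.CO_sub by (simp add: D_iff)

lemma D_eqI: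
  assumes "f \<in> D" "g \<in> D" "\<And>x. x \<in> gunits G \<Longrightarrow> f (i (x, 1)) = g (i (x, 1))"
  shows "f = g"
proof
  fix \<sigma>
  have fg: "f \<in> A" "g \<in> A" using assms(1,2) D_iff by auto
  show "f \<sigma> = g \<sigma>"
  proof (cases "\<sigma> \<in> arr S \<and> q \<sigma> \<in> gunits G")
    case True
    then obtain t where t: "t \<in> Units_R" "\<sigma> = i (q \<sigma>, t)" using unit_fibre by blast
    then have "\<sigma> = act t (i (q \<sigma>, 1))" using act_i[of "q \<sigma>" t 1] True by auto
    then show ?thesis using A_act[OF fg(1) t(1), of "i (q \<sigma>, 1)"] A_act[OF fg(2) t(1), of "i (q \<sigma>, 1)"] True assms(3)
      by auto
  next
    case False
    then show ?thesis using A_out[OF fg(1)] A_out[OF fg(2)] A_supp_iff[OF fg(1)] A_supp_iff[OF fg(2)] assms(1,2)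
      unfolding D_iff by (metis subsetD)
  qed
qed

section \<open>Convolution\<close>

abbreviation cv :: "('b \<Rightarrow> 'r) \<Rightarrow> ('b \<Rightarrow> 'r) \<Rightarrow> 'b \<Rightarrow> 'r" (infixl "\<star>" 70) where
  "f \<star> g \<equiv> conv G S q f g"

text \<open>
  The summand of the convolution sum at \<open>\<sigma>\<close> contributed by the lift \<open>\<rho>\<close>; equivariance of both
  factors makes it depend on the image of \<open>\<rho>\<close> in \<open>G\<close> only.
\<close>

definition cterm :: "('b \<Rightarrow> 'r) \<Rightarrow> ('b \<Rightarrow> 'r) \<Rightarrow> 'b \<Rightarrow> 'b \<Rightarrow> 'r" where
  "cterm f g \<sigma> \<rho> = f \<rho> * g (mul S (ginv S \<rho>) \<sigma>)"

lemma cterm_fibre: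
  assumes "equivariant f" "equivariant g" "\<sigma> \<in> arr S" "\<rho> \<in> arr S" "\<rho>' \<in> arr S"
    and "rng S \<rho> = rng S \<sigma>" "q \<rho> = q \<rho>'"
  shows "cterm f g \<sigma> \<rho>' = cterm f g \<sigma> \<rho>"
proof -
  obtain t where t: "t \<in> Units_R" "\<rho>' = act t \<rho>"
    using fibre_act[OF assms(4,5,7)] .
  have "mul S (ginv S \<rho>') \<sigma> = act (unit_inv t) (mul S (ginv S \<rho>) \<sigma>)"
    using t assms by (simp add: inv_act mul_act_left)
  then have "g (mul S (ginv S \<rho>') \<sigma>) = t * g (mul S (ginv S \<rho>) \<sigma>)"
    using t assms equivariantD[OF assms(2), of "unit_inv t" "mul S (ginv S \<rho>) \<sigma>"] by simp
  moreover have "f \<rho>' = unit_inv t * f \<rho>"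
    using t assms equivariantD[OF assms(1)] by simp
  ultimately show ?thesis
    using t unfolding cterm_def by (simp add: ac_simps)
qed

definition lift :: "'a \<Rightarrow> 'b" where
  "lift \<alpha> = (SOME \<sigma>. \<sigma> \<in> arr S \<and> q \<sigma> = \<alpha>)"

lemma lift [simp]: "\<alpha> \<in> arr G \<Longrightarrow> lift \<alpha> \<in> arr S" "\<alpha> \<in> arr G \<Longrightarrow> q (lift \<alpha>) = \<alpha>"
  using someI_ex[of "\<lambda>\<sigma>. \<sigma> \<in> arr S \<and> q \<sigma> = \<alpha>"] ex_lift[of \<alpha>] unfolding lift_def by auto

lemma supp_section:
  assumes "\<alpha> \<in> supp f"
  shows "supp_section S q f \<alpha> \<in> arr S" "f (supp_section S q f \<alpha>) \<noteq> 0" "q (supp_section S q f \<alpha>) = \<alpha>"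
proof -
  have "\<exists>\<sigma>. \<sigma> \<in> fsupp S f \<and> q \<sigma> = \<alpha>" using assms unfolding suppG_def by auto
  from someI_ex[OF this]
  show "supp_section S q f \<alpha> \<in> arr S" "f (supp_section S q f \<alpha>) \<noteq> 0" "q (supp_section S q f \<alpha>) = \<alpha>"
    unfolding supp_section_def fsupp_def by auto
qed

text \<open>
  Any lifts may be used, and the sum may run over any finite part of the fibre that contains the
  support of the left factor.
\<close>

lemma conv_eq:
  assumes f: "equivariant f" and g: "equivariant g" and s: "\<sigma> \<in> arr S"
    and F: "finite F" "F \<subseteq> {\<alpha> \<in> arr G. rng G \<alpha> = rng G (q \<sigma>)}" "{\<alpha> \<in> supp f. rng G \<alpha> = rng G (q \<sigma>)} \<subseteq> F"
  shows "(f \<star> g) \<sigma> = (\<Sum>\<alpha>\<in>F. cterm f g \<sigma> (lift \<alpha>))"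
proof -
  let ?I = "{\<alpha> \<in> arr G. rng G \<alpha> = rng G (q \<sigma>)} \<inter> supp f"
  have "(f \<star> g) \<sigma> = (\<Sum>\<alpha>\<in>?I. cterm f g \<sigma> (supp_section S q f \<alpha>))"
    using s by (simp add: conv_def cterm_def)
  also have "\<dots> = (\<Sum>\<alpha>\<in>?I. cterm f g \<sigma> (lift \<alpha>))"
  proof (rule sum.cong[OF refl])
    fix \<alpha> assume a: "\<alpha> \<in> ?I"
    then show "cterm f g \<sigma> (supp_section S q f \<alpha>) = cterm f g \<sigma> (lift \<alpha>)"
      using s supp_section[of \<alpha> f] by (intro cterm_fibre[OF f g]) (auto simp: rng_eq_iff)
  qed
  also have "\<dots> = (\<Sum>\<alpha>\<in>F. cterm f g \<sigma> (lift \<alpha>))"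
  proof (rule sum.mono_neutral_left[OF F(1)])
    show "?I \<subseteq> F" using F(3) by auto
    show "\<forall>\<alpha>\<in>F - ?I. cterm f g \<sigma> (lift \<alpha>) = 0"
    proof
      fix \<alpha> assume "\<alpha> \<in> F - ?I"
      then have "\<alpha> \<in> arr G" "\<alpha> \<notin> supp f" using F(2) by auto
      then have "f (lift \<alpha>) = 0" using supp_iff[OF f, of "lift \<alpha>"] by simp
      then show "cterm f g \<sigma> (lift \<alpha>) = 0" by (simp add: cterm_def)
    qed
  qed
  finally show ?thesis .
qed

lemma finite_fib: "f \<in> A \<Longrightarrow> finite {\<alpha> \<in> supp f. rng G \<alpha> = x}"
  using G.finite_fibre A_compact by blast

lemma conv_out [simp]: "\<sigma> \<notin> arr S \<Longrightarrow> (f \<star> g) \<sigma> = 0"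
  by (simp add: conv_def)

lemma conv_add_left:
  assumes "f \<in> A" "f' \<in> A" "g \<in> A"
  shows "(\<lambda>\<sigma>. f \<sigma> + f' \<sigma>) \<star> g = (\<lambda>\<sigma>. (f \<star> g) \<sigma> + (f' \<star> g) \<sigma>)"
proof
  fix \<sigma>
  let ?s = "\<lambda>\<sigma>. f \<sigma> + f' \<sigma>"
  show "(?s \<star> g) \<sigma> = (f \<star> g) \<sigma> + (f' \<star> g) \<sigma>"
  proof (cases "\<sigma> \<in> arr S")
    case True
    let ?F = "{\<alpha> \<in> supp f. rng G \<alpha> = rng G (q \<sigma>)} \<union> {\<alpha> \<in> supp f'. rng G \<alpha> = rng G (q \<sigma>)}"
    have F: "finite ?F" "?F \<subseteq> {\<alpha> \<in> arr G. rng G \<alpha> = rng G (q \<sigma>)}"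
      using finite_fib assms supp_arr by auto
    have "supp ?s \<subseteq> supp f \<union> supp f'"
      unfolding suppG_def fsupp_def by auto
    then have c: "{\<alpha> \<in> supp ?s. rng G \<alpha> = rng G (q \<sigma>)} \<subseteq> ?F" by auto
    have "(?s \<star> g) \<sigma> = (\<Sum>\<alpha>\<in>?F. cterm ?s g \<sigma> (lift \<alpha>))"
      by (rule conv_eq[OF A_equivariant[OF A_add[OF assms(1,2)]] A_equivariant[OF assms(3)] True F c])
    also have "\<dots> = (\<Sum>\<alpha>\<in>?F. cterm f g \<sigma> (lift \<alpha>)) + (\<Sum>\<alpha>\<in>?F. cterm f' g \<sigma> (lift \<alpha>))"
      by (simp add: cterm_def distrib_right sum.distrib)
    also have "(\<Sum>\<alpha>\<in>?F. cterm f g \<sigma> (lift \<alpha>)) = (f \<star> g) \<sigma>"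
      by (rule conv_eq[OF A_equivariant[OF assms(1)] A_equivariant[OF assms(3)] True F, symmetric]) auto
    also have "(\<Sum>\<alpha>\<in>?F. cterm f' g \<sigma> (lift \<alpha>)) = (f' \<star> g) \<sigma>"
      by (rule conv_eq[OF A_equivariant[OF assms(2)] A_equivariant[OF assms(3)] True F, symmetric]) auto
    finally show ?thesis .
  qed simp
qed

lemma conv_scale_left:
  assumes "f \<in> A" "g \<in> A"
  shows "(\<lambda>\<sigma>. c * f \<sigma>) \<star> g = (\<lambda>\<sigma>. c * (f \<star> g) \<sigma>)"
proof
  fix \<sigma>
  let ?s = "\<lambda>\<sigma>. c * f \<sigma>"
  show "(?s \<star> g) \<sigma> = c * (f \<star> g) \<sigma>"
  proof (cases "\<sigma> \<in> arr S")
    case True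
    let ?F = "{\<alpha> \<in> supp f. rng G \<alpha> = rng G (q \<sigma>)}"
    have F: "finite ?F" "?F \<subseteq> {\<alpha> \<in> arr G. rng G \<alpha> = rng G (q \<sigma>)}"
      using finite_fib assms supp_arr by auto
    have "supp ?s \<subseteq> supp f"
      unfolding suppG_def fsupp_def by auto
    then have c: "{\<alpha> \<in> supp ?s. rng G \<alpha> = rng G (q \<sigma>)} \<subseteq> ?F" by auto
    have "(?s \<star> g) \<sigma> = (\<Sum>\<alpha>\<in>?F. cterm ?s g \<sigma> (lift \<alpha>))"
      by (rule conv_eq[OF A_equivariant[OF A_scale[OF assms(1)]] A_equivariant[OF assms(2)] True F c])
    also have "\<dots> = c * (\<Sum>\<alpha>\<in>?F. cterm f g \<sigma> (lift \<alpha>))"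
      by (simp add: cterm_def sum_distrib_left mult.assoc)
    also have "(\<Sum>\<alpha>\<in>?F. cterm f g \<sigma> (lift \<alpha>)) = (f \<star> g) \<sigma>"
      by (rule conv_eq[OF A_equivariant[OF assms(1)] A_equivariant[OF assms(2)] True F subset_refl, symmetric])
    finally show ?thesis .
  qed simp
qed

lemma conv_zero_left: "(\<lambda>\<sigma>. 0) \<star> g = (\<lambda>\<sigma>. 0)"
  by (auto simp: conv_def suppG_def fsupp_def)

lemma conv_nonzero:
  assumes "(f \<star> g) \<sigma> \<noteq> 0"
  obtains \<rho> where "\<rho> \<in> arr S" "rng S \<rho> = rng S \<sigma>" "f \<rho> \<noteq> 0" "g (mul S (ginv S \<rho>) \<sigma>) \<noteq> 0"
proof -
  have s: "\<sigma> \<in> arr S" using assms conv_out by metis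
  let ?I = "{\<alpha> \<in> arr G. rng G \<alpha> = q (rng S \<sigma>)} \<inter> supp f"
  let ?t = "\<lambda>\<alpha>. f (supp_section S q f \<alpha>) * g (mul S (ginv S (supp_section S q f \<alpha>)) \<sigma>)"
  have "(\<Sum>\<alpha>\<in>?I. ?t \<alpha>) \<noteq> 0"
    using assms s unfolding conv_def by simp
  then obtain \<alpha> where a: "\<alpha> \<in> ?I" "?t \<alpha> \<noteq> 0"
    by (rule sum.not_neutral_contains_not_neutral)
  show thesis
  proof (rule that)
    show "supp_section S q f \<alpha> \<in> arr S" "f (supp_section S q f \<alpha>) \<noteq> 0"
      using a supp_section[of \<alpha> f] by auto
    show "rng S (supp_section S q f \<alpha>) = rng S \<sigma>"
      using a supp_section[of \<alpha> f] s by (simp add: rng_eq_iff)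
    show "g (mul S (ginv S (supp_section S q f \<alpha>)) \<sigma>) \<noteq> 0"
      using a(2) by auto
  qed
qed

lemma supp_conv:
  assumes "\<alpha> \<in> supp (f \<star> g)"
  obtains \<beta> \<gamma> where "\<beta> \<in> supp f" "\<gamma> \<in> supp g" "src G \<beta> = rng G \<gamma>" "\<alpha> = mul G \<beta> \<gamma>"
proof -
  obtain \<sigma> where s: "\<sigma> \<in> arr S" "(f \<star> g) \<sigma> \<noteq> 0" "\<alpha> = q \<sigma>"
    using assms unfolding suppG_def fsupp_def by auto
  obtain \<rho> where r: "\<rho> \<in> arr S" "rng S \<rho> = rng S \<sigma>" "f \<rho> \<noteq> 0" "g (mul S (ginv S \<rho>) \<sigma>) \<noteq> 0"
    using s(2) by (rule conv_nonzero)
  let ?\<tau> = "mul S (ginv S \<rho>) \<sigma>"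
  have t: "?\<tau> \<in> arr S" "src S \<rho> = rng S ?\<tau>" "mul S \<rho> ?\<tau> = \<sigma>"
    using r s by auto
  show thesis
  proof (rule that)
    show "q \<rho> \<in> supp f" "q ?\<tau> \<in> supp g" using r t(1) unfolding suppG_def fsupp_def by blast+
    show "src G (q \<rho>) = rng G (q ?\<tau>)" using src_rng_iff[OF r(1) t(1)] t(2) by simp
    show "\<alpha> = mul G (q \<rho>) (q ?\<tau>)" using q_mul[OF r(1) t(1,2)] t(3) s(3) by simp
  qed
qed

lemma conv_single:
  assumes f: "f \<in> A" and g: "g \<in> A" and inj: "inj_on (rng G) (supp f)"
    and s: "\<sigma> \<in> arr S" "\<rho> \<in> arr S" "rng S \<rho> = rng S \<sigma>" "f \<rho> \<noteq> 0"
  shows "(f \<star> g) \<sigma> = f \<rho> * g (mul S (ginv S \<rho>) \<sigma>)"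
proof -
  have r: "q \<rho> \<in> supp f" "rng G (q \<rho>) = rng G (q \<sigma>)"
    using s A_supp_iff[OF f] by (simp_all add: rng_eq_iff)
  have "(f \<star> g) \<sigma> = (\<Sum>\<alpha>\<in>{q \<rho>}. cterm f g \<sigma> (lift \<alpha>))"
  proof (rule conv_eq[OF A_equivariant[OF f] A_equivariant[OF g] s(1)])
    show "{\<alpha> \<in> supp f. rng G \<alpha> = rng G (q \<sigma>)} \<subseteq> {q \<rho>}"
    proof
      fix \<alpha> assume "\<alpha> \<in> {\<alpha> \<in> supp f. rng G \<alpha> = rng G (q \<sigma>)}"
      then have "\<alpha> = q \<rho>" using r by - (rule inj_onD[OF inj], auto)
      then show "\<alpha> \<in> {q \<rho>}" by simp
    qed
  qed (use r s in auto)
  also have "\<dots> = cterm f g \<sigma> \<rho>"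
    using cterm_fibre[OF A_equivariant[OF f] A_equivariant[OF g] s(1,2), of "lift (q \<rho>)"] s by simp
  finally show ?thesis by (simp add: cterm_def)
qed

text \<open>
  Multiplicativity of the values of monomials, from which the reconstructed map inherits being a
  homomorphism.
\<close>

lemma conv_mul:
  assumes "n \<in> N" "g \<in> A" "\<sigma> \<in> arr S" "\<tau> \<in> arr S" "src S \<sigma> = rng S \<tau>" "n \<sigma> \<noteq> 0"
  shows "(n \<star> g) (mul S \<sigma> \<tau>) = n \<sigma> * g \<tau>"
  using conv_single[OF N_A[OF assms(1)] assms(2) N_rng[OF assms(1)], of "mul S \<sigma> \<tau>" \<sigma>] assms by simp

lemma conv_e_left:
  assumes K: "K \<in> G.CO" and g: "g \<in> A" and s: "\<sigma> \<in> arr S"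
  shows "(e K \<star> g) \<sigma> = (if rng G (q \<sigma>) \<in> K then g \<sigma> else 0)"
proof (cases "rng G (q \<sigma>) \<in> K")
  case True
  have "e K (rng S \<sigma>) = 1"
    using e_unit[OF G.CO_sub[OF K], of "rng S \<sigma>"] s True by simp
  then show ?thesis
    using conv_single[OF N_A[OF e_N[OF K]] g N_rng[OF e_N[OF K]] s, of "rng S \<sigma>"] s True by simp
next
  case False
  have "(e K \<star> g) \<sigma> = 0"
  proof (rule ccontr)
    assume "(e K \<star> g) \<sigma> \<noteq> 0"
    then obtain \<rho> where r: "\<rho> \<in> arr S" "rng S \<rho> = rng S \<sigma>" "e K \<rho> \<noteq> 0"
      by (rule conv_nonzero)
    then have "q \<rho> \<in> K" by (auto simp: e_def split: if_splits)
    moreover have "rng G (q \<rho>) = rng G (q \<sigma>)" using r s by (simp add: rng_eq_iff)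
    ultimately show False using False G.gunits_rng G.CO_sub[OF K] by (metis subsetD)
  qed
  then show ?thesis using False by simp
qed

lemma conv_e_right:
  assumes K: "K \<in> G.CO" and f: "f \<in> A" and s: "\<sigma> \<in> arr S"
  shows "(f \<star> e K) \<sigma> = (if src G (q \<sigma>) \<in> K then f \<sigma> else 0)"
proof -
  let ?F = "insert (q \<sigma>) {\<alpha> \<in> supp f. rng G \<alpha> = rng G (q \<sigma>)}"
  have KX: "K \<subseteq> gunits G" by (rule G.CO_sub[OF K])
  have ee: "equivariant (e K)" by (rule A_equivariant[OF N_A[OF e_N[OF K]]])
  have F: "finite ?F" "?F \<subseteq> {\<alpha> \<in> arr G. rng G \<alpha> = rng G (q \<sigma>)}"
    using finite_fib[OF f] supp_arr s by auto
  have "(f \<star> e K) \<sigma> = (\<Sum>\<alpha>\<in>?F. cterm f (e K) \<sigma> (lift \<alpha>))"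
    by (rule conv_eq[OF A_equivariant[OF f] ee s F]) auto
  also have "\<dots> = (\<Sum>\<alpha>\<in>{q \<sigma>}. cterm f (e K) \<sigma> (lift \<alpha>))"
  proof (rule sum.mono_neutral_right[OF F(1)])
    show "\<forall>\<alpha>\<in>?F - {q \<sigma>}. cterm f (e K) \<sigma> (lift \<alpha>) = 0"
    proof
      fix \<alpha> assume a: "\<alpha> \<in> ?F - {q \<sigma>}"
      then have a': "\<alpha> \<in> arr G" "rng G \<alpha> = rng G (q \<sigma>)" using F(2) by auto
      have "q (mul S (ginv S (lift \<alpha>)) \<sigma>) = mul G (ginv G \<alpha>) (q \<sigma>)"
        using a' s by (simp add: rng_eq_iff)
      then have "q (mul S (ginv S (lift \<alpha>)) \<sigma>) \<notin> K"
        using G.inv_mul_unit[of \<alpha> "q \<sigma>"] a a' s KX by auto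
      then show "cterm f (e K) \<sigma> (lift \<alpha>) = 0" by (simp add: cterm_def e_def)
    qed
  qed auto
  also have "\<dots> = cterm f (e K) \<sigma> \<sigma>"
    using cterm_fibre[OF A_equivariant[OF f] ee s s, of "lift (q \<sigma>)"] s by simp
  also have "\<dots> = (if src G (q \<sigma>) \<in> K then f \<sigma> else 0)"
    using s e_unit[OF KX, of "src S \<sigma>"] by (simp add: cterm_def)
  finally show ?thesis .
qed

lemma e_conv_e:
  assumes "K \<in> G.CO" "L \<in> G.CO"
  shows "e K \<star> e L = e (K \<inter> L)"
proof
  fix \<sigma>
  show "(e K \<star> e L) \<sigma> = e (K \<inter> L) \<sigma>"
  proof (cases "\<sigma> \<in> arr S")
    case True
    have "rng G (q \<sigma>) = q \<sigma>" if "q \<sigma> \<in> L" using that G.CO_sub[OF assms(2)] by auto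
    then show ?thesis using conv_e_left[OF assms(1) N_A[OF e_N[OF assms(2)]] True] by (auto simp: e_def)
  qed (simp add: e_def)
qed

lemma e_inj: "K \<subseteq> gunits G \<Longrightarrow> L \<subseteq> gunits G \<Longrightarrow> e K = e L \<Longrightarrow> K = L"
  using supp_e by metis

text \<open>This is where indecomposability enters: the values at units are idempotents of the ring.\<close>

lemma idempotent_D:
  assumes b: "b \<in> D" and bb: "b \<star> b = b"
  shows "\<exists>K\<in>G.CO. b = e K"
proof -
  have bA: "b \<in> A" and bX: "supp b \<subseteq> gunits G" using b D_iff by auto
  have K: "supp b \<in> G.CO"
    using A_compact[OF bA] A_clopen_supp[OF bA] bX by (simp add: G.CO_iff G.clopen_def)
  have inj: "inj_on (rng G) (supp b)"
    using bX G.gunits_rng by (metis inj_onI subsetD)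
  have "b = e (supp b)"
  proof (rule D_eqI[OF b e_D[OF K]])
    fix x assume x: "x \<in> gunits G"
    have e: "e (supp b) (i (x, 1)) = (if x \<in> supp b then 1 else 0)"
      using e_i[OF bX x, of 1] by simp
    have sb: "x \<in> supp b \<longleftrightarrow> b (i (x, 1)) \<noteq> 0"
      using A_supp_iff[OF bA, of "i (x, 1)"] x by simp
    show "b (i (x, 1)) = e (supp b) (i (x, 1))"
    proof (cases "b (i (x, 1)) = 0")
      case False
      then have "b (i (x, 1)) = b (i (x, 1)) * b (i (x, 1))"
        using conv_single[OF bA bA inj, of "i (x, 1)" "i (x, 1)"] x bb
        by (simp add: S.inv_unit[OF i_unit])
      then have "b (i (x, 1)) = 1" using idem[of "b (i (x, 1))"] False by simp
      then show ?thesis using e sb by simp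
    qed (use e sb in simp)
  qed
  then show ?thesis using K by blast
qed

section \<open>Monomials span\<close>

text \<open>
  Locally every function agrees with a multiple of a monomial; a finite cover of the support by
  such clopen pieces can be made disjoint. The conclusion that monomials span is phrased as an
  induction rule for properties that are closed under linear combinations.
\<close>

lemma span_induct:
  assumes f: "f \<in> A" and zero: "P (\<lambda>\<sigma>. 0)"
    and add: "\<And>f g. f \<in> A \<Longrightarrow> g \<in> A \<Longrightarrow> P f \<Longrightarrow> P g \<Longrightarrow> P (\<lambda>\<sigma>. f \<sigma> + g \<sigma>)"
    and scale: "\<And>c n. n \<in> N \<Longrightarrow> P (\<lambda>\<sigma>. c * n \<sigma>)"
  shows "P f"
proof -
  define good where "good K \<longleftrightarrow> G.clopen K \<and> (\<forall>W. G.clopen W \<longrightarrow> W \<subseteq> K \<longrightarrow> P (res W f))" for K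
  have good_Un: "good (K \<union> L)" if K: "good K" and L: "good L" for K L
    unfolding good_def
  proof (intro conjI allI impI)
    show "G.clopen (K \<union> L)" using K L G.clopen_Un unfolding good_def by auto
    fix W assume W: "G.clopen W" "W \<subseteq> K \<union> L"
    have c: "G.clopen (W \<inter> K)" "G.clopen (W - K)"
      using W K G.clopen_Int G.clopen_Diff unfolding good_def by auto
    have "P (res (W \<inter> K) f)" "P (res (W - K) f)"
      using K L c W unfolding good_def by blast+
    then have "P (\<lambda>\<sigma>. res (W \<inter> K) f \<sigma> + res (W - K) f \<sigma>)"
      using A_res[OF f] c by (intro add) auto
    moreover have "(\<lambda>\<sigma>. res (W \<inter> K) f \<sigma> + res (W - K) f \<sigma>) = res W f"
      by (auto simp: res_def)
    ultimately show "P (res W f)" by simp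
  qed
  have good_empty: "good {}"
    unfolding good_def
  proof (intro conjI allI impI)
    show "G.clopen {}" by (simp add: G.clopen_def)
    fix W :: "'a set" assume "W \<subseteq> {}"
    then show "P (res W f)" using zero by (simp add: res_def)
  qed
  have good_Union: "good (\<Union>\<F>)" if "finite \<F>" "\<And>K. K \<in> \<F> \<Longrightarrow> good K" for \<F>
    using that by (induction \<F>) (simp_all add: good_empty good_Un)
  have local: "\<exists>K. openin (arr_top G) K \<and> \<alpha> \<in> K \<and> good K" if a: "\<alpha> \<in> supp f" for \<alpha>
  proof -
    have aG: "\<alpha> \<in> arr G" using a supp_arr by auto
    let ?s = "lift \<alpha>"
    obtain n where n: "n \<in> N" "n ?s = 1" using ex_monomial[of ?s] aG by auto
    let ?c = "f ?s"
    let ?O = "{\<tau> \<in> arr S. f \<tau> \<in> {?c}} \<inter> {\<tau> \<in> arr S. n \<tau> \<in> {1}}"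
    have "openin (arr_top S) ?O"
      using lconst_open A_lconst[OF f] A_lconst[OF N_A[OF n(1)]] by blast
    then have o: "openin (arr_top G) (q ` ?O)" using q_open unfolding open_map_def by blast
    have aO: "\<alpha> \<in> q ` ?O" using n aG by (intro image_eqI[of _ q ?s]) auto
    obtain K where K: "compactin (arr_top G) K" "openin (arr_top G) K" "bisection G K" "\<alpha> \<in> K" "K \<subseteq> q ` ?O"
      using G.ample_base[OF o aO] .
    have eq: "f \<sigma> = ?c * n \<sigma>" if s: "\<sigma> \<in> arr S" "q \<sigma> \<in> K" for \<sigma>
    proof -
      obtain \<tau> where t: "\<tau> \<in> arr S" "f \<tau> = ?c" "n \<tau> = 1" "q \<tau> = q \<sigma>" using K(5) s by auto
      obtain u where u: "u \<in> Units_R" "\<sigma> = act u \<tau>"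
        using fibre_act[OF t(1) s(1) t(4)] .
      then show ?thesis using t A_act[OF f u(1) t(1)] A_act[OF N_A[OF n(1)] u(1) t(1)] by (simp add: mult.commute)
    qed
    have "P (res W f)" if W: "G.clopen W" "W \<subseteq> K" for W
    proof -
      have "f \<sigma> = ?c * n \<sigma>" if "q \<sigma> \<in> W" for \<sigma>
        using eq[of \<sigma>] that W(2) A_out[OF f] A_out[OF N_A[OF n(1)]] by (cases "\<sigma> \<in> arr S") auto
      then have "res W f = (\<lambda>\<sigma>. ?c * res W n \<sigma>)" by (auto simp: res_def)
      then show ?thesis using scale[OF N_res[OF n(1) W(1)], of ?c] by simp
    qed
    then show ?thesis using K G.clopen_compact_open unfolding good_def by blast
  qed
  let ?U = "{K. openin (arr_top G) K \<and> good K}"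
  have "supp f \<subseteq> \<Union>?U" using local by blast
  then obtain \<F> where F: "finite \<F>" "\<F> \<subseteq> ?U" "supp f \<subseteq> \<Union>\<F>"
    using A_compact[OF f] unfolding compactin_def by (metis (mono_tags, lifting) mem_Collect_eq)
  have "good (\<Union>\<F>)" using F by (intro good_Union) auto
  then have "P (res (supp f) f)"
    using F(3) A_clopen_supp[OF f] unfolding good_def by blast
  moreover have "res (supp f) f = f"
  proof
    show "res (supp f) f \<sigma> = f \<sigma>" for \<sigma>
      using A_supp_iff[OF f, of \<sigma>] A_out[OF f, of \<sigma>] by (cases "\<sigma> \<in> arr S") (auto simp: res_def)
  qed
  ultimately show ?thesis by simp
qed

section \<open>The Steinberg algebra is closed under convolution\<close>

lemma conv_act:
  assumes f: "f \<in> A" and g: "g \<in> A" and s: "\<sigma> \<in> arr S" and t: "t \<in> Units_R"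
  shows "(f \<star> g) (act t \<sigma>) = unit_inv t * (f \<star> g) \<sigma>"
proof -
  let ?F = "{\<alpha> \<in> supp f. rng G \<alpha> = rng G (q \<sigma>)}"
  have F: "finite ?F" "?F \<subseteq> {\<alpha> \<in> arr G. rng G \<alpha> = rng G (q \<sigma>)}"
    using finite_fib[OF f] supp_arr by auto
  have F': "?F \<subseteq> {\<alpha> \<in> arr G. rng G \<alpha> = rng G (q (act t \<sigma>))}" "{\<alpha> \<in> supp f. rng G \<alpha> = rng G (q (act t \<sigma>))} \<subseteq> ?F"
    using F s t by auto
  have "cterm f g (act t \<sigma>) (lift \<alpha>) = unit_inv t * cterm f g \<sigma> (lift \<alpha>)" if "\<alpha> \<in> ?F" for \<alpha>
  proof -
    have a: "\<alpha> \<in> arr G" "rng S (lift \<alpha>) = rng S \<sigma>" using that F s by (auto simp: rng_eq_iff)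
    then have "mul S (ginv S (lift \<alpha>)) (act t \<sigma>) = act t (mul S (ginv S (lift \<alpha>)) \<sigma>)"
      using s t by (intro mul_act_right) auto
    then show ?thesis using a s t by (simp add: cterm_def A_act[OF g] ac_simps)
  qed
  then have "(\<Sum>\<alpha>\<in>?F. cterm f g (act t \<sigma>) (lift \<alpha>)) = unit_inv t * (\<Sum>\<alpha>\<in>?F. cterm f g \<sigma> (lift \<alpha>))"
    by (simp add: sum_distrib_left)
  then show ?thesis
    using conv_eq[OF A_equivariant[OF f] A_equivariant[OF g] _ F(1) F'] s t
      conv_eq[OF A_equivariant[OF f] A_equivariant[OF g] s F subset_refl] by simp
qed

lemma open_rng_q: "openin (arr_top S) U \<Longrightarrow> openin (unit_space G) ((\<lambda>\<sigma>. rng G (q \<sigma>)) ` U)"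
  and open_src_q: "openin (arr_top S) U \<Longrightarrow> openin (unit_space G) ((\<lambda>\<sigma>. src G (q \<sigma>)) ` U)"
  using open_map_compose[OF q_open G.open_rng_src(1)] open_map_compose[OF q_open G.open_rng_src(2)]
  unfolding open_map_def comp_def by blast+

lemma cont_rng_q: "continuous_map (arr_top S) (unit_space G) (\<lambda>\<sigma>. rng G (q \<sigma>))"
  and cont_src_q: "continuous_map (arr_top S) (unit_space G) (\<lambda>\<sigma>. src G (q \<sigma>))"
  using continuous_map_compose[OF q_cont G.rng_cont] continuous_map_compose[OF q_cont G.src_cont]
  unfolding comp_def by blast+

text \<open>
  Continuity of the division map on the pairs of arrows with a common range.
\<close>

lemma division_nbhd:
  assumes g: "lconst g" and s: "\<sigma> \<in> arr S" and r: "\<rho> \<in> arr S" "rng S \<rho> = rng S \<sigma>"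
  obtains U V where "openin (arr_top S) U" "openin (arr_top S) V" "\<rho> \<in> U" "\<sigma> \<in> V"
    "\<forall>\<rho>'\<in>U. \<forall>\<sigma>'\<in>V. rng S \<rho>' = rng S \<sigma>' \<longrightarrow> g (mul S (ginv S \<rho>') \<sigma>') = g (mul S (ginv S \<rho>) \<sigma>)"
proof -
  let ?T = "prod_topology (arr_top S) (arr_top S)"
  let ?E = "{p \<in> topspace ?T. rng S (fst p) = rng S (snd p)}"
  have invc: "continuous_map (arr_top S) (arr_top S) (ginv S)"
    and mulc: "continuous_map (subtopology ?T (composable S)) (arr_top S) (\<lambda>(a, b). mul S a b)"
    using S_top unfolding topological_groupoid_def by auto
  have "continuous_map ?T ?T (\<lambda>p. (ginv S (fst p), snd p))"
    using continuous_map_compose[OF continuous_map_fst invc]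
    by (intro continuous_map_pairedI continuous_map_snd) (simp add: comp_def)
  then have "continuous_map (subtopology ?T ?E) (subtopology ?T (composable S)) (\<lambda>p. (ginv S (fst p), snd p))"
    by (intro continuous_map_into_subtopology continuous_map_from_subtopology) (auto simp: composable_def)
  from continuous_map_compose[OF continuous_map_compose[OF this mulc] g]
  have "continuous_map (subtopology ?T ?E) (discrete_topology UNIV) (\<lambda>p. g (mul S (ginv S (fst p)) (snd p)))"
    by (simp add: comp_def)
  from openin_continuous_map_preimage[OF this, of "{g (mul S (ginv S \<rho>) \<sigma>)}"]
  have "openin (subtopology ?T ?E) {p \<in> topspace (subtopology ?T ?E).
      g (mul S (ginv S (fst p)) (snd p)) \<in> {g (mul S (ginv S \<rho>) \<sigma>)}}"
    by simp
  also have "{p \<in> topspace (subtopology ?T ?E). g (mul S (ginv S (fst p)) (snd p)) \<in> {g (mul S (ginv S \<rho>) \<sigma>)}}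
      = {p \<in> ?E. g (mul S (ginv S (fst p)) (snd p)) = g (mul S (ginv S \<rho>) \<sigma>)}"
    unfolding topspace_subtopology by blast
  finally have "openin (subtopology ?T ?E) {p \<in> ?E. g (mul S (ginv S (fst p)) (snd p)) = g (mul S (ginv S \<rho>) \<sigma>)}" .
  then obtain Q where Q: "openin ?T Q"
    "{p \<in> ?E. g (mul S (ginv S (fst p)) (snd p)) = g (mul S (ginv S \<rho>) \<sigma>)} = Q \<inter> ?E"
    unfolding openin_subtopology by auto
  have "(\<rho>, \<sigma>) \<in> Q \<inter> ?E" unfolding Q(2)[symmetric] using s r by simp
  then have "(\<rho>, \<sigma>) \<in> Q" by simp
  from Q(1)[unfolded openin_prod_topology_alt, rule_format, OF this]
  obtain U V where UV: "openin (arr_top S) U" "openin (arr_top S) V" "\<rho> \<in> U" "\<sigma> \<in> V" "U \<times> V \<subseteq> Q"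
    by (elim exE conjE)
  show thesis
  proof (rule that[OF UV(1-4)], intro ballI impI)
    fix \<rho>' \<sigma>' assume "\<rho>' \<in> U" "\<sigma>' \<in> V" "rng S \<rho>' = rng S \<sigma>'"
    then have "(\<rho>', \<sigma>') \<in> Q \<inter> ?E" using UV(5) openin_subset[OF UV(1)] openin_subset[OF UV(2)] by auto
    then show "g (mul S (ginv S \<rho>') \<sigma>') = g (mul S (ginv S \<rho>) \<sigma>)"
      unfolding Q(2)[symmetric] by simp
  qed
qed

text \<open>
  The product vanishes at \<open>\<sigma>\<close> unless the range of \<open>\<sigma>\<close> is a range of the support of \<open>n\<close>, which is a
  clopen condition. If it holds, a single fibre of \<open>q\<close> contributes to the convolution at \<open>\<sigma>\<close>, and it
  contains an arrow \<open>\<rho>\<close> at which \<open>n\<close> is one. As the range map is open, every arrow near \<open>\<sigma>\<close> shares its range with some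
  arrow near \<open>\<rho>\<close> at which \<open>n\<close> is still one, and the remaining factor is locally constant in both.
\<close>

lemma conv_N_lconst:
  assumes n: "n \<in> N" and g: "g \<in> A"
  shows "lconst (n \<star> g)"
proof -
  note nA = N_A[OF n]
  let ?W = "{\<alpha> \<in> arr G. rng G \<alpha> \<in> rng G ` supp n}"
  have W: "G.clopen ?W"
    using A_clopen_supp[OF nA] A_compact[OF nA] unfolding G.clopen_def
    by (intro G.clopen_preimage[unfolded G.clopen_def] G.CO_image) auto
  show ?thesis
  proof (rule lconst_clopenI[OF W])
    fix \<sigma> assume s: "\<sigma> \<in> arr S" "q \<sigma> \<notin> ?W"
    show "(n \<star> g) \<sigma> = 0"
    proof (rule ccontr)
      assume "(n \<star> g) \<sigma> \<noteq> 0"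
      then obtain \<rho> where r: "\<rho> \<in> arr S" "rng S \<rho> = rng S \<sigma>" "n \<rho> \<noteq> 0" by (rule conv_nonzero)
      then have "q \<rho> \<in> supp n" "rng G (q \<rho>) = rng G (q \<sigma>)" using A_supp_iff[OF nA] s by (auto simp: rng_eq_iff)
      then show False using s by (auto simp: image_iff)
    qed
  next
    fix \<sigma> assume s: "\<sigma> \<in> arr S" "q \<sigma> \<in> ?W"
    then obtain \<beta> where b: "\<beta> \<in> supp n" "rng G (q \<sigma>) = rng G \<beta>" by auto
    then obtain \<rho>0 where r0: "\<rho>0 \<in> arr S" "n \<rho>0 \<noteq> 0" "\<beta> = q \<rho>0" unfolding suppG_def fsupp_def by auto
    then obtain \<rho> where r: "\<rho> \<in> arr S" "q \<rho> = \<beta>" "n \<rho> = 1"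
      using ex_normalised[OF n r0(1,2)] by metis
    have rr: "rng S \<rho> = rng S \<sigma>" using r b s by (simp add: rng_eq_iff)
    obtain U V where UV: "openin (arr_top S) U" "openin (arr_top S) V" "\<rho> \<in> U" "\<sigma> \<in> V"
      "\<forall>\<rho>'\<in>U. \<forall>\<sigma>'\<in>V. rng S \<rho>' = rng S \<sigma>' \<longrightarrow> g (mul S (ginv S \<rho>') \<sigma>') = g (mul S (ginv S \<rho>) \<sigma>)"
      using division_nbhd[OF A_lconst[OF g] s(1) r(1) rr] .
    let ?U = "U \<inter> {\<tau> \<in> arr S. n \<tau> \<in> {1}}"
    let ?V = "V \<inter> {\<tau> \<in> arr S. rng G (q \<tau>) \<in> (\<lambda>\<sigma>. rng G (q \<sigma>)) ` ?U}"
    have "openin (unit_space G) ((\<lambda>\<sigma>. rng G (q \<sigma>)) ` ?U)"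
      using UV(1) lconst_open[OF A_lconst[OF nA]] by (intro open_rng_q openin_Int)
    then have "openin (arr_top S) ?V"
      using UV(2) by (intro openin_Int openin_continuous_map_preimage[OF cont_rng_q])
    moreover have "\<sigma> \<in> ?V"
      using UV(3,4) r b s by (auto intro!: image_eqI[of _ _ \<rho>])
    moreover have "(n \<star> g) \<tau> = g (mul S (ginv S \<rho>) \<sigma>)" if t: "\<tau> \<in> ?V" for \<tau>
    proof -
      obtain \<rho>' where r': "\<rho>' \<in> U" "\<rho>' \<in> arr S" "n \<rho>' = 1" "rng G (q \<tau>) = rng G (q \<rho>')"
        using t by auto
      then have rt: "rng S \<rho>' = rng S \<tau>" using t by (simp add: rng_eq_iff)
      then have "g (mul S (ginv S \<rho>') \<tau>) = g (mul S (ginv S \<rho>) \<sigma>)"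
        using UV(5) t r'(1) by blast
      then show ?thesis
        using conv_single[OF nA g N_rng[OF n], of \<tau> \<rho>'] rt t r' by simp
    qed
    ultimately show "\<exists>U. openin (arr_top S) U \<and> \<sigma> \<in> U \<and> U \<inter> {\<tau>. q \<tau> \<in> ?W} \<subseteq> {\<tau>. (n \<star> g) \<tau> = (n \<star> g) \<sigma>}"
      by (intro exI[of _ ?V] conjI) (assumption | simp add: subset_iff)+
  qed
qed

lemma conv_N_A:
  assumes n: "n \<in> N" and g: "g \<in> A"
  shows "n \<star> g \<in> A"
proof (rule A_intro)
  show "(n \<star> g) \<sigma> = 0" if "\<sigma> \<notin> arr S" for \<sigma> using that by simp
  show "lconst (n \<star> g)" using n g by (rule conv_N_lconst)
  show "equivariant (n \<star> g)" unfolding equivariant_def using conv_act[OF N_A[OF n] g] by blast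
  show "compactin (arr_top G) {mul G a b |a b. a \<in> supp n \<and> b \<in> supp g \<and> src G a = rng G b}"
    by (rule compactin_mul[OF G.topological A_compact[OF N_A[OF n]] A_compact[OF g]])
  show "supp (n \<star> g) \<subseteq> {mul G a b |a b. a \<in> supp n \<and> b \<in> supp g \<and> src G a = rng G b}"
    by (rule subsetI, erule supp_conv) blast
qed

text \<open>
  By linearity in the left factor it suffices to treat monomials there.
\<close>

lemma conv_A:
  assumes "f \<in> A" "g \<in> A"
  shows "f \<star> g \<in> A"
  using assms(1)
proof (rule span_induct[where P = "\<lambda>f. f \<star> g \<in> A"])
  show "(\<lambda>\<sigma>. 0) \<star> g \<in> A" by (simp add: conv_zero_left A_zero)
  show "(\<lambda>\<sigma>. f \<sigma> + f' \<sigma>) \<star> g \<in> A" if "f \<in> A" "f' \<in> A" "f \<star> g \<in> A" "f' \<star> g \<in> A" for f f'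
    using that by (simp add: conv_add_left[OF that(1,2) assms(2)] A_add)
  show "(\<lambda>\<sigma>. c * n \<sigma>) \<star> g \<in> A" if "n \<in> N" for c n
    using A_scale[OF conv_N_A[OF that assms(2)], of c] by (simp add: conv_scale_left[OF N_A[OF that] assms(2)])
qed

lemma conv_N:
  assumes n: "n \<in> N" and m: "m \<in> N"
  shows "n \<star> m \<in> N"
  unfolding monomials_def mem_Collect_eq
proof (intro conjI ballI impI)
  show "n \<star> m \<in> A" using conv_N_A[OF n N_A[OF m]] .
  show "(n \<star> m) \<sigma> \<in> Units_R" if s: "\<sigma> \<in> arr S" "(n \<star> m) \<sigma> \<noteq> 0" for \<sigma>
  proof -
    obtain \<rho> where r: "\<rho> \<in> arr S" "rng S \<rho> = rng S \<sigma>" "n \<rho> \<noteq> 0" "m (mul S (ginv S \<rho>) \<sigma>) \<noteq> 0"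
      using s(2) by (rule conv_nonzero)
    then show ?thesis
      using conv_single[OF N_A[OF n] N_A[OF m] N_rng[OF n] s(1) r(1-3)] N_unit[OF n] N_unit[OF m, of "mul S (ginv S \<rho>) \<sigma>"] s
      by simp
  qed
  have ar: "\<beta> \<in> arr G" if "\<beta> \<in> supp f" for \<beta> f using that supp_arr by auto
  show "inj_on (rng G) (supp (n \<star> m))"
  proof (rule inj_onI)
    fix \<alpha> \<alpha>' assume a: "\<alpha> \<in> supp (n \<star> m)" "\<alpha>' \<in> supp (n \<star> m)" "rng G \<alpha> = rng G \<alpha>'"
    obtain \<beta> \<gamma> where b: "\<beta> \<in> supp n" "\<gamma> \<in> supp m" "src G \<beta> = rng G \<gamma>" "\<alpha> = mul G \<beta> \<gamma>" using a(1) by (rule supp_conv)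
    obtain \<beta>' \<gamma>' where b': "\<beta>' \<in> supp n" "\<gamma>' \<in> supp m" "src G \<beta>' = rng G \<gamma>'" "\<alpha>' = mul G \<beta>' \<gamma>'" using a(2) by (rule supp_conv)
    have "\<beta> = \<beta>'" using a(3) b b' ar by - (rule inj_onD[OF N_rng[OF n]], auto)
    moreover from this have "\<gamma> = \<gamma>'" using b b' by - (rule inj_onD[OF N_rng[OF m]], auto)
    ultimately show "\<alpha> = \<alpha>'" using b b' by simp
  qed
  show "inj_on (src G) (supp (n \<star> m))"
  proof (rule inj_onI)
    fix \<alpha> \<alpha>' assume a: "\<alpha> \<in> supp (n \<star> m)" "\<alpha>' \<in> supp (n \<star> m)" "src G \<alpha> = src G \<alpha>'"
    obtain \<beta> \<gamma> where b: "\<beta> \<in> supp n" "\<gamma> \<in> supp m" "src G \<beta> = rng G \<gamma>" "\<alpha> = mul G \<beta> \<gamma>" using a(1) by (rule supp_conv)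
    obtain \<beta>' \<gamma>' where b': "\<beta>' \<in> supp n" "\<gamma>' \<in> supp m" "src G \<beta>' = rng G \<gamma>'" "\<alpha>' = mul G \<beta>' \<gamma>'" using a(2) by (rule supp_conv)
    have "\<gamma> = \<gamma>'" using a(3) b b' ar by - (rule inj_onD[OF N_src[OF m]], auto)
    moreover from this have "\<beta> = \<beta>'" using b b' by - (rule inj_onD[OF N_src[OF n]], auto)
    ultimately show "\<alpha> = \<alpha>'" using b b' by simp
  qed
qed

section \<open>Monomials are normalisers\<close>

text \<open>
  The partner of a monomial in the definition of a normaliser: inversion in the groupoid combined
  with inversion of the values.
\<close>

definition star :: "('b \<Rightarrow> 'r) \<Rightarrow> 'b \<Rightarrow> 'r" where
  "star n \<sigma> = (if \<sigma> \<in> arr S \<and> n (ginv S \<sigma>) \<noteq> 0 then unit_inv (n (ginv S \<sigma>)) else 0)"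

lemma unit_inv_nonzero [simp]: "t \<in> Units_R \<Longrightarrow> unit_inv t \<noteq> (0::'r)"
  by (metis unit_inv_Units zero_not_unit)

lemma star_nonzero: "n \<in> N \<Longrightarrow> \<sigma> \<in> arr S \<Longrightarrow> star n \<sigma> \<noteq> 0 \<longleftrightarrow> n (ginv S \<sigma>) \<noteq> 0"
  using N_unit[of n "ginv S \<sigma>"] by (auto simp: star_def)

lemma supp_star:
  assumes "n \<in> N"
  shows "supp (star n) = ginv G ` supp n"
proof (intro set_eqI iffI)
  fix \<alpha> assume "\<alpha> \<in> supp (star n)"
  then obtain \<sigma> where s: "\<sigma> \<in> arr S" "\<alpha> = q \<sigma>" "star n \<sigma> \<noteq> 0" unfolding suppG_def fsupp_def by auto
  then have "q (ginv S \<sigma>) \<in> supp n" "\<alpha> = ginv G (q (ginv S \<sigma>))"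
    using star_nonzero[OF assms] A_supp_iff[OF N_A[OF assms], of "ginv S \<sigma>"] by auto
  then show "\<alpha> \<in> ginv G ` supp n" by blast
next
  fix \<alpha> assume "\<alpha> \<in> ginv G ` supp n"
  then obtain \<sigma> where s: "\<sigma> \<in> arr S" "\<alpha> = ginv G (q \<sigma>)" "n \<sigma> \<noteq> 0" unfolding suppG_def fsupp_def by auto
  then have "ginv S \<sigma> \<in> arr S" "star n (ginv S \<sigma>) \<noteq> 0" "\<alpha> = q (ginv S \<sigma>)"
    using star_nonzero[OF assms, of "ginv S \<sigma>"] by auto
  then show "\<alpha> \<in> supp (star n)" unfolding suppG_def fsupp_def by blast
qed

lemma star_N:
  assumes n: "n \<in> N"
  shows "star n \<in> N"
proof -
  note nA = N_A[OF n]
  have ar: "\<beta> \<in> arr G" if "\<beta> \<in> supp n" for \<beta> using that supp_arr by auto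
  have "star n \<in> A"
  proof (rule A_intro)
    show "star n \<sigma> = 0" if "\<sigma> \<notin> arr S" for \<sigma> using that by (simp add: star_def)
    have "continuous_map (arr_top S) (arr_top S) (ginv S)"
      using S_top unfolding topological_groupoid_def by auto
    then have "lconst (n \<circ> ginv S)" using A_lconst[OF nA] by (rule continuous_map_compose)
    from lconst_binop[OF this this, of "\<lambda>a b. if a \<noteq> 0 then unit_inv a else 0"]
    show "lconst (star n)" by (rule continuous_map_eq) (simp add: star_def)
    show "equivariant (star n)"
      unfolding equivariant_def
    proof (intro ballI)
      fix t :: 'r and \<sigma> assume t: "t \<in> Units_R" "\<sigma> \<in> arr S"
      have "n (ginv S (act t \<sigma>)) = t * n (ginv S \<sigma>)"
        using t A_act[OF nA, of "unit_inv t" "ginv S \<sigma>"] by (simp add: inv_act)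
      then show "star n (act t \<sigma>) = unit_inv t * star n \<sigma>"
        using t N_unit[OF n, of "ginv S \<sigma>"] by (simp add: star_def unit_inv_mult)
    qed
    show "compactin (arr_top G) (ginv G ` supp n)"
      using A_compact[OF nA] G.inv_cont by (rule image_compactin)
    show "supp (star n) \<subseteq> ginv G ` supp n" by (simp add: supp_star[OF n])
  qed
  moreover have "star n \<sigma> \<in> Units_R" if "\<sigma> \<in> arr S" "star n \<sigma> \<noteq> 0" for \<sigma>
    using that N_unit[OF n, of "ginv S \<sigma>"] by (auto simp: star_def split: if_splits)
  moreover have "inj_on (rng G) (ginv G ` supp n)"
  proof (rule inj_onI, elim imageE)
    fix \<alpha> \<alpha>' \<beta> \<beta>' assume b: "rng G \<alpha> = rng G \<alpha>'" "\<alpha> = ginv G \<beta>" "\<alpha>' = ginv G \<beta>'" "\<beta> \<in> supp n" "\<beta>' \<in> supp n"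
    have "\<beta> = \<beta>'" using b ar by - (rule inj_onD[OF N_src[OF n]], auto)
    then show "\<alpha> = \<alpha>'" using b by simp
  qed
  moreover have "inj_on (src G) (ginv G ` supp n)"
  proof (rule inj_onI, elim imageE)
    fix \<alpha> \<alpha>' \<beta> \<beta>' assume b: "src G \<alpha> = src G \<alpha>'" "\<alpha> = ginv G \<beta>" "\<alpha>' = ginv G \<beta>'" "\<beta> \<in> supp n" "\<beta>' \<in> supp n"
    have "\<beta> = \<beta>'" using b ar by - (rule inj_onD[OF N_rng[OF n]], auto)
    then show "\<alpha> = \<alpha>'" using b by simp
  qed
  ultimately show ?thesis using supp_star[OF n] unfolding monomials_def by simp
qed

lemma star_star:
  assumes n: "n \<in> N"
  shows "star (star n) = n"
proof
  fix \<sigma>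
  show "star (star n) \<sigma> = n \<sigma>"
  proof (cases "\<sigma> \<in> arr S")
    case True
    then show ?thesis
      using star_nonzero[OF n, of "ginv S \<sigma>"] N_unit[OF n True] by (auto simp: star_def)
  qed (simp add: star_def A_out[OF N_A[OF n]])
qed

text \<open>
  An arrow in the support of the product has the form \<open>\<delta>\<close> inverse times \<open>\<gamma>\<close>, with \<open>\<delta>\<close> and
  \<open>\<gamma>\<close> of equal range in the support of \<open>n\<close>; so \<open>\<delta> = \<gamma>\<close> and the product is a unit.
\<close>

lemma star_conv_D:
  assumes n: "n \<in> N" and f: "f \<in> A" "supp f \<subseteq> supp (star n)"
  shows "f \<star> n \<in> D"
  unfolding D_iff
proof (intro conjI subsetI)
  show "f \<star> n \<in> A" using conv_A[OF f(1) N_A[OF n]] .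
  fix \<alpha> assume "\<alpha> \<in> supp (f \<star> n)"
  then obtain \<beta> \<gamma> where b: "\<beta> \<in> supp f" "\<gamma> \<in> supp n" "src G \<beta> = rng G \<gamma>" "\<alpha> = mul G \<beta> \<gamma>" by (rule supp_conv)
  then obtain \<delta> where d: "\<delta> \<in> supp n" "\<beta> = ginv G \<delta>" using f(2) supp_star[OF n] by auto
  have ar: "\<gamma> \<in> arr G" "\<delta> \<in> arr G" using b d supp_arr by auto
  then have "\<delta> = \<gamma>" using b d by - (rule inj_onD[OF N_rng[OF n]], auto)
  then show "\<alpha> \<in> gunits G" using b d ar by simp
qed

lemma star_conv:
  assumes n: "n \<in> N"
  shows "star n \<star> n = e (src G ` supp n)"
proof (rule D_eqI)
  note nA = N_A[OF n] and sN = star_N[OF n]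
  have K: "src G ` supp n \<in> G.CO"
    using A_clopen_supp[OF nA] A_compact[OF nA] unfolding G.clopen_def by (intro G.CO_image) auto
  show D: "star n \<star> n \<in> D" by (rule star_conv_D[OF n N_A[OF sN] subset_refl])
  show "e (src G ` supp n) \<in> D" using K by (rule e_D)
  fix x assume x: "x \<in> gunits G"
  have e: "e (src G ` supp n) (i (x, 1)) = (if x \<in> src G ` supp n then 1 else 0)"
    using e_i[OF G.CO_sub[OF K] x, of 1] by simp
  show "(star n \<star> n) (i (x, 1)) = e (src G ` supp n) (i (x, 1))"
  proof (cases "x \<in> src G ` supp n")
    case True
    then obtain \<sigma> where s: "\<sigma> \<in> arr S" "n \<sigma> \<noteq> 0" "x = src G (q \<sigma>)"
      unfolding suppG_def fsupp_def by auto
    have ix: "i (x, 1) = src S \<sigma>"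
      using i_one[of "ginv S \<sigma>"] s by simp
    have "star n (ginv S \<sigma>) = unit_inv (n \<sigma>)" using s by (simp add: star_def)
    moreover have "unit_inv (n \<sigma>) \<noteq> 0" using N_unit[OF n s(1,2)] by simp
    moreover have "(star n \<star> n) (mul S (ginv S \<sigma>) \<sigma>) = star n (ginv S \<sigma>) * n \<sigma>"
      using s calculation by (intro conv_mul[OF sN nA]) auto
    ultimately have "(star n \<star> n) (i (x, 1)) = 1"
      using N_unit[OF n s(1,2)] s ix by (simp add: unit_inv_left)
    then show ?thesis using e True by simp
  next
    case False
    have "x \<notin> supp (star n \<star> n)"
    proof
      assume "x \<in> supp (star n \<star> n)"
      then obtain \<beta> \<gamma> where b: "\<beta> \<in> supp (star n)" "\<gamma> \<in> supp n" "src G \<beta> = rng G \<gamma>" "x = mul G \<beta> \<gamma>" by (rule supp_conv)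
      then have "src G x = src G \<gamma>" using supp_arr by (metis G.src_mul subsetD)
      then show False using False b x by auto
    qed
    then show ?thesis using A_supp_iff[of "star n \<star> n" "i (x, 1)"] D D_iff x e False by auto
  qed
qed

lemma conv_star:
  assumes n: "n \<in> N"
  shows "n \<star> star n = e (rng G ` supp n)"
proof -
  have "src G ` supp (star n) = rng G ` supp n"
    using supp_star[OF n] supp_arr[of n] by (force simp: image_image)
  then show ?thesis using star_conv[OF star_N[OF n]] star_star[OF n] by simp
qed

lemma conv_star_conv:
  assumes n: "n \<in> N"
  shows "(n \<star> star n) \<star> n = n"
proof
  fix \<sigma>
  note nA = N_A[OF n]
  have K: "rng G ` supp n \<in> G.CO"
    using A_clopen_supp[OF nA] A_compact[OF nA] unfolding G.clopen_def by (intro G.CO_image) auto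
  show "((n \<star> star n) \<star> n) \<sigma> = n \<sigma>"
  proof (cases "\<sigma> \<in> arr S")
    case True
    then show ?thesis
      using conv_e_left[OF K nA True] A_supp_iff[OF nA True] by (auto simp: conv_star[OF n])
  qed (simp add: A_out[OF nA])
qed

lemma normaliser_D:
  assumes n: "n \<in> N" and b: "b \<in> D"
  shows "(star n \<star> b) \<star> n \<in> D"
proof (rule star_conv_D[OF n])
  have bA: "b \<in> A" "supp b \<subseteq> gunits G" using b D_iff by auto
  show "star n \<star> b \<in> A" by (rule conv_A[OF N_A[OF star_N[OF n]] bA(1)])
  show "supp (star n \<star> b) \<subseteq> supp (star n)"
  proof
    fix \<alpha> assume "\<alpha> \<in> supp (star n \<star> b)"
    then obtain \<beta> \<gamma> where b: "\<beta> \<in> supp (star n)" "\<gamma> \<in> supp b" "src G \<beta> = rng G \<gamma>" "\<alpha> = mul G \<beta> \<gamma>" by (rule supp_conv)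
    have "\<gamma> = src G \<beta>" "\<beta> \<in> arr G" using b bA(2) supp_arr G.gunits_rng[of \<gamma>] by auto
    then have "\<alpha> = \<beta>" unfolding b(4) by simp
    then show "\<alpha> \<in> supp (star n)" using b(1) by simp
  qed
qed

section \<open>Germs of monomials\<close>

text \<open>
  Monomials normalised at a common arrow are equal to one near it, hence agree on all arrows whose
  source is close enough.
\<close>

lemma germ:
  assumes n: "n \<in> N" and m: "m \<in> N" and s: "\<sigma> \<in> arr S" "n \<sigma> = 1" "m \<sigma> = 1"
  shows "\<exists>K\<in>G.CO. src G (q \<sigma>) \<in> K \<and> n \<star> e K = m \<star> e K"
proof -
  let ?O = "{\<tau> \<in> arr S. n \<tau> \<in> {1}} \<inter> {\<tau> \<in> arr S. m \<tau> \<in> {1}}"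
  have "openin (arr_top S) ?O"
    using lconst_open A_lconst[OF N_A[OF n]] A_lconst[OF N_A[OF m]] by blast
  then have "openin (unit_space G) ((\<lambda>\<sigma>. src G (q \<sigma>)) ` ?O)" by (rule open_src_q)
  moreover have "src G (q \<sigma>) \<in> (\<lambda>\<sigma>. src G (q \<sigma>)) ` ?O" using s by auto
  ultimately obtain K where K: "K \<in> G.CO" "src G (q \<sigma>) \<in> K" "K \<subseteq> (\<lambda>\<sigma>. src G (q \<sigma>)) ` ?O"
    using G.units.base by blast
  have agree: "n \<tau> = m \<tau>" if t: "\<tau> \<in> arr S" "src G (q \<tau>) \<in> K" for \<tau>
  proof -
    obtain \<rho> where r: "\<rho> \<in> arr S" "n \<rho> = 1" "m \<rho> = 1" "src G (q \<tau>) = src G (q \<rho>)"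
      using K(3) t(2) by auto
    have rs: "q \<rho> \<in> supp n" "q \<rho> \<in> supp m"
      using A_supp_iff[OF N_A[OF n]] A_supp_iff[OF N_A[OF m]] r by auto
    show ?thesis
    proof (cases "q \<tau> = q \<rho>")
      case True
      obtain u where u: "u \<in> Units_R" "\<tau> = act u \<rho>"
        using fibre_act[OF r(1) t(1) True[symmetric]] .
      then show ?thesis using A_act[OF N_A[OF n] u(1) r(1)] A_act[OF N_A[OF m] u(1) r(1)] r by simp
    next
      case False
      then have "q \<tau> \<notin> supp n" "q \<tau> \<notin> supp m"
        using rs r(4) inj_onD[OF N_src[OF n], of "q \<tau>" "q \<rho>"] inj_onD[OF N_src[OF m], of "q \<tau>" "q \<rho>"] by auto
      then show ?thesis using A_supp_iff[OF N_A[OF n] t(1)] A_supp_iff[OF N_A[OF m] t(1)] by simp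
    qed
  qed
  have "n \<star> e K = m \<star> e K"
  proof
    fix \<tau>
    show "(n \<star> e K) \<tau> = (m \<star> e K) \<tau>"
      using conv_e_right[OF K(1) N_A[OF n], of \<tau>] conv_e_right[OF K(1) N_A[OF m], of \<tau>] agree
      by (cases "\<tau> \<in> arr S") auto
  qed
  then show ?thesis using K by blast
qed

lemma slice_inj:
  assumes "n \<in> N" "\<sigma> \<in> arr S" "\<tau> \<in> arr S" "n \<sigma> = 1" "n \<tau> = 1" "src G (q \<sigma>) = src G (q \<tau>)"
  shows "\<sigma> = \<tau>"
proof -
  have "q \<sigma> \<in> supp n" "q \<tau> \<in> supp n"
    using A_supp_iff[OF N_A[OF assms(1)]] assms by auto
  then have "q \<sigma> = q \<tau>"
    using inj_onD[OF N_src[OF assms(1)] assms(6)] by simp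
  then show ?thesis using eq_if_normalised assms by blast
qed

lemma supp_CO:
  assumes "n \<in> A"
  shows "rng G ` supp n \<in> G.CO" "src G ` supp n \<in> G.CO"
  using A_clopen_supp[OF assms] A_compact[OF assms] unfolding G.clopen_def by (simp_all add: G.CO_image)

lemma conv_e_src:
  assumes "n \<in> A"
  shows "n \<star> e (src G ` supp n) = n"
proof
  fix \<sigma>
  show "(n \<star> e (src G ` supp n)) \<sigma> = n \<sigma>"
    using conv_e_right[OF supp_CO(2)[OF assms] assms, of \<sigma>] A_supp_iff[OF assms, of \<sigma>] A_out[OF assms, of \<sigma>]
    by (cases "\<sigma> \<in> arr S") auto
qed

lemma conv_e_rng:
  assumes "n \<in> A"
  shows "e (rng G ` supp n) \<star> n = n"
proof
  fix \<sigma>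
  show "(e (rng G ` supp n) \<star> n) \<sigma> = n \<sigma>"
    using conv_e_left[OF supp_CO(1)[OF assms] assms, of \<sigma>] A_supp_iff[OF assms, of \<sigma>] A_out[OF assms, of \<sigma>]
    by (cases "\<sigma> \<in> arr S") auto
qed

lemma ex_CO: "x \<in> gunits G \<Longrightarrow> \<exists>K\<in>G.CO. x \<in> K"
  using G.units.base[of "gunits G" x] G.openin_units_iff G.units_open by auto

end

section \<open>Isomorphic twists have isomorphic algebras\<close>

lemma tgroupoid_iso_inverse:
  assumes f: "tgroupoid_iso G H f" and G: "is_groupoid G" and H: "is_groupoid H"
  shows "tgroupoid_iso H G (inv_into (arr G) f)"
proof -
  let ?g = "inv_into (arr G) f"
  interpret G: groupoid G using G by unfold_locales
  interpret H: groupoid H using H by unfold_locales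
  have hom: "groupoid_hom G H f" and homeo: "homeomorphic_map (arr_top G) (arr_top H) f"
    using f unfolding tgroupoid_iso_def by auto
  have inj: "inj_on f (arr G)" and surj: "f ` arr G = arr H"
    using homeomorphic_imp_injective_map[OF homeo] homeomorphic_imp_surjective_map[OF homeo] by auto
  have g: "?g b \<in> arr G" "f (?g b) = b" if "b \<in> arr H" for b
    using that surj inv_into_into[of b f "arr G"] f_inv_into_f[of b f "arr G"] by auto
  have gf: "?g (f a) = a" if "a \<in> arr G" for a
    using inj that by (rule inv_into_f_f)
  obtain g' where g': "homeomorphic_maps (arr_top G) (arr_top H) f g'"
    using homeo unfolding homeomorphic_map_maps by auto
  have "homeomorphic_map (arr_top H) (arr_top G) g'"
    using g' by (simp add: homeomorphic_maps_map)
  moreover have "g' b = ?g b" if "b \<in> topspace (arr_top H)" for b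
    using g'[unfolded homeomorphic_maps_def] gf g[OF that] by metis
  ultimately have gh: "homeomorphic_map (arr_top H) (arr_top G) ?g"
    by (rule homeomorphic_map_eq)
  have "groupoid_hom H G ?g"
    unfolding groupoid_hom_def
  proof (intro conjI ballI)
    show "?g ` arr H \<subseteq> arr G" using g by auto
    fix p assume "p \<in> composable H"
    then obtain a b where p: "p = (a, b)" "a \<in> arr H" "b \<in> arr H" "src H a = rng H b"
      by (auto simp: composable_def)
    have "f (src G (?g a)) = f (rng G (?g b))"
      using hom_src[OF hom G H] hom_rng[OF hom G H] g p by simp
    then have c: "src G (?g a) = rng G (?g b)"
      using inj_onD[OF inj] g p by simp
    have "?g (f (mul G (?g a) (?g b))) = mul G (?g a) (?g b)"
      using g p c by (intro gf) simp
    moreover have "f (mul G (?g a) (?g b)) = mul H a b"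
      using hom_mul(1)[OF hom _ _ c] g p by simp
    ultimately show "case p of (a, b) \<Rightarrow> (?g a, ?g b) \<in> composable G \<and> ?g (mul H a b) = mul G (?g a) (?g b)"
      using g p c by (simp add: composable_def)
  qed
  then show ?thesis using gh unfolding tgroupoid_iso_def by simp
qed

definition pull :: "'b tgroupoid \<Rightarrow> ('b \<Rightarrow> 'd) \<Rightarrow> ('d \<Rightarrow> 'r::zero) \<Rightarrow> 'b \<Rightarrow> 'r" where
  "pull S \<psi> f = (\<lambda>\<sigma>. if \<sigma> \<in> arr S then f (\<psi> \<sigma>) else 0)"

locale twist_pair = T1: twist G1 S1 i1 q1 + T2: twist G2 S2 i2 q2
  for G1 :: "'a tgroupoid" and S1 :: "'b tgroupoid"
    and i1 :: "'a \<times> 'r::comm_ring_1 \<Rightarrow> 'b" and q1 :: "'b \<Rightarrow> 'a"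
    and G2 :: "'c tgroupoid" and S2 :: "'d tgroupoid"
    and i2 :: "'c \<times> 'r \<Rightarrow> 'd" and q2 :: "'d \<Rightarrow> 'c"
begin

lemma swap: "twist_pair G2 S2 i2 q2 G1 S1 i1 q1"
  by unfold_locales

definition twist_iso :: "('b \<Rightarrow> 'd) \<Rightarrow> ('a \<Rightarrow> 'c) \<Rightarrow> bool" where
  "twist_iso \<psi> \<psi>G \<longleftrightarrow> tgroupoid_iso S1 S2 \<psi> \<and> tgroupoid_iso G1 G2 \<psi>G \<and>
     (\<forall>x\<in>gunits G1. \<forall>t\<in>Units_R. \<psi> (i1 (x, t)) = i2 (\<psi>G x, t)) \<and>
     (\<forall>\<sigma>\<in>arr S1. q2 (\<psi> \<sigma>) = \<psi>G (q1 \<sigma>))"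

lemma twist_isoD:
  assumes "twist_iso \<psi> \<psi>G"
  shows "groupoid_hom S1 S2 \<psi>" "homeomorphic_map (arr_top S1) (arr_top S2) \<psi>"
    and "groupoid_hom G1 G2 \<psi>G" "homeomorphic_map (arr_top G1) (arr_top G2) \<psi>G"
    and "\<And>x t. x \<in> gunits G1 \<Longrightarrow> t \<in> Units_R \<Longrightarrow> \<psi> (i1 (x, t)) = i2 (\<psi>G x, t)"
    and "\<And>\<sigma>. \<sigma> \<in> arr S1 \<Longrightarrow> q2 (\<psi> \<sigma>) = \<psi>G (q1 \<sigma>)"
    and "inj_on \<psi> (arr S1)" "inj_on \<psi>G (arr G1)" "\<psi> ` arr S1 = arr S2" "\<psi>G ` arr G1 = arr G2"
  using assms homeomorphic_imp_injective_map homeomorphic_imp_surjective_map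
  unfolding twist_iso_def tgroupoid_iso_def by blast+

lemma twist_iso_inverse:
  assumes iso: "twist_iso \<psi> \<psi>G"
  shows "twist_pair.twist_iso G2 S2 i2 q2 G1 S1 i1 q1 (inv_into (arr S1) \<psi>) (inv_into (arr G1) \<psi>G)"
proof -
  interpret R: twist_pair G2 S2 i2 q2 G1 S1 i1 q1 by (rule swap)
  note D = twist_isoD[OF iso]
  let ?p = "inv_into (arr S1) \<psi>" and ?g = "inv_into (arr G1) \<psi>G"
  have g: "?g a \<in> arr G1" "\<psi>G (?g a) = a" if "a \<in> arr G2" for a
    using that D(10) inv_into_into[of a \<psi>G "arr G1"] f_inv_into_f[of a \<psi>G "arr G1"] by auto
  have p: "?p a \<in> arr S1" "\<psi> (?p a) = a" if "a \<in> arr S2" for a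
    using that D(9) inv_into_into[of a \<psi> "arr S1"] f_inv_into_f[of a \<psi> "arr S1"] by auto
  have I: "tgroupoid_iso S2 S1 ?p" "tgroupoid_iso G2 G1 ?g"
    using iso tgroupoid_iso_inverse T1.S.is_groupoid T2.S.is_groupoid T1.G.is_groupoid T2.G.is_groupoid
    unfolding twist_iso_def by blast+
  show ?thesis
    unfolding R.twist_iso_def
  proof (intro conjI I ballI)
    fix x and t :: 'r assume x: "x \<in> gunits G2" and t: "t \<in> Units_R"
    have u: "?g x \<in> gunits G1"
      using hom_gunits[OF _ T2.G.is_groupoid T1.G.is_groupoid x] I(2) unfolding tgroupoid_iso_def by blast
    have "\<psi> (i1 (?g x, t)) = i2 (x, t)"
      using D(5)[OF u t] g(2)[of x] x by simp
    then show "?p (i2 (x, t)) = i1 (?g x, t)"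
      using inv_into_f_f[OF D(7), of "i1 (?g x, t)"] u t by simp
  next
    fix \<sigma> assume s: "\<sigma> \<in> arr S2"
    have "\<psi>G (q1 (?p \<sigma>)) = q2 \<sigma>" using D(6)[of "?p \<sigma>"] p[OF s] by simp
    then show "q1 (?p \<sigma>) = ?g (q2 \<sigma>)"
      using inv_into_f_f[OF D(8), of "q1 (?p \<sigma>)"] p[OF s] by simp
  qed
qed

lemma twists_isomorphic_iff: "twists_isomorphic G1 S1 i1 q1 G2 S2 i2 q2 \<longleftrightarrow> (\<exists>\<psi> \<psi>G. twist_iso \<psi> \<psi>G)"
  unfolding twists_isomorphic_def twist_iso_def ..

lemma twists_isomorphic_sym:
  assumes "twists_isomorphic G1 S1 i1 q1 G2 S2 i2 q2"
  shows "twists_isomorphic G2 S2 i2 q2 G1 S1 i1 q1"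
  using assms twist_iso_inverse twists_isomorphic_iff twist_pair.twists_isomorphic_iff[OF swap] by blast

lemma pull_A:
  assumes iso: "twist_iso \<psi> \<psi>G" and f: "f \<in> T2.A"
  shows "T1.supp (pull S1 \<psi> f) = {\<alpha> \<in> arr G1. \<psi>G \<alpha> \<in> T2.supp f}" "pull S1 \<psi> f \<in> T1.A"
proof -
  note D = twist_isoD[OF iso]
  have \<psi>a: "\<psi> \<sigma> \<in> arr S2" if "\<sigma> \<in> arr S1" for \<sigma> using hom_arr[OF D(1) that] .
  show sup: "T1.supp (pull S1 \<psi> f) = {\<alpha> \<in> arr G1. \<psi>G \<alpha> \<in> T2.supp f}"
  proof (intro set_eqI iffI)
    fix \<alpha> assume "\<alpha> \<in> T1.supp (pull S1 \<psi> f)"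
    then obtain \<sigma> where s: "\<sigma> \<in> arr S1" "\<alpha> = q1 \<sigma>" "f (\<psi> \<sigma>) \<noteq> 0"
      unfolding suppG_def fsupp_def pull_def by auto
    then show "\<alpha> \<in> {\<alpha> \<in> arr G1. \<psi>G \<alpha> \<in> T2.supp f}"
      using T2.A_supp_iff[OF f \<psi>a[OF s(1)]] D(6)[OF s(1)] by simp
  next
    fix \<alpha> assume a: "\<alpha> \<in> {\<alpha> \<in> arr G1. \<psi>G \<alpha> \<in> T2.supp f}"
    then obtain \<sigma> where s: "\<sigma> \<in> arr S1" "q1 \<sigma> = \<alpha>" using T1.ex_lift[of \<alpha>] by auto
    then have "f (\<psi> \<sigma>) \<noteq> 0" using a T2.A_supp_iff[OF f \<psi>a[OF s(1)]] D(6)[OF s(1)] by simp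
    then show "\<alpha> \<in> T1.supp (pull S1 \<psi> f)" using s unfolding suppG_def fsupp_def pull_def by auto
  qed
  show "pull S1 \<psi> f \<in> T1.A"
  proof (rule T1.A_intro)
    show "pull S1 \<psi> f \<sigma> = 0" if "\<sigma> \<notin> arr S1" for \<sigma> using that by (simp add: pull_def)
    have "T1.lconst (f \<circ> \<psi>)"
      using homeomorphic_imp_continuous_map[OF D(2)] T2.A_lconst[OF f] by (rule continuous_map_compose)
    then show "T1.lconst (pull S1 \<psi> f)" by (rule continuous_map_eq) (simp add: pull_def)
    show "T1.equivariant (pull S1 \<psi> f)"
      unfolding T1.equivariant_def
    proof (intro ballI)
      fix t :: 'r and \<sigma> assume t: "t \<in> Units_R" and s: "\<sigma> \<in> arr S1"
      have "\<psi> (mul S1 (i1 (rng G1 (q1 \<sigma>), t)) \<sigma>) = mul S2 (\<psi> (i1 (rng G1 (q1 \<sigma>), t))) (\<psi> \<sigma>)"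
        using s t by (intro hom_mul(1)[OF D(1)]) auto
      moreover have "\<psi>G (rng G1 (q1 \<sigma>)) = rng G2 (q2 (\<psi> \<sigma>))"
        using hom_rng[OF D(3) T1.G.is_groupoid T2.G.is_groupoid, of "q1 \<sigma>"] D(6)[OF s] s by simp
      ultimately have "\<psi> (T1.act t \<sigma>) = T2.act t (\<psi> \<sigma>)"
        using D(5)[of "rng G1 (q1 \<sigma>)" t] s t \<psi>a[OF s] by (simp add: T1.act_eq T2.act_eq)
      then show "pull S1 \<psi> f (T1.act t \<sigma>) = unit_inv t * pull S1 \<psi> f \<sigma>"
        using T2.A_act[OF f t \<psi>a[OF s]] s t by (simp add: pull_def)
    qed
    let ?g = "inv_into (arr G1) \<psi>G"
    have "homeomorphic_map (arr_top G2) (arr_top G1) ?g"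
      using tgroupoid_iso_inverse[OF _ T1.G.is_groupoid T2.G.is_groupoid, of \<psi>G] iso
      unfolding twist_iso_def tgroupoid_iso_def by blast
    then show "compactin (arr_top G1) (?g ` T2.supp f)"
      using T2.A_compact[OF f] homeomorphic_imp_continuous_map image_compactin by blast
    show "T1.supp (pull S1 \<psi> f) \<subseteq> ?g ` T2.supp f"
    proof
      fix \<alpha> assume "\<alpha> \<in> T1.supp (pull S1 \<psi> f)"
      then have "\<alpha> \<in> arr G1" "\<psi>G \<alpha> \<in> T2.supp f" unfolding sup by auto
      then show "\<alpha> \<in> ?g ` T2.supp f" using inv_into_f_f[OF D(8), of \<alpha>] by (metis image_eqI)
    qed
  qed
qed

lemma pull_D:
  assumes iso: "twist_iso \<psi> \<psi>G" and f: "f \<in> T2.D"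
  shows "pull S1 \<psi> f \<in> T1.D"
proof -
  note D = twist_isoD[OF iso]
  have fA: "f \<in> T2.A" "T2.supp f \<subseteq> gunits G2" using f T2.D_iff by auto
  have "T1.supp (pull S1 \<psi> f) \<subseteq> gunits G1"
    unfolding pull_A(1)[OF iso fA(1)]
  proof
    fix \<alpha> assume a: "\<alpha> \<in> {\<alpha> \<in> arr G1. \<psi>G \<alpha> \<in> T2.supp f}"
    then have "\<psi>G (rng G1 \<alpha>) = \<psi>G \<alpha>"
      using hom_rng[OF D(3) T1.G.is_groupoid T2.G.is_groupoid, of \<alpha>] fA(2) by auto
    then have "rng G1 \<alpha> = \<alpha>" using inj_onD[OF D(8)] a by simp
    then show "\<alpha> \<in> gunits G1" using a by (metis (no_types, lifting) T1.G.rng_gunits mem_Collect_eq)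
  qed
  then show ?thesis using pull_A(2)[OF iso fA(1)] T1.D_iff by simp
qed

text \<open>
  The two convolution sums correspond term by term along the isomorphism of the base groupoids.
\<close>

lemma pull_conv:
  assumes iso: "twist_iso \<psi> \<psi>G" and f: "f \<in> T2.A" and g: "g \<in> T2.A"
  shows "pull S1 \<psi> (conv G2 S2 q2 f g) = conv G1 S1 q1 (pull S1 \<psi> f) (pull S1 \<psi> g)"
proof
  note D = twist_isoD[OF iso]
  let ?f = "pull S1 \<psi> f" and ?g = "pull S1 \<psi> g"
  have \<psi>a: "\<psi> \<sigma> \<in> arr S2" if "\<sigma> \<in> arr S1" for \<sigma> using hom_arr[OF D(1) that] .
  have fA: "?f \<in> T1.A" "?g \<in> T1.A" using pull_A(2)[OF iso] f g by auto
  have rngG: "rng G2 (\<psi>G \<alpha>) = \<psi>G (rng G1 \<alpha>)" if "\<alpha> \<in> arr G1" for \<alpha>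
    using hom_rng[OF D(3) T1.G.is_groupoid T2.G.is_groupoid that] by simp
  fix \<sigma>
  show "pull S1 \<psi> (conv G2 S2 q2 f g) \<sigma> = conv G1 S1 q1 ?f ?g \<sigma>"
  proof (cases "\<sigma> \<in> arr S1")
    case s: True
    let ?F = "{\<alpha> \<in> T1.supp ?f. rng G1 \<alpha> = rng G1 (q1 \<sigma>)}"
    have F: "finite ?F" "?F \<subseteq> {\<alpha> \<in> arr G1. rng G1 \<alpha> = rng G1 (q1 \<sigma>)}"
      using T1.finite_fib[OF fA(1)] T1.supp_arr by auto
    have qs: "q2 (\<psi> \<sigma>) = \<psi>G (q1 \<sigma>)" by (rule D(6)[OF s])
    have F2: "\<psi>G ` ?F \<subseteq> {\<alpha> \<in> arr G2. rng G2 \<alpha> = rng G2 (q2 (\<psi> \<sigma>))}"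
    proof (intro subsetI, elim imageE)
      fix \<beta> \<alpha> assume b: "\<beta> = \<psi>G \<alpha>" "\<alpha> \<in> ?F"
      then have a: "\<alpha> \<in> arr G1" "rng G1 \<alpha> = rng G1 (q1 \<sigma>)" using F(2) by auto
      then show "\<beta> \<in> {\<alpha> \<in> arr G2. rng G2 \<alpha> = rng G2 (q2 (\<psi> \<sigma>))}"
        using rngG[of \<alpha>] rngG[of "q1 \<sigma>"] s qs b(1) hom_arr[OF D(3), of \<alpha>] by simp
    qed
    have F3: "{\<alpha> \<in> T2.supp f. rng G2 \<alpha> = rng G2 (q2 (\<psi> \<sigma>))} \<subseteq> \<psi>G ` ?F"
    proof
      fix \<beta> assume b: "\<beta> \<in> {\<alpha> \<in> T2.supp f. rng G2 \<alpha> = rng G2 (q2 (\<psi> \<sigma>))}"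
      then have "\<beta> \<in> \<psi>G ` arr G1" using T2.supp_arr D(10) by auto
      then obtain \<alpha> where a: "\<alpha> \<in> arr G1" "\<beta> = \<psi>G \<alpha>" by auto
      have "\<psi>G (rng G1 \<alpha>) = \<psi>G (rng G1 (q1 \<sigma>))" using b a rngG[of \<alpha>] rngG[of "q1 \<sigma>"] s qs by simp
      then have "rng G1 \<alpha> = rng G1 (q1 \<sigma>)" using inj_onD[OF D(8)] a s by simp
      then show "\<beta> \<in> \<psi>G ` ?F" using a b pull_A(1)[OF iso f] by auto
    qed
    have "conv G2 S2 q2 f g (\<psi> \<sigma>) = (\<Sum>\<beta>\<in>\<psi>G ` ?F. T2.cterm f g (\<psi> \<sigma>) (T2.lift \<beta>))"
      by (rule T2.conv_eq[OF T2.A_equivariant[OF f] T2.A_equivariant[OF g] \<psi>a[OF s] finite_imageI[OF F(1)] F2 F3])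
    also have "\<dots> = (\<Sum>\<alpha>\<in>?F. T2.cterm f g (\<psi> \<sigma>) (T2.lift (\<psi>G \<alpha>)))"
      using inj_on_subset[OF D(8), of ?F] F(2) by (subst sum.reindex) auto
    also have "\<dots> = (\<Sum>\<alpha>\<in>?F. T1.cterm ?f ?g \<sigma> (T1.lift \<alpha>))"
    proof (rule sum.cong[OF refl])
      fix \<alpha> assume "\<alpha> \<in> ?F"
      then have a: "\<alpha> \<in> arr G1" "rng G1 \<alpha> = rng G1 (q1 \<sigma>)" using F(2) by auto
      let ?l = "T1.lift \<alpha>"
      have l: "?l \<in> arr S1" "q1 ?l = \<alpha>" using a by auto
      have lr: "rng S1 ?l = rng S1 \<sigma>" using T1.rng_eq_iff[OF l(1) s] l(2) a(2) by simp
      have inv: "\<psi> (ginv S1 ?l) = ginv S2 (\<psi> ?l)"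
        by (rule hom_inv[OF D(1) T1.S.is_groupoid T2.S.is_groupoid l(1)])
      have "\<psi> (mul S1 (ginv S1 ?l) \<sigma>) = mul S2 (ginv S2 (\<psi> ?l)) (\<psi> \<sigma>)"
        using hom_mul(1)[OF D(1), of "ginv S1 ?l" \<sigma>] l s lr inv by simp
      then have "T1.cterm ?f ?g \<sigma> ?l = T2.cterm f g (\<psi> \<sigma>) (\<psi> ?l)"
        using l s lr by (simp add: T1.cterm_def T2.cterm_def pull_def)
      moreover have "T2.cterm f g (\<psi> \<sigma>) (T2.lift (\<psi>G \<alpha>)) = T2.cterm f g (\<psi> \<sigma>) (\<psi> ?l)"
      proof (rule T2.cterm_fibre[OF T2.A_equivariant[OF f] T2.A_equivariant[OF g] \<psi>a[OF s] \<psi>a[OF l(1)]])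
        have b: "\<psi>G \<alpha> \<in> arr G2" by (rule hom_arr[OF D(3) a(1)])
        show "T2.lift (\<psi>G \<alpha>) \<in> arr S2" "q2 (\<psi> ?l) = q2 (T2.lift (\<psi>G \<alpha>))"
          using b D(6)[OF l(1)] l(2) by simp_all
        show "rng S2 (\<psi> ?l) = rng S2 (\<psi> \<sigma>)"
          using hom_rng[OF D(1) T1.S.is_groupoid T2.S.is_groupoid] l(1) s lr by metis
      qed
      ultimately show "T2.cterm f g (\<psi> \<sigma>) (T2.lift (\<psi>G \<alpha>)) = T1.cterm ?f ?g \<sigma> ?l" by simp
    qed
    also have "\<dots> = conv G1 S1 q1 ?f ?g \<sigma>"
      by (rule T1.conv_eq[OF T1.A_equivariant[OF fA(1)] T1.A_equivariant[OF fA(2)] s F subset_refl, symmetric])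
    finally show ?thesis using s by (simp add: pull_def)
  qed (simp add: pull_def)
qed

theorem algebras_isomorphic:
  assumes "twists_isomorphic G1 S1 i1 q1 G2 S2 i2 q2"
  shows "\<exists>\<Psi>. steinberg_iso G2 S2 i2 q2 G1 S1 i1 q1 \<Psi> \<and> diagonal_preserving G2 S2 i2 q2 G1 S1 i1 q1 \<Psi>"
proof -
  interpret R: twist_pair G2 S2 i2 q2 G1 S1 i1 q1 by (rule swap)
  obtain \<psi> \<psi>G where iso: "twist_iso \<psi> \<psi>G" using assms twists_isomorphic_iff by auto
  note D = twist_isoD[OF iso]
  let ?p = "inv_into (arr S1) \<psi>"
  note iso' = twist_iso_inverse[OF iso]
  have p: "?p a \<in> arr S1" "\<psi> (?p a) = a" if "a \<in> arr S2" for a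
    using that D(9) inv_into_into[of a \<psi> "arr S1"] f_inv_into_f[of a \<psi> "arr S1"] by auto
  have pp: "pull S2 ?p (pull S1 \<psi> f) = f" if "f \<in> T2.A" for f
    using p T2.A_out[OF that] by (auto simp: pull_def)
  have pp': "pull S1 \<psi> (pull S2 ?p g) = g" if "g \<in> T1.A" for g
    using T1.A_out[OF that] hom_arr[OF D(1)] inv_into_f_f[OF D(7)] by (auto simp: pull_def)
  have "bij_betw (pull S1 \<psi>) T2.A T1.A"
    by (rule bij_betw_byWitness[where f' = "pull S2 ?p"])
      (use pp pp' pull_A(2)[OF iso] R.pull_A(2)[OF iso'] in auto)
  moreover have "pull S1 \<psi> (\<lambda>\<sigma>. f \<sigma> + g \<sigma>) = (\<lambda>\<tau>. pull S1 \<psi> f \<tau> + pull S1 \<psi> g \<tau>)" for f g :: "'d \<Rightarrow> 'r"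
    by (auto simp: pull_def)
  moreover have "pull S1 \<psi> (\<lambda>\<sigma>. c * f \<sigma>) = (\<lambda>\<tau>. c * pull S1 \<psi> f \<tau>)" for c and f :: "'d \<Rightarrow> 'r"
    by (auto simp: pull_def)
  ultimately have "steinberg_iso G2 S2 i2 q2 G1 S1 i1 q1 (pull S1 \<psi>)"
    unfolding steinberg_iso_def using pull_conv[OF iso] by blast
  moreover have "diagonal_preserving G2 S2 i2 q2 G1 S1 i1 q1 (pull S1 \<psi>)"
    unfolding diagonal_preserving_def
  proof
    show "pull S1 \<psi> ` T2.D \<subseteq> T1.D" using pull_D[OF iso] by auto
    show "T1.D \<subseteq> pull S1 \<psi> ` T2.D"
    proof
      fix g assume g: "g \<in> T1.D"
      then have "pull S2 ?p g \<in> T2.D" using R.pull_D[OF iso'] by simp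
      moreover have "pull S1 \<psi> (pull S2 ?p g) = g" using pp' g T1.D_iff by simp
      ultimately show "g \<in> pull S1 \<psi> ` T2.D" by (metis image_eqI)
    qed
  qed
  ultimately show ?thesis by blast
qed

lemma steinberg_iso_inverse:
  assumes iso: "steinberg_iso G1 S1 i1 q1 G2 S2 i2 q2 \<Psi>"
    and diag: "diagonal_preserving G1 S1 i1 q1 G2 S2 i2 q2 \<Psi>"
  shows "steinberg_iso G2 S2 i2 q2 G1 S1 i1 q1 (inv_into T1.A \<Psi>)"
    and "diagonal_preserving G2 S2 i2 q2 G1 S1 i1 q1 (inv_into T1.A \<Psi>)"
proof -
  let ?\<Phi> = "inv_into T1.A \<Psi>"
  have b: "bij_betw \<Psi> T1.A T2.A" using iso unfolding steinberg_iso_def by blast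
  have \<Phi>: "?\<Phi> f \<in> T1.A" "\<Psi> (?\<Phi> f) = f" if "f \<in> T2.A" for f
    using bij_betwE[OF bij_betw_inv_into[OF b]] bij_betw_inv_into_right[OF b] that by auto
  have \<Phi>\<Psi>: "?\<Phi> (\<Psi> f) = f" if "f \<in> T1.A" for f
    using bij_betw_inv_into_left[OF b that] .
  have ops: "\<Psi> (\<lambda>\<sigma>. f \<sigma> + g \<sigma>) = (\<lambda>\<tau>. \<Psi> f \<tau> + \<Psi> g \<tau>)" "\<Psi> (conv G1 S1 q1 f g) = conv G2 S2 q2 (\<Psi> f) (\<Psi> g)"
    "\<Psi> (\<lambda>\<sigma>. c * f \<sigma>) = (\<lambda>\<tau>. c * \<Psi> f \<tau>)" if "f \<in> T1.A" "g \<in> T1.A" for f g c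
    using iso that unfolding steinberg_iso_def by blast+
  show "steinberg_iso G2 S2 i2 q2 G1 S1 i1 q1 ?\<Phi>"
    unfolding steinberg_iso_def
  proof (intro conjI ballI allI)
    show "bij_betw ?\<Phi> T2.A T1.A" by (rule bij_betw_inv_into[OF b])
    fix f assume f: "f \<in> T2.A"
    show "?\<Phi> (\<lambda>\<sigma>. c * f \<sigma>) = (\<lambda>\<tau>. c * ?\<Phi> f \<tau>)" for c
      using \<Phi>\<Psi>[OF T1.A_scale[OF \<Phi>(1)[OF f], of c]] ops(3)[OF \<Phi>(1)[OF f] \<Phi>(1)[OF f], of c] \<Phi>(2)[OF f] by simp
    fix g assume g: "g \<in> T2.A"
    show "?\<Phi> (\<lambda>\<sigma>. f \<sigma> + g \<sigma>) = (\<lambda>\<tau>. ?\<Phi> f \<tau> + ?\<Phi> g \<tau>)"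
      using \<Phi>\<Psi>[OF T1.A_add[OF \<Phi>(1)[OF f] \<Phi>(1)[OF g]]] ops(1)[OF \<Phi>(1)[OF f] \<Phi>(1)[OF g]] \<Phi>(2)[OF f] \<Phi>(2)[OF g] by simp
    show "?\<Phi> (conv G2 S2 q2 f g) = conv G1 S1 q1 (?\<Phi> f) (?\<Phi> g)"
      using \<Phi>\<Psi>[OF T1.conv_A[OF \<Phi>(1)[OF f] \<Phi>(1)[OF g]]] ops(2)[OF \<Phi>(1)[OF f] \<Phi>(1)[OF g]] \<Phi>(2)[OF f] \<Phi>(2)[OF g] by simp
  qed
  have "?\<Phi> ` (\<Psi> ` T1.D) = T1.D"
    using \<Phi>\<Psi> T1.D_iff unfolding image_image by force
  then show "diagonal_preserving G2 S2 i2 q2 G1 S1 i1 q1 ?\<Phi>"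
    using diag unfolding diagonal_preserving_def by simp
qed

end

section \<open>Reconstruction of the twist\<close>

text \<open>
  The local bisection hypothesis is imposed on the target, where it controls the images of the
  monomials of the source.
\<close>

locale reconstruction = twist_pair G1 S1 i1 q1 G2 S2 i2 q2
  for G1 :: "'a tgroupoid" and S1 :: "'b tgroupoid"
    and i1 :: "'a \<times> 'r::comm_ring_1 \<Rightarrow> 'b" and q1 :: "'b \<Rightarrow> 'a"
    and G2 :: "'c tgroupoid" and S2 :: "'d tgroupoid"
    and i2 :: "'c \<times> 'r \<Rightarrow> 'd" and q2 :: "'d \<Rightarrow> 'c" +
  fixes \<Psi> :: "('b \<Rightarrow> 'r) \<Rightarrow> ('d \<Rightarrow> 'r)"
  assumes iso: "steinberg_iso G1 S1 i1 q1 G2 S2 i2 q2 \<Psi>"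
    and diag: "diagonal_preserving G1 S1 i1 q1 G2 S2 i2 q2 \<Psi>"
    and lbh: "local_bisection_hypothesis G2 S2 i2 q2"
begin

abbreviation cv1 (infixl "\<star>\<^sub>1" 70) where "f \<star>\<^sub>1 g \<equiv> conv G1 S1 q1 f g"
abbreviation cv2 (infixl "\<star>\<^sub>2" 70) where "f \<star>\<^sub>2 g \<equiv> conv G2 S2 q2 f g"

lemma \<Psi>_A: "f \<in> T1.A \<Longrightarrow> \<Psi> f \<in> T2.A"
  and \<Psi>_inj: "f \<in> T1.A \<Longrightarrow> g \<in> T1.A \<Longrightarrow> \<Psi> f = \<Psi> g \<Longrightarrow> f = g"
  and \<Psi>_surj: "m \<in> T2.A \<Longrightarrow> \<exists>f\<in>T1.A. \<Psi> f = m"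
proof -
  have b: "bij_betw \<Psi> T1.A T2.A" using iso unfolding steinberg_iso_def by blast
  show "f \<in> T1.A \<Longrightarrow> \<Psi> f \<in> T2.A" using bij_betwE[OF b] by blast
  show "f \<in> T1.A \<Longrightarrow> g \<in> T1.A \<Longrightarrow> \<Psi> f = \<Psi> g \<Longrightarrow> f = g" using inj_onD[OF bij_betw_imp_inj_on[OF b]] by blast
  show "m \<in> T2.A \<Longrightarrow> \<exists>f\<in>T1.A. \<Psi> f = m" using bij_betw_imp_surj_on[OF b] by (metis imageE)
qed

lemma \<Psi>_add: "f \<in> T1.A \<Longrightarrow> g \<in> T1.A \<Longrightarrow> \<Psi> (\<lambda>\<sigma>. f \<sigma> + g \<sigma>) = (\<lambda>\<tau>. \<Psi> f \<tau> + \<Psi> g \<tau>)"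
  and \<Psi>_conv: "f \<in> T1.A \<Longrightarrow> g \<in> T1.A \<Longrightarrow> \<Psi> (f \<star>\<^sub>1 g) = \<Psi> f \<star>\<^sub>2 \<Psi> g"
  and \<Psi>_scale: "f \<in> T1.A \<Longrightarrow> \<Psi> (\<lambda>\<sigma>. c * f \<sigma>) = (\<lambda>\<tau>. c * \<Psi> f \<tau>)"
  using iso unfolding steinberg_iso_def by blast+

lemma \<Psi>_zero: "\<Psi> (\<lambda>\<sigma>. 0) = (\<lambda>\<tau>. 0)"
  using \<Psi>_scale[OF T1.A_zero, of 0] by simp

lemma \<Psi>_D: "b \<in> T1.D \<Longrightarrow> \<Psi> b \<in> T2.D"
  and \<Psi>_D_surj: "c \<in> T2.D \<Longrightarrow> \<exists>b\<in>T1.D. \<Psi> b = c"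
  using diag unfolding diagonal_preserving_def by (blast, metis imageE)

definition \<kappa> :: "'a set \<Rightarrow> 'c set" where
  "\<kappa> K = T2.supp (\<Psi> (T1.e K))"

lemma \<kappa>:
  assumes K: "K \<in> T1.G.CO"
  shows "\<kappa> K \<in> T2.G.CO" "\<Psi> (T1.e K) = T2.e (\<kappa> K)"
proof -
  have "\<Psi> (T1.e K) \<star>\<^sub>2 \<Psi> (T1.e K) = \<Psi> (T1.e K)"
    using \<Psi>_conv[OF T1.N_A[OF T1.e_N[OF K]] T1.N_A[OF T1.e_N[OF K]]] T1.e_conv_e[OF K K] by simp
  then obtain L where "L \<in> T2.G.CO" "\<Psi> (T1.e K) = T2.e L"
    using T2.idempotent_D[OF \<Psi>_D[OF T1.e_D[OF K]]] by auto
  moreover from this have "\<kappa> K = L"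
    using T2.supp_e[OF T2.G.CO_sub] unfolding \<kappa>_def by simp
  ultimately show "\<kappa> K \<in> T2.G.CO" "\<Psi> (T1.e K) = T2.e (\<kappa> K)" by simp_all
qed

lemma \<kappa>_eqI: "L \<in> T2.G.CO \<Longrightarrow> K \<in> T1.G.CO \<Longrightarrow> \<Psi> (T1.e K) = T2.e L \<Longrightarrow> \<kappa> K = L"
  using T2.supp_e[OF T2.G.CO_sub] unfolding \<kappa>_def by simp

sublocale K: compact_open_iso "unit_space G1" "unit_space G2" \<kappa>
proof unfold_locales
  show "\<kappa> (K \<inter> L) = \<kappa> K \<inter> \<kappa> L" if K: "K \<in> T1.G.CO" and L: "L \<in> T1.G.CO" for K L
  proof (rule \<kappa>_eqI)
    show "\<kappa> K \<inter> \<kappa> L \<in> T2.G.CO" by (rule compact_opens_Int[OF T2.G.unit_haus \<kappa>(1)[OF K] \<kappa>(1)[OF L]])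
    show "K \<inter> L \<in> T1.G.CO" by (rule compact_opens_Int[OF T1.G.unit_haus K L])
    show "\<Psi> (T1.e (K \<inter> L)) = T2.e (\<kappa> K \<inter> \<kappa> L)"
      using \<Psi>_conv[OF T1.N_A[OF T1.e_N[OF K]] T1.N_A[OF T1.e_N[OF L]]] T1.e_conv_e[OF K L]
        T2.e_conv_e[OF \<kappa>(1)[OF K] \<kappa>(1)[OF L]] \<kappa>(2)[OF K] \<kappa>(2)[OF L] by simp
  qed
  show "bij_betw \<kappa> T1.G.CO T2.G.CO"
    unfolding bij_betw_def
  proof
    show "inj_on \<kappa> T1.G.CO"
    proof (rule inj_onI)
      fix K L assume KL: "K \<in> T1.G.CO" "L \<in> T1.G.CO" "\<kappa> K = \<kappa> L"
      then have "\<Psi> (T1.e K) = \<Psi> (T1.e L)" using \<kappa>(2) by simp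
      then have "T1.e K = T1.e L" using \<Psi>_inj T1.N_A T1.e_N KL by blast
      then show "K = L" using T1.e_inj T1.G.CO_sub KL by blast
    qed
    show "\<kappa> ` T1.G.CO = T2.G.CO"
    proof
      show "\<kappa> ` T1.G.CO \<subseteq> T2.G.CO" using \<kappa>(1) by auto
      show "T2.G.CO \<subseteq> \<kappa> ` T1.G.CO"
      proof
        fix L assume L: "L \<in> T2.G.CO"
        obtain b where b: "b \<in> T1.D" "\<Psi> b = T2.e L" using \<Psi>_D_surj[OF T2.e_D[OF L]] by auto
        have bA: "b \<in> T1.A" using b(1) T1.D_iff by auto
        have "\<Psi> (b \<star>\<^sub>1 b) = \<Psi> b" using \<Psi>_conv[OF bA bA] b T2.e_conv_e[OF L L] by simp
        then have "b \<star>\<^sub>1 b = b" using \<Psi>_inj[OF T1.conv_A[OF bA bA] bA] by simp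
        then obtain K where K: "K \<in> T1.G.CO" "b = T1.e K" using T1.idempotent_D[OF b(1)] by auto
        then have "\<kappa> K = L" using \<kappa>_eqI[OF L K(1)] b by simp
        then show "L \<in> \<kappa> ` T1.G.CO" using K by blast
      qed
    qed
  qed
qed

definition \<phi> :: "'a \<Rightarrow> 'c" where
  "\<phi> = (SOME \<phi>. homeomorphic_map (unit_space G1) (unit_space G2) \<phi> \<and> (\<forall>K\<in>T1.G.CO. \<phi> ` K = \<kappa> K))"

lemma \<phi>_homeo: "homeomorphic_map (unit_space G1) (unit_space G2) \<phi>"
  and \<phi>_image: "K \<in> T1.G.CO \<Longrightarrow> \<phi> ` K = \<kappa> K"
  using someI_ex[OF K.stone_homeomorphism] unfolding \<phi>_def by auto

lemma \<phi>_inj: "inj_on \<phi> (gunits G1)"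
  using homeomorphic_imp_injective_map[OF \<phi>_homeo] by simp

lemma \<phi>_units: "x \<in> gunits G1 \<Longrightarrow> \<phi> x \<in> gunits G2"
  using homeomorphic_imp_surjective_map[OF \<phi>_homeo] by auto

lemma \<phi>_CO: "K \<in> T1.G.CO \<Longrightarrow> \<phi> ` K \<in> T2.G.CO"
  and \<Psi>_e: "K \<in> T1.G.CO \<Longrightarrow> \<Psi> (T1.e K) = T2.e (\<phi> ` K)"
  using \<kappa> \<phi>_image by auto

lemma \<phi>_CO_surj: "L \<in> T2.G.CO \<Longrightarrow> \<exists>K\<in>T1.G.CO. \<phi> ` K = L"
  using K.bij \<phi>_image unfolding bij_betw_def by (metis imageE)

lemma \<phi>_mem: "K \<subseteq> gunits G1 \<Longrightarrow> x \<in> gunits G1 \<Longrightarrow> \<phi> x \<in> \<phi> ` K \<longleftrightarrow> x \<in> K"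
  using \<phi>_inj inj_on_image_mem_iff by metis

text \<open>
  The image of a monomial is a normaliser, so the local bisection hypothesis applies to its
  support. The relation \<open>\<Psi> n \<star> \<Psi> (star n) = e K\<close>, evaluated at the range of an arrow in the
  support, exhibits an inverse of the value there.
\<close>

lemma \<Psi>_N:
  assumes n: "n \<in> T1.N"
  shows "\<Psi> n \<in> T2.N"
proof -
  let ?s = "T1.star n" and ?m = "\<Psi> n"
  let ?k = "\<Psi> ?s"
  have nA: "n \<in> T1.A" and sN: "?s \<in> T1.N" and sA: "?s \<in> T1.A"
    using n T1.star_N T1.N_A by auto
  note cA = T1.conv_A
  have mA: "?m \<in> T2.A" and kA: "?k \<in> T2.A" using \<Psi>_A nA sA by auto
  have "normaliser G2 S2 i2 q2 ?m"
    unfolding normaliser_def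
  proof (intro conjI bexI[of _ ?k] ballI)
    show "?m \<in> T2.A" "?k \<in> T2.A" by fact+
    have "\<Psi> ((n \<star>\<^sub>1 ?s) \<star>\<^sub>1 n) = (?m \<star>\<^sub>2 ?k) \<star>\<^sub>2 ?m"
      using \<Psi>_conv[OF cA[OF nA sA] nA] \<Psi>_conv[OF nA sA] by simp
    then show "(?m \<star>\<^sub>2 ?k) \<star>\<^sub>2 ?m = ?m" using T1.conv_star_conv[OF n] by simp
    have "\<Psi> ((?s \<star>\<^sub>1 n) \<star>\<^sub>1 ?s) = (?k \<star>\<^sub>2 ?m) \<star>\<^sub>2 ?k"
      using \<Psi>_conv[OF cA[OF sA nA] sA] \<Psi>_conv[OF sA nA] by simp
    then show "(?k \<star>\<^sub>2 ?m) \<star>\<^sub>2 ?k = ?k" using T1.conv_star_conv[OF sN] T1.star_star[OF n] by simp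
    fix b assume "b \<in> T2.D"
    then obtain c where c: "c \<in> T1.D" "\<Psi> c = b" using \<Psi>_D_surj by auto
    have cAA: "c \<in> T1.A" using c(1) T1.D_iff by auto
    have "\<Psi> ((?s \<star>\<^sub>1 c) \<star>\<^sub>1 n) = (?k \<star>\<^sub>2 b) \<star>\<^sub>2 ?m"
      using \<Psi>_conv[OF cA[OF sA cAA] nA] \<Psi>_conv[OF sA cAA] c by simp
    then show "(?k \<star>\<^sub>2 b) \<star>\<^sub>2 ?m \<in> T2.D" using \<Psi>_D[OF T1.normaliser_D[OF n c(1)]] by simp
    have "\<Psi> ((n \<star>\<^sub>1 c) \<star>\<^sub>1 ?s) = (?m \<star>\<^sub>2 b) \<star>\<^sub>2 ?k"
      using \<Psi>_conv[OF cA[OF nA cAA] sA] \<Psi>_conv[OF nA cAA] c by simp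
    then show "(?m \<star>\<^sub>2 b) \<star>\<^sub>2 ?k \<in> T2.D"
      using \<Psi>_D[OF T1.normaliser_D[OF sN c(1)]] T1.star_star[OF n] by simp
  qed
  then have bis: "bisection G2 (T2.supp ?m)"
    using lbh unfolding local_bisection_hypothesis_def by blast
  note inj = bisection_inj[OF bis]
  let ?K = "rng G1 ` T1.supp n"
  have K: "?K \<in> T1.G.CO" by (rule T1.supp_CO(1)[OF nA])
  have mk: "?m \<star>\<^sub>2 ?k = T2.e (\<phi> ` ?K)"
    using \<Psi>_conv[OF nA sA] T1.conv_star[OF n] \<Psi>_e[OF K] by simp
  have em: "T2.e (\<phi> ` ?K) \<star>\<^sub>2 ?m = ?m"
    using \<Psi>_conv[OF T1.N_A[OF T1.e_N[OF K]] nA] T1.conv_e_rng[OF nA] \<Psi>_e[OF K] by simp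
  have "?m \<sigma> \<in> Units_R" if s: "\<sigma> \<in> arr S2" "?m \<sigma> \<noteq> 0" for \<sigma>
  proof -
    have "(T2.e (\<phi> ` ?K) \<star>\<^sub>2 ?m) \<sigma> \<noteq> 0" using em s by simp
    then have "rng G2 (q2 \<sigma>) \<in> \<phi> ` ?K"
      using T2.conv_e_left[OF \<phi>_CO[OF K] mA s(1)] by presburger
    then have "T2.e (\<phi> ` ?K) (rng S2 \<sigma>) = 1"
      using T2.e_unit[OF T2.G.CO_sub[OF \<phi>_CO[OF K]], of "rng S2 \<sigma>"] s by simp
    then have "(?m \<star>\<^sub>2 ?k) (rng S2 \<sigma>) = 1" using mk by simp
    moreover have "(?m \<star>\<^sub>2 ?k) (rng S2 \<sigma>) = ?m \<sigma> * ?k (mul S2 (ginv S2 \<sigma>) (rng S2 \<sigma>))"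
      using s by (intro T2.conv_single[OF mA kA inj(1)]) auto
    ultimately show ?thesis unfolding Units_R_def by auto
  qed
  then show ?thesis using mA inj unfolding T2.monomials_def by blast
qed

text \<open>
  The set of sources of the support of \<open>n\<close> is visible in the algebra: its indicator function is
  \<open>star n \<star> n\<close>, and it is a right unit for \<open>n\<close>. Each of these relations gives one inclusion.
\<close>

lemma src_supp_\<Psi>:
  assumes n: "n \<in> T1.N"
  shows "src G2 ` T2.supp (\<Psi> n) = \<phi> ` (src G1 ` T1.supp n)"
proof -
  let ?K = "src G1 ` T1.supp n"
  have nA: "n \<in> T1.A" and sA: "T1.star n \<in> T1.A" using n T1.star_N T1.N_A by auto
  have mA: "\<Psi> n \<in> T2.A" and kA: "\<Psi> (T1.star n) \<in> T2.A" using \<Psi>_A nA sA by auto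
  have K: "?K \<in> T1.G.CO" by (rule T1.supp_CO(2)[OF nA])
  have KX: "\<phi> ` ?K \<subseteq> gunits G2" by (rule T2.G.CO_sub[OF \<phi>_CO[OF K]])
  have km: "\<Psi> (T1.star n) \<star>\<^sub>2 \<Psi> n = T2.e (\<phi> ` ?K)"
    using \<Psi>_conv[OF sA nA] T1.star_conv[OF n] \<Psi>_e[OF K] by simp
  have me: "\<Psi> n \<star>\<^sub>2 T2.e (\<phi> ` ?K) = \<Psi> n"
    using \<Psi>_conv[OF nA T1.N_A[OF T1.e_N[OF K]]] T1.conv_e_src[OF nA] \<Psi>_e[OF K] by simp
  show ?thesis
  proof
    show "src G2 ` T2.supp (\<Psi> n) \<subseteq> \<phi> ` ?K"
    proof
      fix y assume "y \<in> src G2 ` T2.supp (\<Psi> n)"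
      then obtain \<sigma> where s: "\<sigma> \<in> arr S2" "\<Psi> n \<sigma> \<noteq> 0" "y = src G2 (q2 \<sigma>)"
        unfolding suppG_def fsupp_def by auto
      have "(\<Psi> n \<star>\<^sub>2 T2.e (\<phi> ` ?K)) \<sigma> \<noteq> 0" using me s by simp
      then show "y \<in> \<phi> ` ?K"
        using T2.conv_e_right[OF \<phi>_CO[OF K] mA s(1)] s(3) by presburger
    qed
    show "\<phi> ` ?K \<subseteq> src G2 ` T2.supp (\<Psi> n)"
    proof
      fix y assume y: "y \<in> \<phi> ` ?K"
      then have "y \<in> T2.supp (\<Psi> (T1.star n) \<star>\<^sub>2 \<Psi> n)" using T2.supp_e[OF KX] km by simp
      then obtain \<beta> \<gamma> where b: "\<beta> \<in> T2.supp (\<Psi> (T1.star n))" "\<gamma> \<in> T2.supp (\<Psi> n)"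
        "src G2 \<beta> = rng G2 \<gamma>" "y = mul G2 \<beta> \<gamma>" by (rule T2.supp_conv)
      have "\<beta> \<in> arr G2" "\<gamma> \<in> arr G2" using b T2.supp_arr by auto
      then have "src G2 y = src G2 \<gamma>" using b by simp
      moreover have "src G2 y = y" by (rule T2.G.gunits_src[OF subsetD[OF KX y]])
      ultimately show "y \<in> src G2 ` T2.supp (\<Psi> n)" using b(2) by (metis image_eqI)
    qed
  qed
qed

lemma mem_\<phi>_src:
  assumes "m \<in> T2.A" "\<sigma> \<in> arr S2" "m \<sigma> = 1"
  shows "src G2 (q2 \<sigma>) \<in> src G2 ` T2.supp m"
  using T2.A_supp_iff[OF assms(1,2)] assms by auto

lemma ex_image:
  assumes n: "n \<in> T1.N" and t: "\<tau> \<in> arr S1" "n \<tau> = 1"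
  shows "\<exists>\<sigma>\<in>arr S2. \<Psi> n \<sigma> = 1 \<and> src G2 (q2 \<sigma>) = \<phi> (src G1 (q1 \<tau>))"
proof -
  have "q1 \<tau> \<in> T1.supp n" using T1.A_supp_iff[OF T1.N_A[OF n] t(1)] t by simp
  then have "\<phi> (src G1 (q1 \<tau>)) \<in> src G2 ` T2.supp (\<Psi> n)" using src_supp_\<Psi>[OF n] by auto
  then obtain \<sigma> where s: "\<sigma> \<in> arr S2" "\<Psi> n \<sigma> \<noteq> 0" "\<phi> (src G1 (q1 \<tau>)) = src G2 (q2 \<sigma>)"
    unfolding suppG_def fsupp_def by auto
  obtain \<rho> where "\<rho> \<in> arr S2" "q2 \<rho> = q2 \<sigma>" "\<Psi> n \<rho> = 1"
    using T2.ex_normalised[OF \<Psi>_N[OF n] s(1,2)] .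
  then show ?thesis using s by (intro bexI[of _ \<rho>]) auto
qed

text \<open>
  That \<open>n\<close> and \<open>n'\<close> agree near \<open>\<tau>\<close> is expressed by an equation \<open>n \<star> e K = n' \<star> e K\<close>, to which
  \<open>\<Psi>\<close> can be applied.
\<close>

lemma image_independent:
  assumes n: "n \<in> T1.N" and n': "n' \<in> T1.N" and t: "\<tau> \<in> arr S1" "n \<tau> = 1" "n' \<tau> = 1"
    and s: "\<sigma> \<in> arr S2" "\<Psi> n \<sigma> = 1" "src G2 (q2 \<sigma>) = \<phi> (src G1 (q1 \<tau>))"
  shows "\<Psi> n' \<sigma> = 1"
proof -
  obtain K where K: "K \<in> T1.G.CO" "src G1 (q1 \<tau>) \<in> K" "n \<star>\<^sub>1 T1.e K = n' \<star>\<^sub>1 T1.e K"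
    using T1.germ[OF n n' t] by auto
  note eA = T1.N_A[OF T1.e_N[OF K(1)]]
  have "\<Psi> n \<star>\<^sub>2 T2.e (\<phi> ` K) = \<Psi> n' \<star>\<^sub>2 T2.e (\<phi> ` K)"
    using \<Psi>_conv[OF T1.N_A[OF n] eA] \<Psi>_conv[OF T1.N_A[OF n'] eA] K \<Psi>_e[OF K(1)] by simp
  then have "(\<Psi> n \<star>\<^sub>2 T2.e (\<phi> ` K)) \<sigma> = (\<Psi> n' \<star>\<^sub>2 T2.e (\<phi> ` K)) \<sigma>" by simp
  then show ?thesis
    using T2.conv_e_right[OF \<phi>_CO[OF K(1)] \<Psi>_A[OF T1.N_A[OF n]] s(1)]
      T2.conv_e_right[OF \<phi>_CO[OF K(1)] \<Psi>_A[OF T1.N_A[OF n']] s(1)] s K(2) by simp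
qed

definition \<psi> :: "'b \<Rightarrow> 'd" where
  "\<psi> \<tau> = (SOME \<sigma>. \<sigma> \<in> arr S2 \<and> src G2 (q2 \<sigma>) = \<phi> (src G1 (q1 \<tau>)) \<and> (\<forall>n\<in>T1.N. n \<tau> = 1 \<longrightarrow> \<Psi> n \<sigma> = 1))"

lemma \<psi>:
  assumes t: "\<tau> \<in> arr S1"
  shows "\<psi> \<tau> \<in> arr S2" "src G2 (q2 (\<psi> \<tau>)) = \<phi> (src G1 (q1 \<tau>))" "n \<in> T1.N \<Longrightarrow> n \<tau> = 1 \<Longrightarrow> \<Psi> n (\<psi> \<tau>) = 1"
proof -
  obtain n where n: "n \<in> T1.N" "n \<tau> = 1" using T1.ex_monomial[OF t] by auto
  obtain \<sigma> where s: "\<sigma> \<in> arr S2" "\<Psi> n \<sigma> = 1" "src G2 (q2 \<sigma>) = \<phi> (src G1 (q1 \<tau>))"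
    using ex_image[OF n(1) t n(2)] by auto
  have "\<exists>\<sigma>. \<sigma> \<in> arr S2 \<and> src G2 (q2 \<sigma>) = \<phi> (src G1 (q1 \<tau>)) \<and> (\<forall>n\<in>T1.N. n \<tau> = 1 \<longrightarrow> \<Psi> n \<sigma> = 1)"
    using s image_independent[OF n(1) _ t n(2) _ s] by blast
  from someI_ex[OF this]
  show "\<psi> \<tau> \<in> arr S2" "src G2 (q2 (\<psi> \<tau>)) = \<phi> (src G1 (q1 \<tau>))" "n \<in> T1.N \<Longrightarrow> n \<tau> = 1 \<Longrightarrow> \<Psi> n (\<psi> \<tau>) = 1" for n
    unfolding \<psi>_def by blast+
qed

lemma \<psi>_eqI:
  assumes "\<tau> \<in> arr S1" "n \<in> T1.N" "n \<tau> = 1" "\<sigma> \<in> arr S2" "\<Psi> n \<sigma> = 1" "src G2 (q2 \<sigma>) = \<phi> (src G1 (q1 \<tau>))"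
  shows "\<psi> \<tau> = \<sigma>"
  by (rule T2.slice_inj[OF \<Psi>_N[OF assms(2)] \<psi>(1)[OF assms(1)] assms(4) \<psi>(3)[OF assms(1-3)] assms(5)])
    (simp add: \<psi>(2)[OF assms(1)] assms(6))

text \<open>
  The argument for independence of the monomial, read backwards: a germ in the target is the
  image of one in the source.
\<close>

lemma \<psi>_inj: "inj_on \<psi> (arr S1)"
proof (rule inj_onI)
  fix \<tau> \<tau>' assume t: "\<tau> \<in> arr S1" "\<tau>' \<in> arr S1" "\<psi> \<tau> = \<psi> \<tau>'"
  have "\<phi> (src G1 (q1 \<tau>)) = \<phi> (src G1 (q1 \<tau>'))" using \<psi>(2)[OF t(1)] \<psi>(2)[OF t(2)] t(3) by simp
  then have src: "src G1 (q1 \<tau>) = src G1 (q1 \<tau>')" using inj_onD[OF \<phi>_inj] t by simp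
  obtain n n' where n: "n \<in> T1.N" "n \<tau> = 1" "n' \<in> T1.N" "n' \<tau>' = 1" using T1.ex_monomial t by metis
  have "\<Psi> n (\<psi> \<tau>) = 1" "\<Psi> n' (\<psi> \<tau>) = 1" using \<psi>(3)[OF t(1) n(1,2)] \<psi>(3)[OF t(2) n(3,4)] t by auto
  from T2.germ[OF \<Psi>_N[OF n(1)] \<Psi>_N[OF n(3)] \<psi>(1)[OF t(1)] this]
  obtain L where L: "L \<in> T2.G.CO" "src G2 (q2 (\<psi> \<tau>)) \<in> L" "\<Psi> n \<star>\<^sub>2 T2.e L = \<Psi> n' \<star>\<^sub>2 T2.e L" by auto
  obtain K where K: "K \<in> T1.G.CO" "\<phi> ` K = L" using \<phi>_CO_surj[OF L(1)] by auto
  note eA = T1.N_A[OF T1.e_N[OF K(1)]]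
  have xK: "src G1 (q1 \<tau>) \<in> K"
    using L(2) K \<psi>(2)[OF t(1)] \<phi>_mem[OF T1.G.CO_sub[OF K(1)]] t by simp
  have "\<Psi> (n \<star>\<^sub>1 T1.e K) = \<Psi> (n' \<star>\<^sub>1 T1.e K)"
    using \<Psi>_conv[OF T1.N_A[OF n(1)] eA] \<Psi>_conv[OF T1.N_A[OF n(3)] eA] L(3) K \<Psi>_e[OF K(1)] by simp
  then have "n \<star>\<^sub>1 T1.e K = n' \<star>\<^sub>1 T1.e K"
    using \<Psi>_inj[OF T1.conv_A[OF T1.N_A[OF n(1)] eA] T1.conv_A[OF T1.N_A[OF n(3)] eA]] by simp
  then have "(n \<star>\<^sub>1 T1.e K) \<tau> = (n' \<star>\<^sub>1 T1.e K) \<tau>" by simp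
  then have "n' \<tau> = 1"
    using T1.conv_e_right[OF K(1) T1.N_A[OF n(1)] t(1)] T1.conv_e_right[OF K(1) T1.N_A[OF n(3)] t(1)] xK n by simp
  then show "\<tau> = \<tau>'" using T1.slice_inj[OF n(3) t(1,2) _ n(4) src] by simp
qed

text \<open>
  Since monomials span, some monomial has an image that does not vanish at a given \<open>\<sigma>\<close>.
\<close>

lemma \<psi>_surj:
  assumes s: "\<sigma> \<in> arr S2"
  shows "\<exists>\<tau>\<in>arr S1. \<psi> \<tau> = \<sigma>"
proof -
  obtain m where m: "m \<in> T2.N" "m \<sigma> = 1" using T2.ex_monomial[OF s] by auto
  obtain f where f: "f \<in> T1.A" "\<Psi> f = m" using \<Psi>_surj[OF T2.N_A[OF m(1)]] by auto
  have "\<Psi> f \<sigma> \<noteq> 0 \<longrightarrow> (\<exists>n\<in>T1.N. \<Psi> n \<sigma> \<noteq> 0)"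
    using f(1)
  proof (rule T1.span_induct[where P = "\<lambda>f. \<Psi> f \<sigma> \<noteq> 0 \<longrightarrow> (\<exists>n\<in>T1.N. \<Psi> n \<sigma> \<noteq> 0)"])
    show "\<Psi> (\<lambda>\<sigma>. 0) \<sigma> \<noteq> 0 \<longrightarrow> (\<exists>n\<in>T1.N. \<Psi> n \<sigma> \<noteq> 0)" by (simp add: \<Psi>_zero)
    show "\<Psi> (\<lambda>\<sigma>. f \<sigma> + g \<sigma>) \<sigma> \<noteq> 0 \<longrightarrow> (\<exists>n\<in>T1.N. \<Psi> n \<sigma> \<noteq> 0)"
      if "f \<in> T1.A" "g \<in> T1.A" "\<Psi> f \<sigma> \<noteq> 0 \<longrightarrow> (\<exists>n\<in>T1.N. \<Psi> n \<sigma> \<noteq> 0)"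
        "\<Psi> g \<sigma> \<noteq> 0 \<longrightarrow> (\<exists>n\<in>T1.N. \<Psi> n \<sigma> \<noteq> 0)" for f g
      using that(3,4) by (auto simp: \<Psi>_add[OF that(1,2)])
    show "\<Psi> (\<lambda>\<sigma>. c * n \<sigma>) \<sigma> \<noteq> 0 \<longrightarrow> (\<exists>n\<in>T1.N. \<Psi> n \<sigma> \<noteq> 0)" if "n \<in> T1.N" for c n
      using that unfolding \<Psi>_scale[OF T1.N_A[OF that]] by (metis mult_zero_right)
  qed
  then obtain n where n: "n \<in> T1.N" "\<Psi> n \<sigma> \<noteq> 0" using f m by auto
  have u: "\<Psi> n \<sigma> \<in> Units_R" using T2.N_unit[OF \<Psi>_N[OF n(1)] s n(2)] .
  \<comment> \<open>Rescaling by the value at \<open>\<sigma>\<close> stays within the monomials and commutes with \<open>\<Psi>\<close>.\<close>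
  define n' where "n' = (\<lambda>\<sigma>'. unit_inv (\<Psi> n \<sigma>) * n \<sigma>')"
  have n': "n' \<in> T1.N" unfolding n'_def using T1.N_scale[OF n(1)] u by simp
  have \<Psi>n': "\<Psi> n' \<sigma> = 1"
    unfolding n'_def \<Psi>_scale[OF T1.N_A[OF n(1)]] using u by (simp add: unit_inv_left)
  have "src G2 (q2 \<sigma>) \<in> \<phi> ` (src G1 ` T1.supp n')"
    using mem_\<phi>_src[OF \<Psi>_A[OF T1.N_A[OF n']] s \<Psi>n'] src_supp_\<Psi>[OF n'] by simp
  then obtain \<tau>0 where t0: "\<tau>0 \<in> arr S1" "n' \<tau>0 \<noteq> 0" "src G2 (q2 \<sigma>) = \<phi> (src G1 (q1 \<tau>0))"
    unfolding suppG_def fsupp_def by auto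
  obtain \<tau> where t: "\<tau> \<in> arr S1" "q1 \<tau> = q1 \<tau>0" "n' \<tau> = 1" using T1.ex_normalised[OF n' t0(1,2)] .
  have "\<psi> \<tau> = \<sigma>" by (rule \<psi>_eqI[OF t(1) n' t(3) s \<Psi>n']) (simp add: t0 t)
  then show ?thesis using t(1) by blast
qed

text \<open>
  For \<open>K\<close> containing the range of \<open>\<tau>\<close>, multiplying \<open>n\<close> by \<open>e K\<close> from the left keeps it
  normalised at \<open>\<tau>\<close>; so the range of \<open>\<psi> \<tau>\<close> lies in \<open>\<phi> ` K\<close>. These sets separate points.
\<close>

lemma \<psi>_rng:
  assumes t: "\<tau> \<in> arr S1"
  shows "rng G2 (q2 (\<psi> \<tau>)) = \<phi> (rng G1 (q1 \<tau>))"
proof (rule T2.G.units.eqI[symmetric])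
  show "\<phi> (rng G1 (q1 \<tau>)) \<in> topspace (unit_space G2)" using \<phi>_units t by simp
  show "rng G2 (q2 (\<psi> \<tau>)) \<in> topspace (unit_space G2)" using \<psi>(1)[OF t] by simp
  fix L assume L: "L \<in> T2.G.CO" "\<phi> (rng G1 (q1 \<tau>)) \<in> L"
  obtain K where K: "K \<in> T1.G.CO" "\<phi> ` K = L" using \<phi>_CO_surj[OF L(1)] by auto
  have xK: "rng G1 (q1 \<tau>) \<in> K"
    using L(2) K \<phi>_mem[OF T1.G.CO_sub[OF K(1)], of "rng G1 (q1 \<tau>)"] t by simp
  obtain n where n: "n \<in> T1.N" "n \<tau> = 1" using T1.ex_monomial[OF t] by auto
  note nA = T1.N_A[OF n(1)]
  have eN: "T1.e K \<star>\<^sub>1 n \<in> T1.N" by (rule T1.conv_N[OF T1.e_N[OF K(1)] n(1)])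
  have "(T1.e K \<star>\<^sub>1 n) \<tau> = 1" using T1.conv_e_left[OF K(1) nA t] xK n by simp
  then have "\<Psi> (T1.e K \<star>\<^sub>1 n) (\<psi> \<tau>) = 1" by (rule \<psi>(3)[OF t eN])
  then have "(T2.e L \<star>\<^sub>2 \<Psi> n) (\<psi> \<tau>) = 1"
    using \<Psi>_conv[OF T1.N_A[OF T1.e_N[OF K(1)]] nA] \<Psi>_e[OF K(1)] K(2) by simp
  then show "rng G2 (q2 (\<psi> \<tau>)) \<in> L"
    using T2.conv_e_left[OF L(1) \<Psi>_A[OF nA] \<psi>(1)[OF t]] T2.zero_neq_one(1) by presburger
qed

lemma \<psi>_hom: "groupoid_hom S1 S2 \<psi>"
  unfolding groupoid_hom_def
proof (intro conjI ballI, clarsimp simp: \<psi>(1), clarify)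
  fix \<tau> \<tau>' assume "(\<tau>, \<tau>') \<in> composable S1"
  then have t: "\<tau> \<in> arr S1" "\<tau>' \<in> arr S1" "src S1 \<tau> = rng S1 \<tau>'" by (auto simp: composable_def)
  note t1 = \<psi>(1)[OF t(1)] and t2 = \<psi>(1)[OF t(2)]
  have "src G1 (q1 \<tau>) = rng G1 (q1 \<tau>')" using t T1.src_rng_iff by simp
  then have c: "src S2 (\<psi> \<tau>) = rng S2 (\<psi> \<tau>')"
    using T2.src_rng_iff[OF t1 t2] \<psi>(2)[OF t(1)] \<psi>_rng[OF t(2)] by simp
  obtain n n' where n: "n \<in> T1.N" "n \<tau> = 1" "n' \<in> T1.N" "n' \<tau>' = 1" using T1.ex_monomial t by metis
  have "\<psi> (mul S1 \<tau> \<tau>') = mul S2 (\<psi> \<tau>) (\<psi> \<tau>')"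
  proof (rule \<psi>_eqI[OF _ T1.conv_N[OF n(1,3)]])
    show "mul S1 \<tau> \<tau>' \<in> arr S1" "mul S2 (\<psi> \<tau>) (\<psi> \<tau>') \<in> arr S2" using t t1 t2 c by auto
    show "(n \<star>\<^sub>1 n') (mul S1 \<tau> \<tau>') = 1"
      using T1.conv_mul[OF n(1) T1.N_A[OF n(3)] t] n by simp
    show "\<Psi> (n \<star>\<^sub>1 n') (mul S2 (\<psi> \<tau>) (\<psi> \<tau>')) = 1"
      using T2.conv_mul[OF \<Psi>_N[OF n(1)] \<Psi>_A[OF T1.N_A[OF n(3)]] t1 t2 c] \<psi>(3)[OF t(1) n(1,2)] \<psi>(3)[OF t(2) n(3,4)]
        \<Psi>_conv[OF T1.N_A[OF n(1)] T1.N_A[OF n(3)]] by simp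
    have "src G2 (q2 (mul S2 (\<psi> \<tau>) (\<psi> \<tau>'))) = src G2 (q2 (\<psi> \<tau>'))"
      using T2.q_src[of "mul S2 (\<psi> \<tau>) (\<psi> \<tau>')"] t1 t2 c by (metis T2.S.mul_arr T2.S.src_mul T2.q_src)
    moreover have "src G1 (q1 (mul S1 \<tau> \<tau>')) = src G1 (q1 \<tau>')"
      using t by (metis T1.S.mul_arr T1.S.src_mul T1.q_src)
    ultimately show "src G2 (q2 (mul S2 (\<psi> \<tau>) (\<psi> \<tau>'))) = \<phi> (src G1 (q1 (mul S1 \<tau> \<tau>')))"
      using \<psi>(2)[OF t(2)] by simp
  qed
  then show "(\<psi> \<tau>, \<psi> \<tau>') \<in> composable S2 \<and> \<psi> (mul S1 \<tau> \<tau>') = mul S2 (\<psi> \<tau>) (\<psi> \<tau>')"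
    using t1 t2 c by (simp add: composable_def)
qed

text \<open>
  The multiple \<open>t * e K\<close> of an indicator function is normalised at \<open>i (x, t)\<close>.
\<close>

lemma \<psi>_i:
  assumes x: "x \<in> gunits G1" and t: "t \<in> Units_R"
  shows "\<psi> (i1 (x, t)) = i2 (\<phi> x, t)"
proof -
  obtain K where K: "K \<in> T1.G.CO" "x \<in> K" using T1.ex_CO[OF x] by auto
  note eN = T1.e_N[OF K(1)]
  have y: "\<phi> x \<in> gunits G2" by (rule \<phi>_units[OF x])
  show ?thesis
  proof (rule \<psi>_eqI[OF _ T1.N_scale[OF eN t]])
    show "i1 (x, t) \<in> arr S1" "i2 (\<phi> x, t) \<in> arr S2" using x y t by simp_all
    show "t * T1.e K (i1 (x, t)) = 1"
      using T1.e_i[OF T1.G.CO_sub[OF K(1)] x t] K t by (simp add: unit_inv_right)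
    have "T2.e (\<phi> ` K) (i2 (\<phi> x, t)) = unit_inv t"
      using T2.e_i[OF T2.G.CO_sub[OF \<phi>_CO[OF K(1)]] y t] K by simp
    then show "\<Psi> (\<lambda>\<sigma>. t * T1.e K \<sigma>) (i2 (\<phi> x, t)) = 1"
      using \<Psi>_scale[OF T1.N_A[OF eN], of t] \<Psi>_e[OF K(1)] t by (simp add: unit_inv_right)
    show "src G2 (q2 (i2 (\<phi> x, t))) = \<phi> (src G1 (q1 (i1 (x, t))))" using x y t by simp
  qed
qed

text \<open>
  On the open set where \<open>n\<close> is one, the source map is an open embedding into the unit space, and
  likewise for \<open>\<Psi> n\<close>; between these sets, \<open>\<psi>\<close> is \<open>\<phi>\<close> read through the source maps.
\<close>

lemma \<psi>_homeo: "homeomorphic_map (arr_top S1) (arr_top S2) \<psi>"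
proof (rule bijective_open_imp_homeomorphic_map)
  let ?p1 = "\<lambda>\<sigma>. src G1 (q1 \<sigma>)" and ?p2 = "\<lambda>\<sigma>. src G2 (q2 \<sigma>)"
  show "continuous_map (arr_top S1) (arr_top S2) \<psi>"
    unfolding continuous_map_def
  proof (intro conjI allI impI)
    show "\<psi> \<in> arr S1 \<rightarrow> arr S2" using \<psi>(1) by auto
    fix V assume V: "openin (arr_top S2) V"
    show "openin (arr_top S1) {\<tau> \<in> arr S1. \<psi> \<tau> \<in> V}"
    proof (subst openin_subopen, intro ballI)
      fix \<tau> assume t: "\<tau> \<in> {\<tau> \<in> arr S1. \<psi> \<tau> \<in> V}"
      then have ta: "\<tau> \<in> arr S1" by simp
      obtain n where n: "n \<in> T1.N" "n \<tau> = 1" using T1.ex_monomial[OF ta] by auto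
      let ?V = "V \<inter> {\<sigma> \<in> arr S2. \<Psi> n \<sigma> \<in> {1}}"
      have "openin (unit_space G2) (?p2 ` ?V)"
        using V T2.lconst_open[OF T2.A_lconst[OF \<Psi>_A[OF T1.N_A[OF n(1)]]]] by (intro T2.open_src_q openin_Int)
      from openin_continuous_map_preimage[OF homeomorphic_imp_continuous_map[OF \<phi>_homeo] this]
      have "openin (unit_space G1) {x \<in> gunits G1. \<phi> x \<in> ?p2 ` ?V}" by simp
      from openin_continuous_map_preimage[OF T1.cont_src_q this]
      have "openin (arr_top S1) ({\<tau> \<in> arr S1. ?p1 \<tau> \<in> {x \<in> gunits G1. \<phi> x \<in> ?p2 ` ?V}} \<inter> {\<tau> \<in> arr S1. n \<tau> \<in> {1}})"
        (is "openin _ ?W")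
        using T1.lconst_open[OF T1.A_lconst[OF T1.N_A[OF n(1)]]] by (intro openin_Int)
      moreover have "\<tau> \<in> ?W"
        using t n \<psi>[OF ta] by (auto intro!: image_eqI[of _ ?p2 "\<psi> \<tau>"])
      moreover have "?W \<subseteq> {\<tau> \<in> arr S1. \<psi> \<tau> \<in> V}"
      proof
        fix \<tau>' assume t': "\<tau>' \<in> ?W"
        then obtain \<sigma> where s: "\<sigma> \<in> V" "\<sigma> \<in> arr S2" "\<Psi> n \<sigma> = 1" "\<phi> (?p1 \<tau>') = ?p2 \<sigma>" by auto
        have "\<psi> \<tau>' = \<sigma>" using t' s n by (intro \<psi>_eqI[OF _ n(1)]) auto
        then show "\<tau>' \<in> {\<tau> \<in> arr S1. \<psi> \<tau> \<in> V}" using t' s by simp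
      qed
      ultimately show "\<exists>T. openin (arr_top S1) T \<and> \<tau> \<in> T \<and> T \<subseteq> {\<tau> \<in> arr S1. \<psi> \<tau> \<in> V}"
        by (intro exI[of _ ?W] conjI)
    qed
  qed
  show "open_map (arr_top S1) (arr_top S2) \<psi>"
    unfolding open_map_def
  proof (intro allI impI)
    fix U assume U: "openin (arr_top S1) U"
    show "openin (arr_top S2) (\<psi> ` U)"
    proof (subst openin_subopen, intro ballI)
      fix \<sigma> assume "\<sigma> \<in> \<psi> ` U"
      then obtain \<tau> where t: "\<tau> \<in> U" "\<sigma> = \<psi> \<tau>" by auto
      have ta: "\<tau> \<in> arr S1" using t openin_subset[OF U] by auto
      obtain n where n: "n \<in> T1.N" "n \<tau> = 1" using T1.ex_monomial[OF ta] by auto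
      let ?U = "U \<inter> {\<tau> \<in> arr S1. n \<tau> \<in> {1}}"
      have "openin (unit_space G1) (?p1 ` ?U)"
        using U T1.lconst_open[OF T1.A_lconst[OF T1.N_A[OF n(1)]]] by (intro T1.open_src_q openin_Int)
      then have "openin (unit_space G2) (\<phi> ` (?p1 ` ?U))"
        using homeomorphic_imp_open_map[OF \<phi>_homeo] unfolding open_map_def by blast
      from openin_continuous_map_preimage[OF T2.cont_src_q this]
      have "openin (arr_top S2) ({\<sigma> \<in> arr S2. ?p2 \<sigma> \<in> \<phi> ` (?p1 ` ?U)} \<inter> {\<sigma> \<in> arr S2. \<Psi> n \<sigma> \<in> {1}})"
        (is "openin _ ?W")
        using T2.lconst_open[OF T2.A_lconst[OF \<Psi>_A[OF T1.N_A[OF n(1)]]]] by (intro openin_Int)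
      moreover have "\<sigma> \<in> ?W"
        using t ta n \<psi>[OF ta] by auto
      moreover have "?W \<subseteq> \<psi> ` U"
      proof
        fix \<sigma>' assume s: "\<sigma>' \<in> ?W"
        then obtain \<tau>' where t': "\<tau>' \<in> U" "\<tau>' \<in> arr S1" "n \<tau>' = 1" "?p2 \<sigma>' = \<phi> (?p1 \<tau>')" by auto
        have "\<psi> \<tau>' = \<sigma>'" using t' s n by (intro \<psi>_eqI[OF _ n(1)]) auto
        then show "\<sigma>' \<in> \<psi> ` U" using t' by blast
      qed
      ultimately show "\<exists>T. openin (arr_top S2) T \<and> \<sigma> \<in> T \<and> T \<subseteq> \<psi> ` U"
        by (intro exI[of _ ?W] conjI)
    qed
  qed
  show "\<psi> ` arr S1 = arr S2" using \<psi>(1) \<psi>_surj by (auto simp: image_iff)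
  show "inj_on \<psi> (arr S1)" by (rule \<psi>_inj)
qed

lemma \<psi>_act:
  assumes "\<tau> \<in> arr S1" "t \<in> Units_R"
  shows "\<psi> (T1.act t \<tau>) = T2.act t (\<psi> \<tau>)"
proof -
  have "\<psi> (mul S1 (i1 (rng G1 (q1 \<tau>), t)) \<tau>) = mul S2 (\<psi> (i1 (rng G1 (q1 \<tau>), t))) (\<psi> \<tau>)"
    using assms by (intro hom_mul(1)[OF \<psi>_hom]) auto
  then show ?thesis
    using assms \<psi>(1)[OF assms(1)] by (simp add: T1.act_eq T2.act_eq \<psi>_i \<psi>_rng)
qed

text \<open>
  Equivariance of \<open>\<psi>\<close> makes the choice of lift irrelevant.
\<close>

definition \<psi>G :: "'a \<Rightarrow> 'c" where
  "\<psi>G \<alpha> = q2 (\<psi> (T1.lift \<alpha>))"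

lemma \<psi>G_q: 
  assumes t: "\<tau> \<in> arr S1"
  shows "\<psi>G (q1 \<tau>) = q2 (\<psi> \<tau>)"
proof -
  have l: "T1.lift (q1 \<tau>) \<in> arr S1" "q1 (T1.lift (q1 \<tau>)) = q1 \<tau>" using t by auto
  obtain u where "u \<in> Units_R" "\<tau> = T1.act u (T1.lift (q1 \<tau>))"
    using T1.fibre_act[OF l(1) t l(2)] .
  then show ?thesis
    using \<psi>_act[OF l(1)] \<psi>(1)[OF l(1)] unfolding \<psi>G_def by (metis T2.q_act)
qed

lemma \<psi>G_homeo: "homeomorphic_map (arr_top G1) (arr_top G2) \<psi>G"
proof (rule bijective_open_imp_homeomorphic_map)
  have q1m: "quotient_map (arr_top S1) (arr_top G1) q1"
    by (rule continuous_open_imp_quotient_map[OF T1.q_cont T1.q_open T1.q_surj])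
  have "continuous_map (arr_top S1) (arr_top G2) (q2 \<circ> \<psi>)"
    using homeomorphic_imp_continuous_map[OF \<psi>_homeo] T2.q_cont by (rule continuous_map_compose)
  then have "continuous_map (arr_top S1) (arr_top G2) (\<psi>G \<circ> q1)"
    by (rule continuous_map_eq) (simp add: \<psi>G_q)
  then show "continuous_map (arr_top G1) (arr_top G2) \<psi>G"
    using continuous_compose_quotient_map[OF q1m] by blast
  show "open_map (arr_top G1) (arr_top G2) \<psi>G"
    unfolding open_map_def
  proof (intro allI impI)
    fix U assume U: "openin (arr_top G1) U"
    have "openin (arr_top G2) (q2 ` (\<psi> ` {\<tau> \<in> arr S1. q1 \<tau> \<in> U}))"
      using T1.q_preimage_open[OF U] homeomorphic_imp_open_map[OF \<psi>_homeo] T2.q_open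
      unfolding open_map_def by blast
    moreover have "q2 ` (\<psi> ` {\<tau> \<in> arr S1. q1 \<tau> \<in> U}) = \<psi>G ` U"
    proof (intro set_eqI iffI)
      fix y assume "y \<in> q2 ` (\<psi> ` {\<tau> \<in> arr S1. q1 \<tau> \<in> U})"
      then show "y \<in> \<psi>G ` U" using \<psi>G_q by (auto intro!: image_eqI simp: \<psi>G_q[symmetric])
    next
      fix y assume "y \<in> \<psi>G ` U"
      then obtain \<alpha> where a: "\<alpha> \<in> U" "y = \<psi>G \<alpha>" by auto
      then have "\<alpha> \<in> arr G1" using openin_subset[OF U] by auto
      then show "y \<in> q2 ` (\<psi> ` {\<tau> \<in> arr S1. q1 \<tau> \<in> U})"
        using a by (auto simp: \<psi>G_def intro!: image_eqI[of _ q2 "\<psi> (T1.lift \<alpha>)"])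
    qed
    ultimately show "openin (arr_top G2) (\<psi>G ` U)" by simp
  qed
  show "\<psi>G ` arr G1 = arr G2"
  proof -
    have "\<psi>G ` arr G1 = (\<psi>G \<circ> q1) ` arr S1" by (simp only: T1.q_surj[symmetric] image_comp)
    also have "\<dots> = q2 ` (\<psi> ` arr S1)" unfolding image_comp by (rule image_cong) (simp_all add: \<psi>G_q)
    also have "\<psi> ` arr S1 = arr S2" using homeomorphic_imp_surjective_map[OF \<psi>_homeo] .
    finally show ?thesis using T2.q_surj by simp
  qed
  show "inj_on \<psi>G (arr G1)"
  proof (rule inj_onI)
    fix \<alpha> \<beta> assume a: "\<alpha> \<in> arr G1" "\<beta> \<in> arr G1" "\<psi>G \<alpha> = \<psi>G \<beta>"
    let ?s = "T1.lift \<alpha>" and ?t = "T1.lift \<beta>"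
    have l: "?s \<in> arr S1" "?t \<in> arr S1" "q1 ?s = \<alpha>" "q1 ?t = \<beta>" using a by auto
    have "q2 (\<psi> ?s) = q2 (\<psi> ?t)" using a(3) unfolding \<psi>G_def .
    then obtain u where u: "u \<in> Units_R" "\<psi> ?t = T2.act u (\<psi> ?s)"
      by (rule T2.fibre_act[OF \<psi>(1)[OF l(1)] \<psi>(1)[OF l(2)]])
    then have "\<psi> ?t = \<psi> (T1.act u ?s)" using \<psi>_act[OF l(1)] by simp
    then have "?t = T1.act u ?s" using inj_onD[OF \<psi>_inj] l u by simp
    then have "q1 ?t = q1 ?s" using T1.q_act[OF l(1) u(1)] by simp
    then show "\<alpha> = \<beta>" using l by simp
  qed
qed

lemma \<psi>G_hom: "groupoid_hom G1 G2 \<psi>G"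
  unfolding groupoid_hom_def
proof (intro conjI ballI)
  show "\<psi>G ` arr G1 \<subseteq> arr G2" using homeomorphic_imp_surjective_map[OF \<psi>G_homeo] by simp
  fix p assume "p \<in> composable G1"
  then obtain \<alpha> \<beta> where p: "p = (\<alpha>, \<beta>)" and a: "\<alpha> \<in> arr G1" "\<beta> \<in> arr G1" "src G1 \<alpha> = rng G1 \<beta>"
    by (auto simp: composable_def)
  let ?s = "T1.lift \<alpha>" and ?t = "T1.lift \<beta>"
  have l: "?s \<in> arr S1" "?t \<in> arr S1" "q1 ?s = \<alpha>" "q1 ?t = \<beta>" using a by auto
  have c: "src S1 ?s = rng S1 ?t" using T1.src_rng_iff[OF l(1,2)] a(3) l(3,4) by simp
  have m: "\<psi> (mul S1 ?s ?t) = mul S2 (\<psi> ?s) (\<psi> ?t)" "src S2 (\<psi> ?s) = rng S2 (\<psi> ?t)"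
    using hom_mul[OF \<psi>_hom l(1,2) c] by auto
  note pa = \<psi>(1)[OF l(1)] \<psi>(1)[OF l(2)]
  have "\<psi>G (mul G1 \<alpha> \<beta>) = \<psi>G (q1 (mul S1 ?s ?t))" using T1.q_mul[OF l(1,2) c] l(3,4) by simp
  also have "\<dots> = q2 (mul S2 (\<psi> ?s) (\<psi> ?t))" using \<psi>G_q[of "mul S1 ?s ?t"] l c m by simp
  also have "\<dots> = mul G2 (\<psi>G \<alpha>) (\<psi>G \<beta>)" using T2.q_mul[OF pa m(2)] by (simp add: \<psi>G_def)
  finally have "\<psi>G (mul G1 \<alpha> \<beta>) = mul G2 (\<psi>G \<alpha>) (\<psi>G \<beta>)" .
  moreover have "(\<psi>G \<alpha>, \<psi>G \<beta>) \<in> composable G2"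
    using m(2) pa T2.src_rng_iff[OF pa] by (simp add: composable_def \<psi>G_def)
  ultimately show "case p of (a, b) \<Rightarrow> (\<psi>G a, \<psi>G b) \<in> composable G2 \<and> \<psi>G (mul G1 a b) = mul G2 (\<psi>G a) (\<psi>G b)"
    using p by simp
qed

theorem twists_isomorphic: "twists_isomorphic G1 S1 i1 q1 G2 S2 i2 q2"
  unfolding twists_isomorphic_def tgroupoid_iso_def
proof (intro exI[of _ \<psi>] exI[of _ \<psi>G] conjI ballI \<psi>_hom \<psi>_homeo \<psi>G_hom \<psi>G_homeo)
  fix x and t :: 'r assume x: "x \<in> gunits G1" and t: "t \<in> Units_R"
  have "\<psi>G x = \<phi> x" using \<psi>G_q[of "i1 (x, 1)"] \<psi>_i[OF x, of 1] \<phi>_units[OF x] x by simp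
  then show "\<psi> (i1 (x, t)) = i2 (\<psi>G x, t)" using \<psi>_i[OF x t] by simp
next
  fix \<sigma> assume "\<sigma> \<in> arr S1"
  then show "q2 (\<psi> \<sigma>) = \<psi>G (q1 \<sigma>)" by (simp add: \<psi>G_q)
qed

end

section \<open>The equivalence\<close>

theorem corollary8p10:
  fixes G1 :: "'a tgroupoid" and S1 :: "'b tgroupoid"
    and i1 :: "'a \<times> 'r::comm_ring_1 \<Rightarrow> 'b" and q1 :: "'b \<Rightarrow> 'a"
    and G2 :: "'c tgroupoid" and S2 :: "'d tgroupoid"
    and i2 :: "'c \<times> 'r \<Rightarrow> 'd" and q2 :: "'d \<Rightarrow> 'c"
  assumes "indecomposable_ring TYPE('r)"
    and "ample G1" and "Hausdorff_space (arr_top G1)"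
    and "ample G2" and "Hausdorff_space (arr_top G2)"
    and "discrete_twist G1 S1 i1 q1"
    and "discrete_twist G2 S2 i2 q2"
    and "local_bisection_hypothesis G1 S1 i1 q1"
  shows "twists_isomorphic G1 S1 i1 q1 G2 S2 i2 q2 \<longleftrightarrow>
    (\<exists>\<Psi>. steinberg_iso G1 S1 i1 q1 G2 S2 i2 q2 \<Psi> \<and>
         diagonal_preserving G1 S1 i1 q1 G2 S2 i2 q2 \<Psi>)"
proof -
  interpret T: twist_pair G1 S1 i1 q1 G2 S2 i2 q2
    using assms by unfold_locales
  interpret R: twist_pair G2 S2 i2 q2 G1 S1 i1 q1
    by (rule T.swap)
  show ?thesis
  proof
    assume "twists_isomorphic G1 S1 i1 q1 G2 S2 i2 q2"
    then show "\<exists>\<Psi>. steinberg_iso G1 S1 i1 q1 G2 S2 i2 q2 \<Psi> \<and>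
         diagonal_preserving G1 S1 i1 q1 G2 S2 i2 q2 \<Psi>"
      using T.twists_isomorphic_sym R.algebras_isomorphic by blast
  next
    assume "\<exists>\<Psi>. steinberg_iso G1 S1 i1 q1 G2 S2 i2 q2 \<Psi> \<and>
         diagonal_preserving G1 S1 i1 q1 G2 S2 i2 q2 \<Psi>"
    then obtain \<Psi> where \<Psi>: "steinberg_iso G1 S1 i1 q1 G2 S2 i2 q2 \<Psi>"
      "diagonal_preserving G1 S1 i1 q1 G2 S2 i2 q2 \<Psi>" by blast
    interpret reconstruction G2 S2 i2 q2 G1 S1 i1 q1 "inv_into (steinberg G1 S1 i1 q1) \<Psi>"
      using T.steinberg_iso_inverse[OF \<Psi>] assms(8) by unfold_locales
    show "twists_isomorphic G1 S1 i1 q1 G2 S2 i2 q2"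
      using R.twists_isomorphic_sym twists_isomorphic by blast
  qed
qed

end
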